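(* Let $(X,\mathbb{P})$ be a spectrally positive Lévy process such that $\mathbb{P}(X_0=0)=1$, and for $x>0$ let $T_x=\inf\{s\ge 0:X_s=-x\}$. If $(X,\mathbb{P})$ is not a subordinator, then the following identity between measures holds on $(0,\infty)^2$ (in the variables $(t,x)$): $$\mathbb{P}(T_x\in \mathrm{d}t)\,\mathrm{d}x=\frac{x}{t}\,\mathbb{P}(-X_t\in \mathrm{d}x)\,\mathrm{d}t.$$
   Context: $X=(X_t)_{t\ge0}$ is a real-valued càdlàg Lévy process; spectrally positive means that it has no negative jumps. A subordinator is a Lévy process with non-decreasing paths. The convention $\inf\emptyset=\infty$ is used. *)

theory Defs
  imports "HOL-Probability.Probability"
begin

definition cadlag :: "(real \<Rightarrow> real) \<Rightarrow> bool" where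
  "cadlag f \<longleftrightarrow>
     (\<forall>t\<ge>0. continuous (at_right t) f) \<and> (\<forall>t>0. \<exists>l. (f \<longlongrightarrow> l) (at_left t))"

definition no_negative_jumps :: "(real \<Rightarrow> real) \<Rightarrow> bool" where
  "no_negative_jumps f \<longleftrightarrow> (\<forall>t>0. \<forall>l. (f \<longlongrightarrow> l) (at_left t) \<longrightarrow> l \<le> f t)"

text \<open>
  The time set is the half-line of nonnegative reals; values of \<open>X\<close> at negative times are
  irrelevant. Path properties are required almost surely. The initial value is not fixed to
  be zero here, so the independence clause includes the value at the first time point
  and stationarity compares with \<open>X h - X 0\<close>. Stochastic continuity follows from
  these clauses and the path regularity.
\<close>

definition levy_process :: "'a measure \<Rightarrow> (real \<Rightarrow> 'a \<Rightarrow> real) \<Rightarrow> bool" where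
  "levy_process M X \<longleftrightarrow>
     prob_space M \<and>
     (\<forall>t\<ge>0. X t \<in> borel_measurable M) \<and>
     (\<forall>(n::nat) (\<tau>::nat \<Rightarrow> real). 0 \<le> \<tau> 0 \<and> mono \<tau> \<longrightarrow>
        prob_space.indep_vars M (\<lambda>_. borel)
          (\<lambda>i \<omega>. case i of 0 \<Rightarrow> X (\<tau> 0) \<omega> | Suc j \<Rightarrow> X (\<tau> (Suc j)) \<omega> - X (\<tau> j) \<omega>) {..n}) \<and>
     (\<forall>s\<ge>0. \<forall>h\<ge>0.
        distr M borel (\<lambda>\<omega>. X (s + h) \<omega> - X s \<omega>) = distr M borel (\<lambda>\<omega>. X h \<omega> - X 0 \<omega>)) \<and>
     (AE \<omega> in M. cadlag (\<lambda>t. X t \<omega>))"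

definition spectrally_positive :: "'a measure \<Rightarrow> (real \<Rightarrow> 'a \<Rightarrow> real) \<Rightarrow> bool" where
  "spectrally_positive M X \<longleftrightarrow> (AE \<omega> in M. no_negative_jumps (\<lambda>t. X t \<omega>))"

definition subordinator :: "'a measure \<Rightarrow> (real \<Rightarrow> 'a \<Rightarrow> real) \<Rightarrow> bool" where
  "subordinator M X \<longleftrightarrow> levy_process M X \<and> (AE \<omega> in M. mono_on {0..} (\<lambda>t. X t \<omega>))"

text \<open>In \<^typ>\<open>ereal\<close> the infimum of the empty set is \<open>\<infinity>\<close>.\<close>

definition passage_time :: "(real \<Rightarrow> 'a \<Rightarrow> real) \<Rightarrow> real \<Rightarrow> 'a \<Rightarrow> ereal" where
  "passage_time X x \<omega> = Inf {ereal s | s. 0 \<le> s \<and> X s \<omega> = - x}"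

text \<open>
  The measure \<open>P(T\<^sub>x \<in> dt) dx\<close> on the open quadrant, evaluated at a Borel set \<open>B\<close> of
  pairs \<open>(t, x)\<close>; paths with \<open>T\<^sub>x = \<infinity>\<close> do not contribute. Probabilities are
  taken in the completion of \<open>M\<close> because a hitting time need not be measurable with respect
  to an uncompleted sigma-algebra.
\<close>

definition passage_time_measure ::
    "'a measure \<Rightarrow> (real \<Rightarrow> 'a \<Rightarrow> real) \<Rightarrow> (real \<times> real) set \<Rightarrow> ennreal" where
  "passage_time_measure M X B =
     (\<integral>\<^sup>+x\<in>{0<..}. emeasure (completion M)
        {\<omega> \<in> space M. \<exists>t. passage_time X x \<omega> = ereal t \<and> (t, x) \<in> B} \<partial>lborel)"

text \<open>The measure \<open>(x / t) P(- X\<^sub>t \<in> dx) dt\<close>, evaluated at a Borel set of pairs \<open>(t, x)\<close>.\<close>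

definition kendall_measure ::
    "'a measure \<Rightarrow> (real \<Rightarrow> 'a \<Rightarrow> real) \<Rightarrow> (real \<times> real) set \<Rightarrow> ennreal" where
  "kendall_measure M X B =
     (\<integral>\<^sup>+t\<in>{0<..}.
        (\<integral>\<^sup>+x\<in>{0<..}. ennreal (x / t) * indicator B (t, x) \<partial>distr M borel (\<lambda>\<omega>. - X t \<omega>))
      \<partial>lborel)"

end

theory Submission
  imports Defs
begin

text \<open>
  Put \<open>Y = - X\<close>. Since \<open>Y\<close> has no upward jumps, it sits exactly at level \<open>x\<close> at the time \<open>\<rho>\<^sub>x\<close>
  which is the infimum of all times with \<open>Y > x\<close>. For \<open>q > 0\<close> let \<open>U\<^sub>q\<close> be the \<open>q\<close>-potential measure
  of \<open>Y\<close>, which gives to a Borel set the expected amount of time that \<open>Y\<close> spends in it, where time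
  is discounted by \<open>exp (- q t)\<close>.

  Levels above \<open>x\<close> are visited only after \<open>\<rho>\<^sub>x\<close>, so the strong Markov property at \<open>\<rho>\<^sub>x\<close> gives
  \<open>U\<^sub>q (y, \<infinity>) = L\<^sub>q(x) U\<^sub>q (y - x, \<infinity>)\<close> for \<open>0 \<le> x \<le> y\<close>, where \<open>L\<^sub>q(x) = E (exp (- q \<rho>\<^sub>x))\<close>, with
  \<open>exp (- \<infinity>) = 0\<close> (\<open>potential_tail_factor\<close>). Here \<open>U\<^sub>q (0, \<infinity>) > 0\<close>, as otherwise \<open>Y \<le> 0\<close> at all
  times almost surely, and by stationarity of the increments \<open>X\<close> would be a subordinator. Dividing by
  this number one sees that \<open>L\<^sub>q\<close> is multiplicative in \<open>x\<close>. Hence \<open>L\<^sub>q(x) = exp (- \<Phi>(q) x)\<close>, and on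
  \<open>(0, \<infinity>)\<close> the measure \<open>U\<^sub>q\<close> has a density of the form \<open>c(q) exp (- \<Phi>(q) x)\<close>
  (\<open>passage_transform_eq_exp\<close>, \<open>potential_positive_half_line\<close>).

  The two constants are related by \<open>c(q) = \<Phi>'(q)\<close>. To see this, insert these exponential forms into
  the resolvent equation \<open>U\<^sub>q = U\<^sub>r + (r - q) (U\<^sub>r convolved with U\<^sub>q)\<close>, evaluated on a half-line
  \<open>(x, \<infinity>)\<close>, and let \<open>x\<close> tend to infinity (\<open>potential_rate_bounds\<close>). Differentiating \<open>L\<^sub>q(x)\<close> in \<open>q\<close>
  then shows that \<open>E (\<rho>\<^sub>x exp (- q \<rho>\<^sub>x)) = x c(q) exp (- \<Phi>(q) x)\<close> (\<open>passage_time_moment\<close>), and this is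
  \<open>x\<close> times the density of \<open>U\<^sub>q\<close>. In other words, over every Borel set of levels \<open>x\<close> the measures
  \<open>t P(\<rho>\<^sub>x \<in> dt) dx\<close> and \<open>x P(Y\<^sub>t \<in> dx) dt\<close> have the same Laplace transform in \<open>t\<close>. By uniqueness of
  Laplace transforms they agree (\<open>joint_laws_eq\<close>), and division by \<open>t\<close> gives the identity for \<open>\<rho>\<^sub>x\<close>
  (\<open>kendall_exceedance\<close>).

  It remains to replace \<open>\<rho>\<^sub>x\<close> by the hitting time \<open>T\<^sub>x\<close>. The two may differ on single paths, but \<open>T\<^sub>x\<close>
  lies between \<open>\<rho>\<^sub>x\<close> and every \<open>\<rho>\<^sub>y\<close> with \<open>y < x\<close>, and \<open>L\<^sub>q\<close> is continuous, so they agree almost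
  surely for each fixed \<open>x > 0\<close> (\<open>hitting_time_eq_exceedance_time\<close>).
\<close>

section \<open>Exponential integrals, multiplicative functions and Laplace transforms\<close>

lemma nn_integral_exp_from:
  fixes q a :: real
  assumes "0 < q"
  shows "(\<integral>\<^sup>+t. ennreal (exp (- (q * t))) * indicator {a..} t \<partial>lborel) = ennreal (exp (- (q * a)) / q)"
proof -
  have "((\<lambda>t. - exp (- q * t) / q) \<longlongrightarrow> - 0 / q) at_top"
    using assms
    by (intro tendsto_intros filterlim_compose[OF exp_at_bot]
          filterlim_tendsto_neg_mult_at_bot[OF tendsto_const _ filterlim_ident]) auto
  moreover have "((\<lambda>t. - exp (- q * t) / q) has_real_derivative exp (- q * x)) (at x)" for x
    using assms by (auto intro!: derivative_eq_intros)
  ultimately show ?thesis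
    by (subst nn_integral_FTC_atLeast[where F="\<lambda>t. - exp (- q * t) / q" and T="- 0 / q"]) auto
qed

lemma nn_integral_exp_between:
  fixes d a b :: real
  assumes "0 < d" "a \<le> b"
  shows "(\<integral>\<^sup>+t. ennreal (exp (- (d * t))) * indicator {a..<b} t \<partial>lborel) =
    ennreal ((exp (- (d * a)) - exp (- (d * b))) / d)"
proof -
  have "ennreal (exp (- (d * b)) / d) + (\<integral>\<^sup>+t. ennreal (exp (- (d * t))) * indicator {a..<b} t \<partial>lborel) =
      (\<integral>\<^sup>+t. ennreal (exp (- (d * t))) * indicator {b..} t + ennreal (exp (- (d * t))) * indicator {a..<b} t \<partial>lborel)"
    using assms by (subst nn_integral_add) (auto simp: nn_integral_exp_from)
  also have "\<dots> = (\<integral>\<^sup>+t. ennreal (exp (- (d * t))) * indicator {a..} t \<partial>lborel)"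
    using assms by (intro nn_integral_cong) (auto simp: indicator_def)
  also have "\<dots> = ennreal (exp (- (d * a)) / d)"
    using assms by (simp add: nn_integral_exp_from)
  also have "\<dots> = ennreal (exp (- (d * b)) / d) + ennreal ((exp (- (d * a)) - exp (- (d * b))) / d)"
    using assms by (subst ennreal_plus[symmetric]) (auto simp: field_simps)
  finally show ?thesis by (simp add: ennreal_add_left_cancel)
qed

lemma exp_minus_one_bounds:
  fixes y :: real
  shows "y \<le> exp y - 1" "exp y - 1 \<le> y * exp y"
proof -
  show "y \<le> exp y - 1" using exp_ge_add_one_self[of y] by linarith
  have "exp y * (1 - y) \<le> exp y * exp (- y)"
    using exp_ge_add_one_self[of "- y"] by (intro mult_left_mono) auto
  then show "exp y - 1 \<le> y * exp y" by (simp add: exp_minus algebra_simps)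
qed

text \<open>
  The function \<open>- ln L\<close> is additive and monotone. Comparing its value at \<open>n x\<close> with the values at the
  two integers next to \<open>n x\<close> shows that it differs from a linear function by at most a
  constant divided by \<open>n\<close>.
\<close>
lemma decreasing_multiplicative_eq_exp:
  fixes L :: "real \<Rightarrow> real"
  assumes mult: "\<And>x y. 0 \<le> x \<Longrightarrow> 0 \<le> y \<Longrightarrow> L (x + y) = L x * L y"
    and mono: "\<And>x y. 0 \<le> x \<Longrightarrow> x \<le> y \<Longrightarrow> L y \<le> L x"
    and pos: "\<And>x. 0 \<le> x \<Longrightarrow> 0 < L x"
    and "0 \<le> x"
  shows "L x = exp (x * ln (L 1))"
proof -
  define g where "g x = - ln (L x)" for x
  have add: "g (x + y) = g x + g y" if "0 \<le> x" "0 \<le> y" for x y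
    using that by (simp add: g_def mult ln_mult_pos pos)
  have gmono: "g x \<le> g y" if "0 \<le> x" "x \<le> y" for x y
    using that mono[of x y] pos[of x] pos[of y] by (simp add: g_def)
  have g0: "g 0 = 0" using add[of 0 0] by simp
  have gn: "g (real n * x) = real n * g x" if "0 \<le> x" for n x
    using that by (induction n) (auto simp: g0 add algebra_simps)
  have g1: "0 \<le> g 1" using gmono[of 0 1] g0 by simp
  have close: "real n * \<bar>g x - x * g 1\<bar> \<le> g 1" for n
  proof -
    define k where "k = nat \<lfloor>real n * x\<rfloor>"
    have k: "real k \<le> real n * x" "real n * x \<le> real (Suc k)"
      unfolding k_def using \<open>0 \<le> x\<close> by (simp_all add: of_nat_nat) linarith+
    have a: "real k * g 1 \<le> real n * g x"
      using gn[of 1 k] gn[of x n] gmono[OF _ k(1)] \<open>0 \<le> x\<close> by simp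
    have b: "real n * g x \<le> real (Suc k) * g 1"
      using gn[of 1 "Suc k"] gn[of x n] gmono[OF _ k(2)] \<open>0 \<le> x\<close> by simp
    have c: "real k * g 1 \<le> real n * x * g 1" "real n * x * g 1 \<le> real (Suc k) * g 1"
      using k g1 by (intro mult_right_mono; simp)+
    have "\<bar>real n * g x - real n * x * g 1\<bar> \<le> g 1"
      using a b c by (simp add: abs_le_iff distrib_right)
    moreover have "real n * g x - real n * x * g 1 = real n * (g x - x * g 1)"
      by (simp add: right_diff_distrib)
    ultimately show ?thesis by (simp add: abs_mult)
  qed
  have "\<bar>g x - x * g 1\<bar> = 0"
  proof (rule ccontr)
    assume "\<bar>g x - x * g 1\<bar> \<noteq> 0"
    then obtain n where "real n * \<bar>g x - x * g 1\<bar> > g 1"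
      using reals_Archimedean3[of "\<bar>g x - x * g 1\<bar>"] by auto
    then show False using close[of n] by simp
  qed
  then have "ln (L x) = x * ln (L 1)" by (simp add: g_def)
  then show ?thesis using exp_ln[OF pos[OF \<open>0 \<le> x\<close>]] by simp
qed

text \<open>
  Under the substitution \<open>u = exp (- t)\<close> the Laplace transforms at natural arguments become the moments
  of measures on \<open>[0, 1]\<close>. By the Weierstrass approximation theorem these determine the
  integrals of continuous functions, and hence the masses of half-lines.
\<close>
lemma laplace_unique:
  fixes N1 N2 :: "real measure"
  assumes fin: "finite_measure N1" "finite_measure N2"
    and sets: "sets N1 = sets borel" "sets N2 = sets borel"
    and pos: "AE t in N1. 0 < t" "AE t in N2. 0 < t"
    and eq: "\<And>n::nat. (\<integral>\<^sup>+t. ennreal (exp (- real n * t)) \<partial>N1) = (\<integral>\<^sup>+t. ennreal (exp (- real n * t)) \<partial>N2)"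
  shows "N1 = N2"
proof -
  interpret N1: finite_measure N1 by fact
  interpret N2: finite_measure N2 by fact
  have [measurable_cong]: "sets N1 = sets borel" "sets N2 = sets borel" by fact+
  have int: "integrable N1 g" "integrable N2 g"
    if [measurable]: "g \<in> borel_measurable borel" and "\<And>t. 0 < t \<Longrightarrow> \<bar>g t\<bar> \<le> K"
    for g :: "real \<Rightarrow> real" and K
    using pos that
    by (auto intro!: N1.integrable_const_bound[where B=K] N2.integrable_const_bound[where B=K])
  have expn: "(\<integral>t. exp (- t) ^ n \<partial>N1) = (\<integral>t. exp (- t) ^ n \<partial>N2)" for n
  proof -
    have *: "exp (- t) ^ n = exp (- real n * t)" for t :: real
      by (simp add: exp_of_nat_mult[symmetric])
    have i: "integrable N1 (\<lambda>t. exp (- real n * t))" "integrable N2 (\<lambda>t. exp (- real n * t))"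
      using int[of "\<lambda>t. exp (- real n * t)" 1] by auto
    show ?thesis
      using eq[of n] nn_integral_eq_integral[OF i(1)] nn_integral_eq_integral[OF i(2)]
      by (simp add: * integral_nonneg_AE)
  qed
  have poly: "(\<integral>t. p (exp (- t)) \<partial>N1) = (\<integral>t. p (exp (- t)) \<partial>N2)"
    if p: "real_polynomial_function p" for p
  proof -
    obtain a n where p: "p = (\<lambda>x. \<Sum>i\<le>n. a i * x ^ i)"
      using p real_polynomial_function_iff_sum by blast
    have "integrable N1 (\<lambda>t. exp (-t) ^ i)" "integrable N2 (\<lambda>t. exp (-t) ^ i)" for i
      by (rule int[where K=1]; simp add: power_le_one)+
    then show ?thesis
      unfolding p by (simp add: expn)
  qed
  have cont: "(\<integral>t. f (exp (- t)) \<partial>N1) = (\<integral>t. f (exp (- t)) \<partial>N2)"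
    if f: "continuous_on UNIV f" for f :: "real \<Rightarrow> real"
  proof -
    have [measurable]: "f \<in> borel_measurable borel"
      using f by (rule borel_measurable_continuous_onI)
    have bf: "compact (f ` {0..1})"
      by (intro compact_continuous_image continuous_on_subset[OF f]) auto
    obtain K where "\<forall>y\<in>f ` {0..1}. norm y \<le> K"
      using compact_imp_bounded[OF bf] unfolding bounded_iff by blast
    then have K: "\<bar>f x\<bar> \<le> K" if "x \<in> {0..1}" for x
      using that by auto
    have If: "integrable N1 (\<lambda>t. f (exp (- t)))" "integrable N2 (\<lambda>t. f (exp (- t)))"
      by (rule int[where K=K]; simp add: K)+
    have le: "\<bar>(\<integral>t. f (exp (- t)) \<partial>N1) - (\<integral>t. f (exp (- t)) \<partial>N2)\<bar>
        \<le> e * (measure N1 (space N1) + measure N2 (space N2))" if "0 < e" for e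
    proof -
      obtain p where p: "real_polynomial_function p" "\<And>x. x \<in> {0..1} \<Longrightarrow> \<bar>f x - p x\<bar> < e"
        using Stone_Weierstrass_real_polynomial_function[of "{0..1}" f e] \<open>0 < e\<close>
          continuous_on_subset[OF f] by auto
      have pc: "continuous_on UNIV p"
        using p(1) continuous_on_polymonial_function real_polynomial_function_eq by blast
      have [measurable]: "p \<in> borel_measurable borel"
        using pc by (rule borel_measurable_continuous_onI)
      have bp: "\<bar>p x\<bar> \<le> K + e" if "x \<in> {0..1}" for x
        using p(2)[OF that] K[OF that] by linarith
      have Ip: "integrable N1 (\<lambda>t. p (exp (- t)))" "integrable N2 (\<lambda>t. p (exp (- t)))"
        by (rule int[where K="K + e"]; simp add: bp)+
      have d: "\<bar>(\<integral>t. f (exp (- t)) \<partial>N) - (\<integral>t. p (exp (- t)) \<partial>N)\<bar> \<le> e * measure N (space N)"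
        if N: "finite_measure N" and I: "integrable N (\<lambda>t. f (exp (- t)))" "integrable N (\<lambda>t. p (exp (- t)))"
          and N0: "AE t in N. 0 < t" for N :: "real measure"
      proof -
        interpret finite_measure N by fact
        have "\<bar>(\<integral>t. f (exp (- t)) \<partial>N) - (\<integral>t. p (exp (- t)) \<partial>N)\<bar> = \<bar>\<integral>t. f (exp (- t)) - p (exp (- t)) \<partial>N\<bar>"
          using I by simp
        also have "\<dots> \<le> (\<integral>t. \<bar>f (exp (- t)) - p (exp (- t))\<bar> \<partial>N)" by (rule integral_abs_bound)
        also have "\<dots> \<le> (\<integral>t. e \<partial>N)"
        proof (rule integral_mono_AE)
          show "AE t in N. \<bar>f (exp (- t)) - p (exp (- t))\<bar> \<le> e"
            using N0 by eventually_elim (simp add: p(2) less_imp_le)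
        qed (use I in simp_all)
        finally show ?thesis by (simp add: mult.commute)
      qed
      show ?thesis
        using d[OF fin(1) If(1) Ip(1) pos(1)] d[OF fin(2) If(2) Ip(2) pos(2)] poly[OF p(1)]
        by (simp add: algebra_simps)
    qed
    define K where "K = measure N1 (space N1) + measure N2 (space N2)"
    have "K \<ge> 0" by (simp add: K_def)
    have "\<bar>(\<integral>t. f (exp (- t)) \<partial>N1) - (\<integral>t. f (exp (- t)) \<partial>N2)\<bar> \<le> 0 + e" if "0 < e" for e
    proof -
      have "e / (K + 1) * K \<le> e" using \<open>K \<ge> 0\<close> that by (simp add: divide_simps algebra_simps)
      then show ?thesis
        using le[of "e / (K + 1)"] that \<open>K \<ge> 0\<close> unfolding K_def[symmetric] by auto
    qed
    then have "\<bar>(\<integral>t. f (exp (- t)) \<partial>N1) - (\<integral>t. f (exp (- t)) \<partial>N2)\<bar> \<le> 0"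
      by (rule field_le_epsilon)
    then show ?thesis by simp
  qed
  have tail: "measure N1 {x<..} = measure N2 {x<..}" for x
  proof -
    define f where "f m u = min 1 (max 0 (real m * (exp (-x) - u)))" for m and u :: real
    have [measurable]: "f m \<in> borel_measurable borel" for m
      unfolding f_def by measurable
    have fc: "continuous_on UNIV (f m)" for m
      unfolding f_def by (intro continuous_intros)
    have flim: "(\<lambda>m. f m (exp (-t))) \<longlonglongrightarrow> indicator {x<..} t" for t
    proof (cases "x < t")
      case True
      define d where "d = exp (-x) - exp (-t)"
      have "d > 0" using True by (simp add: d_def)
      then obtain M where M: "real M * d > 1"
        using reals_Archimedean3 by blast
      have "f m (exp (-t)) = 1" if "m \<ge> M" for m
      proof -
        have "real M * d \<le> real m * d" using that \<open>d > 0\<close> by simp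
        then show ?thesis using M by (simp add: f_def d_def[symmetric])
      qed
      then have "eventually (\<lambda>m. f m (exp (-t)) = 1) sequentially"
        unfolding eventually_sequentially by blast
      then show ?thesis using True by (simp add: tendsto_eventually)
    next
      case False
      then have "real m * (exp (-x) - exp (-t)) \<le> 0" for m
        by (simp add: mult_nonneg_nonpos)
      then show ?thesis using False by (simp add: f_def max_absorb1)
    qed
    have lim: "(\<lambda>m. \<integral>t. f m (exp (-t)) \<partial>N) \<longlonglongrightarrow> measure N {x<..}"
      if "finite_measure N" and [measurable_cong]: "sets N = sets borel" for N
    proof -
      interpret finite_measure N by fact
      have "(\<lambda>m. \<integral>t. f m (exp (-t)) \<partial>N) \<longlonglongrightarrow> (\<integral>t. indicator {x<..} t \<partial>N)"
        by (rule integral_dominated_convergence[where w="\<lambda>_. 1"]) (auto simp: flim, simp add: f_def)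
      then show ?thesis using that(2) sets_eq_imp_space_eq[OF that(2)] by simp
    qed
    show ?thesis
      using lim[OF fin(1) sets(1)] lim[OF fin(2) sets(2)] cont[OF fc] LIMSEQ_unique by simp
  qed
  show ?thesis
    by (rule measure_eqI_lessThan)
      (use sets tail in \<open>auto simp: N1.emeasure_eq_measure N2.emeasure_eq_measure\<close>)
qed

section \<open>Exceedance times of upward skip-free processes\<close>

text \<open>
  These are the properties of \<open>Y = - X\<close> on which the argument rests, for a version whose paths are
  regular without exception. The Markov property is stated for the events that decide whether a level is
  exceeded at finitely many times, since such events approximate everything that the exceedance
  time depends on. Setting \<open>Y = 0\<close> at negative times makes \<open>Y\<close> a function on the whole real line,
  so that joint measurability in time and path holds without restricting the time set.
\<close>
locale skip_free_process = prob_space M for M :: "'a measure" +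
  fixes Y :: "real \<Rightarrow> 'a \<Rightarrow> real"
  assumes Y_measurable: "\<And>t. Y t \<in> borel_measurable M"
    and Y_nonpos [simp]: "\<And>t \<omega>. t \<le> 0 \<Longrightarrow> Y t \<omega> = 0"
    and right_continuous: "\<And>t \<omega>. 0 \<le> t \<Longrightarrow> ((\<lambda>s. Y s \<omega>) \<longlongrightarrow> Y t \<omega>) (at_right t)"
    and no_upward_jump: "\<And>t x \<omega>. 0 < t \<Longrightarrow> (\<And>s. 0 \<le> s \<Longrightarrow> s < t \<Longrightarrow> Y s \<omega> \<le> x) \<Longrightarrow> Y t \<omega> \<le> x"
    and markov: "\<And>F b u x f. finite F \<Longrightarrow> F \<subseteq> {0..b} \<Longrightarrow> 0 \<le> b \<Longrightarrow> 0 \<le> u \<Longrightarrow>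
      f \<in> borel_measurable borel \<Longrightarrow>
      (\<integral>\<^sup>+\<omega>. indicator {\<omega>. \<exists>s\<in>F. x < Y s \<omega>} \<omega> * f (Y (b + u) \<omega>) \<partial>M) =
      (\<integral>\<^sup>+\<omega>. indicator {\<omega>. \<exists>s\<in>F. x < Y s \<omega>} \<omega> * (\<integral>\<^sup>+\<omega>'. f (Y b \<omega> + Y u \<omega>') \<partial>M) \<partial>M)"
    and not_nonincreasing: "\<not> (AE \<omega> in M. \<forall>t\<ge>0. Y t \<omega> \<le> 0)"
begin

sublocale lborel_M: pair_sigma_finite lborel M ..

text \<open>
  By right-continuity \<open>Y\<close> is the limit of the processes that look at \<open>Y\<close> at the next point of
  the grid of mesh \<open>1 / n\<close> to the right of \<open>t\<close>; each of these depends on \<open>t\<close> through countably many values.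
\<close>
lemma Y_jointly_measurable: "(\<lambda>p. Y (fst p) (snd p)) \<in> borel_measurable (borel \<Otimes>\<^sub>M M)"
proof (rule borel_measurable_LIMSEQ_real)
  fix p :: "real \<times> 'a"
  obtain t \<omega> where p: "p = (t, \<omega>)" by (cases p)
  define s where "s n = real_of_int (\<lfloor>real (Suc n) * t\<rfloor> + 1) / real (Suc n)" for n
  have s1: "t < s n" for n
  proof -
    have "real (Suc n) * t < real_of_int (\<lfloor>real (Suc n) * t\<rfloor> + 1)"
      using floor_correct[of "real (Suc n) * t"] by linarith
    then show ?thesis unfolding s_def by (simp add: field_simps)
  qed
  have s2: "s n \<le> t + 1 / real (Suc n)" for n
  proof -
    have "real_of_int (\<lfloor>real (Suc n) * t\<rfloor> + 1) \<le> real (Suc n) * t + 1"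
      using floor_correct[of "real (Suc n) * t"] by linarith
    then have "s n \<le> (real (Suc n) * t + 1) / real (Suc n)"
      unfolding s_def by (rule divide_right_mono) simp
    then show ?thesis by (simp add: add_divide_distrib)
  qed
  have lim: "s \<longlonglongrightarrow> t"
  proof (rule tendsto_sandwich[where f="\<lambda>_. t" and h="\<lambda>n. t + 1 / real (Suc n)"])
    show "(\<lambda>n. t + 1 / real (Suc n)) \<longlonglongrightarrow> t"
      using tendsto_add[OF tendsto_const[of t] LIMSEQ_Suc[OF lim_1_over_n]] by simp
  qed (use s1 s2 in \<open>simp_all add: less_imp_le\<close>)
  have "(\<lambda>n. Y (s n) \<omega>) \<longlonglongrightarrow> Y t \<omega>"
  proof (cases "0 \<le> t")
    case True
    have "filterlim s (at_right t) sequentially"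
      using lim s1 by (simp add: filterlim_at less_imp_neq[symmetric] always_eventually)
    then show ?thesis
      using filterlim_compose[OF right_continuous[OF True]] by blast
  next
    case False
    then have "eventually (\<lambda>n. s n < 0) sequentially"
      using order_tendstoD(2)[OF lim] by auto
    then have "eventually (\<lambda>n. Y (s n) \<omega> = Y t \<omega>) sequentially"
      by eventually_elim (use False in auto)
    then show ?thesis by (rule tendsto_eventually)
  qed
  then show "(\<lambda>n. Y (real_of_int (\<lfloor>real (Suc n) * fst p\<rfloor> + 1) / real (Suc n)) (snd p))
      \<longlonglongrightarrow> Y (fst p) (snd p)"
    by (simp add: p s_def)
next
  fix n
  show "(\<lambda>p. Y (real_of_int (\<lfloor>real (Suc n) * fst p\<rfloor> + 1) / real (Suc n)) (snd p))
      \<in> borel_measurable (borel \<Otimes>\<^sub>M M)"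
    by (rule measurable_compose_countable[where f="\<lambda>(i::int) p. Y (real_of_int (i + 1) / real (Suc n)) (snd p)"
          and g="\<lambda>p. \<lfloor>real (Suc n) * fst p\<rfloor>"])
       (use Y_measurable in measurable)
qed

lemma measurable_Y [measurable (raw)]:
  assumes "f \<in> borel_measurable N" "g \<in> measurable N M"
  shows "(\<lambda>w. Y (f w) (g w)) \<in> borel_measurable N"
  using measurable_compose[OF measurable_Pair[OF assms] Y_jointly_measurable] by simp

definition exceeds :: "real \<Rightarrow> 'a \<Rightarrow> bool" where
  "exceeds x \<omega> \<longleftrightarrow> (\<exists>s\<ge>0. x < Y s \<omega>)"

text \<open>
  The value \<open>0\<close> on paths that never exceed \<open>x\<close> is arbitrary; every statement in which this
  case could matter carries the condition \<open>exceeds x \<omega>\<close>.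
\<close>
definition exceedance_time :: "real \<Rightarrow> 'a \<Rightarrow> real" where
  "exceedance_time x \<omega> = (if exceeds x \<omega> then Inf {s. 0 \<le> s \<and> x < Y s \<omega>} else 0)"

lemma right_neighbourhood_below:
  assumes "0 \<le> t" "Y t \<omega> < x"
  obtains b where "t < b" "\<And>s. t \<le> s \<Longrightarrow> s < b \<Longrightarrow> Y s \<omega> < x"
proof -
  have "eventually (\<lambda>s. Y s \<omega> < x) (at_right t)"
    using order_tendstoD(2)[OF right_continuous[OF assms(1)] assms(2)] .
  then obtain b where "t < b" "\<forall>s>t. s < b \<longrightarrow> Y s \<omega> < x"
    using eventually_at_right[of t "t + 1"] by auto
  then show ?thesis using that[of b] assms(2) by (metis order_le_less)
qed

lemma right_neighbourhood_above:
  assumes "0 \<le> t" "x < Y t \<omega>"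
  obtains b where "t < b" "\<And>s. t \<le> s \<Longrightarrow> s < b \<Longrightarrow> x < Y s \<omega>"
proof -
  have "eventually (\<lambda>s. x < Y s \<omega>) (at_right t)"
    using order_tendstoD(1)[OF right_continuous[OF assms(1)] assms(2)] .
  then obtain b where "t < b" "\<forall>s>t. s < b \<longrightarrow> x < Y s \<omega>"
    using eventually_at_right[of t "t + 1"] by auto
  then show ?thesis using that[of b] assms(2) by (metis order_le_less)
qed

text \<open>
  Right-continuity turns one exceedance into exceedances on a whole interval, which contains rational
  times. This makes exceedance times measurable jointly in level and path, and exhibits the
  event as a limit of events that depend on finitely many times.
\<close>
lemma exceedance_time_less_iff:
  "exceeds x \<omega> \<and> exceedance_time x \<omega> < t \<longleftrightarrow>
     (\<exists>r::rat. 0 \<le> real_of_rat r \<and> real_of_rat r < t \<and> x < Y (real_of_rat r) \<omega>)"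
proof -
  have "exceeds x \<omega> \<and> exceedance_time x \<omega> < t \<longleftrightarrow> (\<exists>s\<ge>0. s < t \<and> x < Y s \<omega>)"
  proof (cases "exceeds x \<omega>")
    case True
    then have "exceedance_time x \<omega> < t \<longleftrightarrow> (\<exists>s\<in>{s. 0 \<le> s \<and> x < Y s \<omega>}. s < t)"
      unfolding exceedance_time_def exceeds_def
      by (simp only: if_True, intro cInf_less_iff) (auto intro!: bdd_belowI[of _ 0])
    then show ?thesis using True by auto
  qed (auto simp: exceeds_def)
  also have "\<dots> \<longleftrightarrow> (\<exists>r::rat. 0 \<le> real_of_rat r \<and> real_of_rat r < t \<and> x < Y (real_of_rat r) \<omega>)"
  proof safe
    fix s assume s: "0 \<le> s" "s < t" "x < Y s \<omega>"
    obtain b where b: "s < b" "\<And>r. s \<le> r \<Longrightarrow> r < b \<Longrightarrow> x < Y r \<omega>"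
      using right_neighbourhood_above[OF s(1,3)] by blast
    obtain r where "s < real_of_rat r" "real_of_rat r < min b t"
      using of_rat_dense[of s "min b t"] b(1) s(2) by auto
    moreover from this have "0 \<le> real_of_rat r" using s(1) by linarith
    ultimately show "\<exists>r::rat. 0 \<le> real_of_rat r \<and> real_of_rat r < t \<and> x < Y (real_of_rat r) \<omega>"
      using b(2)[of "real_of_rat r"] by (intro exI[of _ r] conjI) simp_all
  qed blast
  finally show ?thesis .
qed

lemma exceedance_time_nonneg: "0 \<le> exceedance_time x \<omega>"
  unfolding exceedance_time_def exceeds_def by (auto intro!: cInf_greatest)

lemma exceedance_time_le:
  assumes "0 \<le> s" "x < Y s \<omega>"
  shows "exceeds x \<omega>" "exceedance_time x \<omega> \<le> s"
proof -
  show "exceeds x \<omega>" using assms by (auto simp: exceeds_def)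
  then show "exceedance_time x \<omega> \<le> s"
    unfolding exceedance_time_def using assms by (auto intro!: cInf_lower bdd_belowI[of _ 0])
qed

text \<open>
  Before \<open>\<rho>\<^sub>x\<close> the path is at or below \<open>x\<close>, and so is \<open>Y\<close> at \<open>\<rho>\<^sub>x\<close> because there are no upward jumps;
  right after \<open>\<rho>\<^sub>x\<close> there are times with \<open>Y > x\<close>, so right-continuity gives the other inequality.
\<close>
lemma Y_exceedance_time:
  assumes "exceeds x \<omega>" "0 \<le> x"
  shows "Y (exceedance_time x \<omega>) \<omega> = x"
proof (rule antisym)
  let ?r = "exceedance_time x \<omega>"
  have below: "Y s \<omega> \<le> x" if "0 \<le> s" "s < ?r" for s
    using exceedance_time_le(2)[of s x \<omega>] that by force
  show "Y ?r \<omega> \<le> x"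
  proof (cases "?r = 0")
    case False
    then have "0 < ?r" using exceedance_time_nonneg[of x \<omega>] by simp
    then show ?thesis using no_upward_jump below by blast
  qed (use \<open>0 \<le> x\<close> in simp)
  show "x \<le> Y ?r \<omega>"
  proof (rule ccontr)
    assume "\<not> x \<le> Y ?r \<omega>"
    then obtain b where b: "?r < b" "\<And>s. ?r \<le> s \<Longrightarrow> s < b \<Longrightarrow> Y s \<omega> < x"
      using right_neighbourhood_below[OF exceedance_time_nonneg[of x \<omega>]] by (metis not_le)
    obtain r where r: "0 \<le> real_of_rat r" "real_of_rat r < b" "x < Y (real_of_rat r) \<omega>"
      using assms(1) b(1) exceedance_time_less_iff[of x \<omega> b] by blast
    show False
      using b(2)[of "real_of_rat r"] exceedance_time_le(2)[OF r(1,3)] r by simp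
  qed
qed

lemma exceedance_time_pos:
  assumes "exceeds x \<omega>" "0 < x"
  shows "0 < exceedance_time x \<omega>"
  using Y_exceedance_time[of x \<omega>] assms exceedance_time_nonneg[of x \<omega>]
  by (cases "exceedance_time x \<omega> = 0") auto

lemma exceedance_mono:
  assumes "x \<le> y" "exceeds y \<omega>"
  shows "exceeds x \<omega>" "exceedance_time x \<omega> \<le> exceedance_time y \<omega>"
proof -
  show *: "exceeds x \<omega>" using assms unfolding exceeds_def by force
  show "exceedance_time x \<omega> \<le> exceedance_time y \<omega>"
  proof (rule dense_ge)
    fix t assume "exceedance_time y \<omega> < t"
    then obtain r where "0 \<le> real_of_rat r" "real_of_rat r < t" "y < Y (real_of_rat r) \<omega>"
      using assms(2) exceedance_time_less_iff[of y \<omega> t] by blast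
    then show "exceedance_time x \<omega> \<le> t"
      using exceedance_time_le(2)[of "real_of_rat r" x \<omega>] assms(1) by force
  qed
qed

lemma measurable_exceeds_before [measurable (raw)]:
  assumes [measurable]: "f \<in> borel_measurable N" "g \<in> measurable N M" "h \<in> borel_measurable N"
  shows "Measurable.pred N (\<lambda>w. exceeds (f w) (g w) \<and> exceedance_time (f w) (g w) < h w)"
  unfolding exceedance_time_less_iff by measurable

lemma measurable_exceeds [measurable (raw)]:
  assumes [measurable]: "f \<in> borel_measurable N" "g \<in> measurable N M"
  shows "Measurable.pred N (\<lambda>w. exceeds (f w) (g w))"
proof -
  have "(\<lambda>w. exceeds (f w) (g w)) =
      (\<lambda>w. \<exists>n::nat. exceeds (f w) (g w) \<and> exceedance_time (f w) (g w) < real n)"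
    using reals_Archimedean2 by (intro ext) blast
  also have "Measurable.pred N \<dots>" by measurable
  finally show ?thesis .
qed

lemma measurable_exceedance_time [measurable (raw)]:
  assumes [measurable]: "f \<in> borel_measurable N" "g \<in> measurable N M"
  shows "(\<lambda>w. exceedance_time (f w) (g w)) \<in> borel_measurable N"
proof (subst borel_measurable_iff_less, safe)
  fix a
  have "{w \<in> space N. exceedance_time (f w) (g w) < a} =
    {w \<in> space N. (exceeds (f w) (g w) \<and> exceedance_time (f w) (g w) < a) \<or>
      (\<not> exceeds (f w) (g w) \<and> 0 < a)}"
    by (auto simp: exceedance_time_def)
  also have "\<dots> \<in> sets N" by measurable
  finally show "{w \<in> space N. exceedance_time (f w) (g w) < a} \<in> sets N" .
qed

section \<open>The strong Markov property at exceedance times\<close>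

text \<open>
  The simple Markov property at time \<open>b\<close> on the event \<open>A\<close>. The test functions are bounded so that the
  property is inherited by differences of events.
\<close>
definition markov_event :: "real \<Rightarrow> 'a set \<Rightarrow> bool" where
  "markov_event b A \<longleftrightarrow> A \<in> sets M \<and>
    (\<forall>f \<in> borel_measurable borel. \<forall>u\<ge>0. (\<forall>y. f y \<le> 1) \<longrightarrow>
      (\<integral>\<^sup>+\<omega>. indicator A \<omega> * f (Y (b + u) \<omega>) \<partial>M) =
      (\<integral>\<^sup>+\<omega>. indicator A \<omega> * (\<integral>\<^sup>+\<omega>'. f (Y b \<omega> + Y u \<omega>') \<partial>M) \<partial>M))"

text \<open>
  The event is the increasing union of the events that \<open>x\<close> is exceeded at one of the
  first \<open>n\<close> rational times below \<open>a\<close>, in some enumeration of the rationals.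
\<close>
lemma markov_event_exceeds_before:
  assumes "0 \<le> b" "a \<le> b"
  shows "markov_event b {\<omega> \<in> space M. exceeds x \<omega> \<and> exceedance_time x \<omega> < a}" (is "markov_event b ?A")
proof -
  define F where "F n = real_of_rat ` from_nat ` {..<n} \<inter> {0..<a}" for n :: nat
  have F: "finite (F n)" "F n \<subseteq> {0..b}" for n
    using assms by (auto simp: F_def)
  have Fmono: "F m \<subseteq> F n" if "m \<le> n" for m n
    using that by (auto simp: F_def)
  have ex: "(\<exists>n. \<exists>s\<in>F n. x < Y s \<omega>) \<longleftrightarrow> exceeds x \<omega> \<and> exceedance_time x \<omega> < a" for \<omega>
  proof -
    have "(\<Union>n. F n) = range real_of_rat \<inter> {0..<a}"
    proof -
      have "real_of_rat r \<in> real_of_rat ` from_nat ` {..<Suc (to_nat r)}" for r :: rat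
        by (intro imageI image_eqI[of _ _ "to_nat r"]) auto
      then show ?thesis unfolding F_def by blast
    qed
    then have "(\<exists>n. \<exists>s\<in>F n. x < Y s \<omega>) \<longleftrightarrow> (\<exists>s\<in>range real_of_rat \<inter> {0..<a}. x < Y s \<omega>)"
      by blast
    then show ?thesis unfolding exceedance_time_less_iff by auto
  qed
  define B where "B n = {\<omega>. \<exists>s\<in>F n. x < Y s \<omega>}" for n
  have [measurable]: "(\<lambda>\<omega>. indicator (B n) \<omega> :: ennreal) \<in> borel_measurable M" for n
    unfolding B_def using F(1) by measurable
  have limB: "(\<lambda>n. indicator (B n) \<omega> * c :: ennreal) \<longlonglongrightarrow> indicator ?A \<omega> * c" if "\<omega> \<in> space M" for \<omega> c
  proof (cases "\<omega> \<in> ?A")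
    case True
    then obtain m where "\<omega> \<in> B m" using ex[of \<omega>] by (auto simp: B_def)
    then have "indicator (B n) \<omega> * c = indicator ?A \<omega> * c" if "m \<le> n" for n
      using Fmono[OF that] True by (auto simp: B_def indicator_def)
    then show ?thesis by (intro tendsto_eventually) (auto simp: eventually_sequentially)
  next
    case False
    then have "\<omega> \<notin> B n" for n using ex[of \<omega>] that by (auto simp: B_def)
    then show ?thesis using False by simp
  qed
  have [measurable]: "?A \<in> sets M" by measurable
  have "(\<integral>\<^sup>+\<omega>. indicator ?A \<omega> * f (Y (b + u) \<omega>) \<partial>M) =
      (\<integral>\<^sup>+\<omega>. indicator ?A \<omega> * (\<integral>\<^sup>+\<omega>'. f (Y b \<omega> + Y u \<omega>') \<partial>M) \<partial>M)"
    if [measurable]: "f \<in> borel_measurable borel" and "0 \<le> u" and f1: "\<And>y. f y \<le> 1" for f u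
  proof (rule LIMSEQ_unique)
    have c1: "indicator C \<omega> * c \<le> (1::ennreal)" if "c \<le> 1" for C c and \<omega> :: 'a
      using that by (auto simp: indicator_def)
    have i1: "(\<integral>\<^sup>+\<omega>'. f (Y b \<omega> + Y u \<omega>') \<partial>M) \<le> 1" for \<omega>
      using nn_integral_mono[of M "\<lambda>\<omega>'. f (Y b \<omega> + Y u \<omega>')" "\<lambda>_. 1"] f1 by (simp add: emeasure_space_1)
    show "(\<lambda>n. \<integral>\<^sup>+\<omega>. indicator (B n) \<omega> * f (Y (b + u) \<omega>) \<partial>M)
        \<longlonglongrightarrow> (\<integral>\<^sup>+\<omega>. indicator ?A \<omega> * f (Y (b + u) \<omega>) \<partial>M)"
      by (rule nn_integral_dominated_convergence[where w="\<lambda>_. 1"])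
         (auto simp: emeasure_space_1 intro!: c1 f1 limB)
    have "(\<lambda>n. \<integral>\<^sup>+\<omega>. indicator (B n) \<omega> * (\<integral>\<^sup>+\<omega>'. f (Y b \<omega> + Y u \<omega>') \<partial>M) \<partial>M)
        \<longlonglongrightarrow> (\<integral>\<^sup>+\<omega>. indicator ?A \<omega> * (\<integral>\<^sup>+\<omega>'. f (Y b \<omega> + Y u \<omega>') \<partial>M) \<partial>M)"
      by (rule nn_integral_dominated_convergence[where w="\<lambda>_. 1"])
         (auto simp: emeasure_space_1 intro!: c1 i1 limB)
    then show "(\<lambda>n. \<integral>\<^sup>+\<omega>. indicator (B n) \<omega> * f (Y (b + u) \<omega>) \<partial>M)
        \<longlonglongrightarrow> (\<integral>\<^sup>+\<omega>. indicator ?A \<omega> * (\<integral>\<^sup>+\<omega>'. f (Y b \<omega> + Y u \<omega>') \<partial>M) \<partial>M)"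
      unfolding B_def using markov[OF F(1) F(2) \<open>0 \<le> b\<close> \<open>0 \<le> u\<close>] by simp
  qed
  then show ?thesis
    unfolding markov_event_def using \<open>?A \<in> sets M\<close> by blast
qed

lemma markov_event_diff:
  assumes "markov_event b A" "markov_event b B" "B \<subseteq> A"
  shows "markov_event b (A - B)"
proof -
  have [measurable]: "A \<in> sets M" "B \<in> sets M" using assms by (auto simp: markov_event_def)
  have ind: "indicator A \<omega> = (indicator B \<omega> + indicator (A - B) \<omega> :: ennreal)" for \<omega>
    using \<open>B \<subseteq> A\<close> by (auto simp: indicator_def)
  have split: "(\<integral>\<^sup>+\<omega>. indicator A \<omega> * g \<omega> \<partial>M) = (\<integral>\<^sup>+\<omega>. indicator B \<omega> * g \<omega> \<partial>M) + (\<integral>\<^sup>+\<omega>. indicator (A - B) \<omega> * g \<omega> \<partial>M)"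
    if [measurable]: "g \<in> borel_measurable M" for g :: "'a \<Rightarrow> ennreal"
    unfolding ind by (subst nn_integral_add[symmetric]) (auto simp: distrib_right)
  have "(\<integral>\<^sup>+\<omega>. indicator (A - B) \<omega> * f (Y (b + u) \<omega>) \<partial>M) =
      (\<integral>\<^sup>+\<omega>. indicator (A - B) \<omega> * (\<integral>\<^sup>+\<omega>'. f (Y b \<omega> + Y u \<omega>') \<partial>M) \<partial>M)"
    if [measurable]: "f \<in> borel_measurable borel" and u: "0 \<le> u" and f1: "\<And>y. f y \<le> 1" for f u
  proof -
    let ?g = "\<lambda>\<omega>. f (Y (b + u) \<omega>)" and ?h = "\<lambda>\<omega>. \<integral>\<^sup>+\<omega>'. f (Y b \<omega> + Y u \<omega>') \<partial>M"
    have eq: "(\<integral>\<^sup>+\<omega>. indicator A \<omega> * ?g \<omega> \<partial>M) = (\<integral>\<^sup>+\<omega>. indicator A \<omega> * ?h \<omega> \<partial>M)"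
      "(\<integral>\<^sup>+\<omega>. indicator B \<omega> * ?g \<omega> \<partial>M) = (\<integral>\<^sup>+\<omega>. indicator B \<omega> * ?h \<omega> \<partial>M)"
      using assms(1,2) that unfolding markov_event_def by blast+
    have "(\<integral>\<^sup>+\<omega>. indicator B \<omega> * ?g \<omega> \<partial>M) \<le> (\<integral>\<^sup>+\<omega>. 1 \<partial>M)"
      by (intro nn_integral_mono) (auto simp: indicator_def f1)
    then have "(\<integral>\<^sup>+\<omega>. indicator B \<omega> * ?g \<omega> \<partial>M) \<noteq> \<infinity>"
      by (auto simp: emeasure_space_1 top_unique)
    moreover have "(\<integral>\<^sup>+\<omega>. indicator B \<omega> * ?g \<omega> \<partial>M) + (\<integral>\<^sup>+\<omega>. indicator (A - B) \<omega> * ?g \<omega> \<partial>M) =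
       (\<integral>\<^sup>+\<omega>. indicator B \<omega> * ?g \<omega> \<partial>M) + (\<integral>\<^sup>+\<omega>. indicator (A - B) \<omega> * ?h \<omega> \<partial>M)"
    proof -
      have "(\<integral>\<^sup>+\<omega>. indicator B \<omega> * ?g \<omega> \<partial>M) + (\<integral>\<^sup>+\<omega>. indicator (A - B) \<omega> * ?g \<omega> \<partial>M) =
          (\<integral>\<^sup>+\<omega>. indicator A \<omega> * ?h \<omega> \<partial>M)"
        unfolding eq(1)[symmetric] by (rule split[symmetric]) measurable
      also have "\<dots> = (\<integral>\<^sup>+\<omega>. indicator B \<omega> * ?h \<omega> \<partial>M) + (\<integral>\<^sup>+\<omega>. indicator (A - B) \<omega> * ?h \<omega> \<partial>M)"
        by (rule split) measurable
      finally show ?thesis unfolding eq(2) .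
    qed
    ultimately show ?thesis unfolding ennreal_add_left_cancel by blast
  qed
  then show ?thesis unfolding markov_event_def by auto
qed

lemma markov_event_space:
  assumes "0 \<le> b"
  shows "markov_event b (space M)"
proof -
  have "{\<omega>. \<exists>s\<in>{0::real}. -1 < Y s \<omega>} = UNIV" by simp
  then have "(\<integral>\<^sup>+\<omega>. f (Y (b + u) \<omega>) \<partial>M) = (\<integral>\<^sup>+\<omega>. (\<integral>\<^sup>+\<omega>'. f (Y b \<omega> + Y u \<omega>') \<partial>M) \<partial>M)"
    if "f \<in> borel_measurable borel" "0 \<le> u" for f u
    using markov[of "{0}" b u f "-1"] that assms by simp
  then show ?thesis
    unfolding markov_event_def by (auto intro!: nn_integral_cong cong: nn_integral_cong)
qed

text \<open>The resolvent of the semigroup of \<open>Y\<close>, applied to \<open>f\<close> and evaluated at the starting point \<open>z\<close>.\<close>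
definition potential :: "real \<Rightarrow> (real \<Rightarrow> ennreal) \<Rightarrow> real \<Rightarrow> ennreal" where
  "potential q f z =
     (\<integral>\<^sup>+t. ennreal (exp (- q * t)) * indicator {0..} t * (\<integral>\<^sup>+\<omega>. f (z + Y t \<omega>) \<partial>M) \<partial>lborel)"

lemma measurable_potential [measurable]:
  assumes [measurable]: "f \<in> borel_measurable borel"
  shows "potential q f \<in> borel_measurable borel"
  unfolding potential_def by measurable

lemma potential_mono:
  assumes "\<And>y. f y \<le> g y"
  shows "potential q f z \<le> potential q g z"
  unfolding potential_def by (intro nn_integral_mono mult_left_mono assms) auto

lemma potential_add:
  assumes [measurable]: "f \<in> borel_measurable borel" "g \<in> borel_measurable borel"
  shows "potential q (\<lambda>y. f y + g y) z = potential q f z + potential q g z"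
proof -
  have "potential q (\<lambda>y. f y + g y) z = (\<integral>\<^sup>+t. ennreal (exp (- q * t)) * indicator {0..} t * (\<integral>\<^sup>+\<omega>. f (z + Y t \<omega>) \<partial>M)
     + ennreal (exp (- q * t)) * indicator {0..} t * (\<integral>\<^sup>+\<omega>. g (z + Y t \<omega>) \<partial>M) \<partial>lborel)"
    unfolding potential_def by (intro nn_integral_cong) (simp add: nn_integral_add distrib_left)
  also have "\<dots> = potential q f z + potential q g z"
    unfolding potential_def by (rule nn_integral_add) measurable
  finally show ?thesis .
qed

lemma potential_cmult:
  assumes [measurable]: "f \<in> borel_measurable borel"
  shows "potential q (\<lambda>y. c * f y) z = c * potential q f z"
proof -
  have "potential q (\<lambda>y. c * f y) z = (\<integral>\<^sup>+t. c * (ennreal (exp (- q * t)) * indicator {0..} t * (\<integral>\<^sup>+\<omega>. f (z + Y t \<omega>) \<partial>M)) \<partial>lborel)"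
    unfolding potential_def by (intro nn_integral_cong) (simp add: nn_integral_cmult mult_ac)
  also have "\<dots> = c * potential q f z"
    unfolding potential_def by (rule nn_integral_cmult) measurable
  finally show ?thesis .
qed

lemma potential_swap:
  assumes [measurable]: "f \<in> borel_measurable borel"
  shows "potential q f z =
    (\<integral>\<^sup>+\<omega>. (\<integral>\<^sup>+t. ennreal (exp (- q * t)) * indicator {0..} t * f (z + Y t \<omega>) \<partial>lborel) \<partial>M)"
proof -
  have "potential q f z =
      (\<integral>\<^sup>+t. (\<integral>\<^sup>+\<omega>. ennreal (exp (- q * t)) * indicator {0..} t * f (z + Y t \<omega>) \<partial>M) \<partial>lborel)"
    unfolding potential_def by (intro nn_integral_cong) (simp add: nn_integral_cmult)
  also have "\<dots> = (\<integral>\<^sup>+\<omega>. (\<integral>\<^sup>+t. ennreal (exp (- q * t)) * indicator {0..} t * f (z + Y t \<omega>) \<partial>lborel) \<partial>M)"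
    by (rule lborel_M.Fubini'[symmetric]) measurable
  finally show ?thesis .
qed

lemma potential_le:
  assumes "0 < q" "\<And>y. f y \<le> c"
  shows "potential q f z \<le> c * ennreal (1 / q)"
proof -
  have "potential q f z \<le> (\<integral>\<^sup>+t. c * (ennreal (exp (- q * t)) * indicator {0..} t) \<partial>lborel)"
    unfolding potential_def
  proof (rule nn_integral_mono)
    fix t
    have "(\<integral>\<^sup>+\<omega>. f (z + Y t \<omega>) \<partial>M) \<le> (\<integral>\<^sup>+\<omega>. c \<partial>M)"
      by (intro nn_integral_mono assms)
    then have "(\<integral>\<^sup>+\<omega>. f (z + Y t \<omega>) \<partial>M) \<le> c"
      by (simp add: emeasure_space_1)
    then show "ennreal (exp (- q * t)) * indicator {0..} t * (\<integral>\<^sup>+\<omega>. f (z + Y t \<omega>) \<partial>M)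
       \<le> c * (ennreal (exp (- q * t)) * indicator {0..} t)"
      by (subst mult.commute) (rule mult_right_mono, auto)
  qed
  also have "\<dots> = c * ennreal (1 / q)"
    using assms(1) by (subst nn_integral_cmult) (auto simp: nn_integral_exp_from)
  finally show ?thesis .
qed

lemma potential_dominated_convergence:
  assumes q: "0 < q" and [measurable]: "\<And>n. f n \<in> borel_measurable borel" "f' \<in> borel_measurable borel"
    and f1: "\<And>n y. f n y \<le> 1" and lim: "\<And>y. (\<lambda>n. f n y) \<longlonglongrightarrow> f' y"
  shows "(\<lambda>n. potential q (f n) z) \<longlonglongrightarrow> potential q f' z"
proof -
  have inner: "(\<lambda>n. \<integral>\<^sup>+\<omega>. f n (z + Y t \<omega>) \<partial>M) \<longlonglongrightarrow> (\<integral>\<^sup>+\<omega>. f' (z + Y t \<omega>) \<partial>M)" for t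
    by (rule nn_integral_dominated_convergence[where w="\<lambda>_. 1"])
       (auto simp: emeasure_space_1 f1 lim)
  have le1: "(\<integral>\<^sup>+\<omega>. f n (z + Y t \<omega>) \<partial>M) \<le> 1" for n t
    using nn_integral_mono[of M "\<lambda>\<omega>. f n (z + Y t \<omega>)" "\<lambda>_. 1"] f1 by (simp add: emeasure_space_1)
  show ?thesis
    unfolding potential_def
  proof (rule nn_integral_dominated_convergence[where w="\<lambda>t. ennreal (exp (- q * t)) * indicator {0..} t"])
    show "AE t in lborel. ennreal (exp (- q * t)) * indicator {0..} t * (\<integral>\<^sup>+\<omega>. f n (z + Y t \<omega>) \<partial>M)
       \<le> ennreal (exp (- q * t)) * indicator {0..} t" for n
      using mult_left_mono[OF le1] by auto
    show "AE t in lborel. (\<lambda>n. ennreal (exp (- q * t)) * indicator {0..} t * (\<integral>\<^sup>+\<omega>. f n (z + Y t \<omega>) \<partial>M))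
       \<longlonglongrightarrow> ennreal (exp (- q * t)) * indicator {0..} t * (\<integral>\<^sup>+\<omega>. f' (z + Y t \<omega>) \<partial>M)"
      by (intro AE_I2 ennreal_tendsto_cmult inner) (auto simp: ennreal_mult_less_top indicator_def)
  qed (use q in \<open>auto simp: nn_integral_exp_from\<close>)
qed

lemma potential_translate: "potential q f z = potential q (\<lambda>y. f (z + y)) 0"
  by (simp add: potential_def)

lemma potential_tendsto:
  fixes f :: "real \<Rightarrow> real"
  assumes q: "0 < q" and cont: "continuous_on UNIV f" and f1: "\<And>y. f y \<le> 1"
    and z: "z \<longlonglongrightarrow> z'"
  shows "(\<lambda>n. potential q (\<lambda>y. ennreal (f y)) (z n)) \<longlonglongrightarrow> potential q (\<lambda>y. ennreal (f y)) z'"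
proof -
  have [measurable]: "f \<in> borel_measurable borel"
    using cont by (rule borel_measurable_continuous_onI)
  have "(\<lambda>n. f (z n + y)) \<longlonglongrightarrow> f (z' + y)" for y
    by (rule continuous_on_tendsto_compose[OF cont]) (auto intro!: tendsto_intros z)
  then show ?thesis
    unfolding potential_translate[of q _ "z _"] potential_translate[of q _ z']
    by (intro potential_dominated_convergence q) (auto simp: f1 tendsto_ennrealI)
qed

text \<open>
  This is the simple Markov property integrated over all later times: after \<open>b\<close> the process starts
  afresh from \<open>Y b\<close>, and the discounting up to \<open>b\<close> splits off as a factor.
\<close>
lemma markov_potential:
  assumes A: "markov_event b A" and "0 \<le> b"
    and [measurable]: "f \<in> borel_measurable borel" and f1: "\<And>y. f y \<le> 1"
  shows "(\<integral>\<^sup>+\<omega>. indicator A \<omega> * (\<integral>\<^sup>+t. ennreal (exp (- q * t)) * indicator {b..} t * f (Y t \<omega>) \<partial>lborel) \<partial>M) =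
    (\<integral>\<^sup>+\<omega>. indicator A \<omega> * (ennreal (exp (- q * b)) * potential q f (Y b \<omega>)) \<partial>M)"
proof -
  have [measurable]: "A \<in> sets M" using A by (auto simp: markov_event_def)
  let ?e = "\<lambda>u. ennreal (exp (- q * u)) * indicator {0..} u"
  have sw: "(\<integral>\<^sup>+\<omega>. g \<omega> * (\<integral>\<^sup>+t. h t * k t \<omega> \<partial>lborel) \<partial>M) =
    (\<integral>\<^sup>+t. h t * (\<integral>\<^sup>+\<omega>. g \<omega> * k t \<omega> \<partial>M) \<partial>lborel)"
    if [measurable]: "g \<in> borel_measurable M" "h \<in> borel_measurable borel" "case_prod k \<in> borel_measurable (borel \<Otimes>\<^sub>M M)"
    for g and h :: "real \<Rightarrow> ennreal" and k
  proof -
    have "(\<integral>\<^sup>+\<omega>. g \<omega> * (\<integral>\<^sup>+t. h t * k t \<omega> \<partial>lborel) \<partial>M) = (\<integral>\<^sup>+\<omega>. (\<integral>\<^sup>+t. g \<omega> * (h t * k t \<omega>) \<partial>lborel) \<partial>M)"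
      by (intro nn_integral_cong nn_integral_cmult[symmetric]) measurable
    also have "\<dots> = (\<integral>\<^sup>+t. (\<integral>\<^sup>+\<omega>. g \<omega> * (h t * k t \<omega>) \<partial>M) \<partial>lborel)"
      by (rule lborel_M.Fubini') measurable
    also have "\<dots> = (\<integral>\<^sup>+t. h t * (\<integral>\<^sup>+\<omega>. g \<omega> * k t \<omega> \<partial>M) \<partial>lborel)"
      by (intro nn_integral_cong) (simp add: nn_integral_cmult[symmetric] mult.left_commute)
    finally show ?thesis .
  qed
  have "(\<integral>\<^sup>+\<omega>. indicator A \<omega> * (\<integral>\<^sup>+t. ennreal (exp (- q * t)) * indicator {b..} t * f (Y t \<omega>) \<partial>lborel) \<partial>M) =
     (\<integral>\<^sup>+t. ennreal (exp (- q * t)) * indicator {b..} t * (\<integral>\<^sup>+\<omega>. indicator A \<omega> * f (Y t \<omega>) \<partial>M) \<partial>lborel)"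
    by (rule sw) measurable
  also have "\<dots> = (\<integral>\<^sup>+u. ennreal (exp (- q * (b + u))) * indicator {b..} (b + u) *
      (\<integral>\<^sup>+\<omega>. indicator A \<omega> * f (Y (b + u) \<omega>) \<partial>M) \<partial>lborel)"
    by (subst nn_integral_real_affine[where c=1 and t=b]) auto
  also have "\<dots> = (\<integral>\<^sup>+u. ennreal (exp (- q * b)) * (?e u *
      (\<integral>\<^sup>+\<omega>. indicator A \<omega> * (\<integral>\<^sup>+\<omega>'. f (Y b \<omega> + Y u \<omega>') \<partial>M) \<partial>M)) \<partial>lborel)"
  proof (intro nn_integral_cong)
    fix u :: real
    have e: "ennreal (exp (- q * (b + u))) = ennreal (exp (- q * b)) * ennreal (exp (- q * u))"
      by (simp add: ennreal_mult[symmetric] exp_add[symmetric] algebra_simps)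
    have m: "(\<integral>\<^sup>+\<omega>. indicator A \<omega> * f (Y (b + u) \<omega>) \<partial>M) =
      (\<integral>\<^sup>+\<omega>. indicator A \<omega> * (\<integral>\<^sup>+\<omega>'. f (Y b \<omega> + Y u \<omega>') \<partial>M) \<partial>M)" if "0 \<le> u"
      using A that f1 unfolding markov_event_def by auto
    show "ennreal (exp (- q * (b + u))) * indicator {b..} (b + u) * (\<integral>\<^sup>+\<omega>. indicator A \<omega> * f (Y (b + u) \<omega>) \<partial>M) =
      ennreal (exp (- q * b)) * (?e u * (\<integral>\<^sup>+\<omega>. indicator A \<omega> * (\<integral>\<^sup>+\<omega>'. f (Y b \<omega> + Y u \<omega>') \<partial>M) \<partial>M))"
      unfolding e using m by (cases "0 \<le> u") (simp_all add: mult.assoc)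
  qed
  also have "\<dots> = ennreal (exp (- q * b)) *
     (\<integral>\<^sup>+u. ?e u * (\<integral>\<^sup>+\<omega>. indicator A \<omega> * (\<integral>\<^sup>+\<omega>'. f (Y b \<omega> + Y u \<omega>') \<partial>M) \<partial>M) \<partial>lborel)"
    by (rule nn_integral_cmult) measurable
  also have "\<dots> = ennreal (exp (- q * b)) * (\<integral>\<^sup>+\<omega>. indicator A \<omega> * potential q f (Y b \<omega>) \<partial>M)"
    unfolding potential_def by (rule arg_cong[where f="(*) _"], rule sw[symmetric]) measurable
  also have "\<dots> = (\<integral>\<^sup>+\<omega>. indicator A \<omega> * (ennreal (exp (- q * b)) * potential q f (Y b \<omega>)) \<partial>M)"
    by (subst nn_integral_cmult[symmetric]) (measurable, simp add: mult_ac)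
  finally show ?thesis .
qed

text \<open>
  The first point of the grid of mesh \<open>1 / (m + 1)\<close> that lies strictly to the right of \<open>r\<close>. Strictness
  makes the event that the grid time of \<open>\<rho>\<^sub>x\<close> equals \<open>b\<close> an event of the form
  \<open>a \<le> \<rho>\<^sub>x < b\<close>, to which the Markov property at \<open>b\<close> applies.
\<close>
definition grid_time :: "nat \<Rightarrow> real \<Rightarrow> real" where
  "grid_time m r = real (nat \<lfloor>real (Suc m) * r\<rfloor> + 1) / real (Suc m)"

lemma grid_time_bounds:
  assumes "0 \<le> r"
  shows "r < grid_time m r" "grid_time m r \<le> r + 1 / real (Suc m)"
proof -
  have "0 \<le> \<lfloor>real (Suc m) * r\<rfloor>" using assms by simp
  then have e: "real (nat \<lfloor>real (Suc m) * r\<rfloor> + 1) = real_of_int \<lfloor>real (Suc m) * r\<rfloor> + 1"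
    by simp
  have "(real (Suc m) * r) / real (Suc m) < (real_of_int \<lfloor>real (Suc m) * r\<rfloor> + 1) / real (Suc m)"
    by (rule divide_strict_right_mono) (linarith, simp)
  then show "r < grid_time m r" unfolding grid_time_def e by simp
  have "(real_of_int \<lfloor>real (Suc m) * r\<rfloor> + 1) / real (Suc m) \<le> (real (Suc m) * r + 1) / real (Suc m)"
    by (rule divide_right_mono) (linarith, simp)
  then show "grid_time m r \<le> r + 1 / real (Suc m)"
    unfolding grid_time_def e by (simp add: add_divide_distrib)
qed

lemma grid_time_tendsto:
  assumes "0 \<le> r"
  shows "(\<lambda>m. grid_time m r) \<longlonglongrightarrow> r"
proof (rule tendsto_sandwich[where f="\<lambda>_. r" and h="\<lambda>m. r + 1 / real (Suc m)"])
  show "(\<lambda>n. r + 1 / real (Suc n)) \<longlonglongrightarrow> r"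
    using tendsto_add[OF tendsto_const[of r] LIMSEQ_Suc[OF lim_1_over_n]] by simp
qed (use grid_time_bounds[OF assms] in \<open>simp_all add: less_imp_le\<close>)

lemma measurable_grid_time [measurable]: "grid_time m \<in> borel_measurable borel"
  unfolding grid_time_def by measurable

text \<open>The Markov property at a random time with countably many values: sum over these values.\<close>
lemma markov_potential_grid:
  fixes q x :: real and m :: nat
  assumes [measurable]: "f \<in> borel_measurable borel" and f1: "\<And>y. f y \<le> 1"
  defines "D \<equiv> \<lambda>\<omega>. grid_time m (exceedance_time x \<omega>)"
  shows "(\<integral>\<^sup>+\<omega>. indicator {\<omega>. exceeds x \<omega>} \<omega> *
       (\<integral>\<^sup>+t. ennreal (exp (- q * t)) * indicator {D \<omega>..} t * f (Y t \<omega>) \<partial>lborel) \<partial>M) =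
    (\<integral>\<^sup>+\<omega>. indicator {\<omega>. exceeds x \<omega>} \<omega> *
       (ennreal (exp (- q * D \<omega>)) * potential q f (Y (D \<omega>) \<omega>)) \<partial>M)"
proof -
  define B where "B k = {\<omega> \<in> space M. exceeds x \<omega> \<and> exceedance_time x \<omega> < real k / real (Suc m)}" for k
  define A where "A k = B (Suc k) - B k" for k
  define b where "b k = real (k + 1) / real (Suc m)" for k
  have [measurable]: "B k \<in> sets M" for k unfolding B_def by measurable
  have [measurable]: "A k \<in> sets M" for k unfolding A_def by measurable
  have [measurable]: "D \<in> borel_measurable M" unfolding D_def by measurable
  have b0: "0 \<le> b k" for k by (simp add: b_def)
  have bmono: "real k / real (Suc m) \<le> real l / real (Suc m)" if "k \<le> l" for k l
    using that by (intro divide_right_mono) auto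
  have A: "markov_event (b k) (A k)" for k
    unfolding A_def B_def
  proof (rule markov_event_diff)
    show "{\<omega> \<in> space M. exceeds x \<omega> \<and> exceedance_time x \<omega> < real k / real (Suc m)}
      \<subseteq> {\<omega> \<in> space M. exceeds x \<omega> \<and> exceedance_time x \<omega> < real (Suc k) / real (Suc m)}"
      using bmono[of k "Suc k"] by auto
  qed (rule markov_event_exceeds_before; use b0[of k] bmono[of k "Suc k"] in \<open>simp add: b_def\<close>)+
  have Aiff: "\<omega> \<in> A k \<longleftrightarrow> exceeds x \<omega> \<and> nat \<lfloor>real (Suc m) * exceedance_time x \<omega>\<rfloor> = k" if "\<omega> \<in> space M" for \<omega> k
  proof -
    let ?r = "exceedance_time x \<omega>"
    have "\<omega> \<in> A k \<longleftrightarrow> exceeds x \<omega> \<and> real k / real (Suc m) \<le> ?r \<and> ?r < real (Suc k) / real (Suc m)"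
      using that by (auto simp: A_def B_def)
    also have "\<dots> \<longleftrightarrow> exceeds x \<omega> \<and> real k \<le> real (Suc m) * ?r \<and> real (Suc m) * ?r < real (Suc k)"
      by (simp add: pos_divide_le_eq pos_less_divide_eq mult.commute del: of_nat_Suc)
    also have "real k \<le> real (Suc m) * ?r \<and> real (Suc m) * ?r < real (Suc k) \<longleftrightarrow> \<lfloor>real (Suc m) * ?r\<rfloor> = int k"
      by (auto simp: floor_eq_iff)
    also have "\<dots> \<longleftrightarrow> nat \<lfloor>real (Suc m) * ?r\<rfloor> = k"
      using exceedance_time_nonneg[of x \<omega>] by (simp add: eq_nat_nat_iff nat_eq_iff)
    finally show ?thesis .
  qed
  have disj: "disjoint_family A"
    unfolding disjoint_family_on_def
  proof safe
    fix k l \<omega> assume kl: "\<omega> \<in> A k" "\<omega> \<in> A l" "k \<noteq> l"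
    have "\<omega> \<in> space M" using kl(1) by (auto simp: A_def B_def)
    then show "\<omega> \<in> {}" using Aiff[of \<omega> k] Aiff[of \<omega> l] kl by simp
  qed
  have expand: "(\<integral>\<^sup>+\<omega>. indicator {\<omega>. exceeds x \<omega>} \<omega> * h (D \<omega>) \<omega> \<partial>M) =
      (\<Sum>k. \<integral>\<^sup>+\<omega>. indicator (A k) \<omega> * h (b k) \<omega> \<partial>M)"
    if [measurable]: "\<And>k. h (b k) \<in> borel_measurable M" for h
  proof -
    have "indicator {\<omega>. exceeds x \<omega>} \<omega> * h (D \<omega>) \<omega> = (\<Sum>k. indicator (A k) \<omega> * h (b k) \<omega>)"
      if "\<omega> \<in> space M" for \<omega>
    proof (cases "exceeds x \<omega>")
      case True
      define k where "k = nat \<lfloor>real (Suc m) * exceedance_time x \<omega>\<rfloor>"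
      have "\<omega> \<in> A k" using True Aiff[OF that] by (simp add: k_def)
      then have "(\<Sum>k. h (b k) \<omega> * indicator (A k) \<omega>) = h (b k) \<omega>"
        by (intro suminf_cmult_indicator disj)
      moreover have "D \<omega> = b k"
        by (simp add: D_def grid_time_def b_def k_def)
      ultimately show ?thesis using True by (simp add: mult.commute)
    next
      case False
      then have "\<omega> \<notin> A k" for k using Aiff[OF that] by blast
      then show ?thesis using False by simp
    qed
    then have "(\<integral>\<^sup>+\<omega>. indicator {\<omega>. exceeds x \<omega>} \<omega> * h (D \<omega>) \<omega> \<partial>M) =
      (\<integral>\<^sup>+\<omega>. (\<Sum>k. indicator (A k) \<omega> * h (b k) \<omega>) \<partial>M)"
      by (intro nn_integral_cong) auto
    also have "\<dots> = (\<Sum>k. \<integral>\<^sup>+\<omega>. indicator (A k) \<omega> * h (b k) \<omega> \<partial>M)"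
      by (rule nn_integral_suminf) measurable
    finally show ?thesis .
  qed
  have "(\<integral>\<^sup>+\<omega>. indicator {\<omega>. exceeds x \<omega>} \<omega> *
       (\<integral>\<^sup>+t. ennreal (exp (- q * t)) * indicator {D \<omega>..} t * f (Y t \<omega>) \<partial>lborel) \<partial>M) =
     (\<Sum>k. \<integral>\<^sup>+\<omega>. indicator (A k) \<omega> * (\<integral>\<^sup>+t. ennreal (exp (- q * t)) * indicator {b k..} t * f (Y t \<omega>) \<partial>lborel) \<partial>M)"
    by (rule expand[of "\<lambda>d \<omega>. \<integral>\<^sup>+t. ennreal (exp (- q * t)) * indicator {d..} t * f (Y t \<omega>) \<partial>lborel"]) measurable
  also have "\<dots> = (\<Sum>k. \<integral>\<^sup>+\<omega>. indicator (A k) \<omega> * (ennreal (exp (- q * b k)) * potential q f (Y (b k) \<omega>)) \<partial>M)"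
    by (subst markov_potential[OF A b0 _ f1]) simp_all
  also have "\<dots> = (\<integral>\<^sup>+\<omega>. indicator {\<omega>. exceeds x \<omega>} \<omega> *
       (ennreal (exp (- q * D \<omega>)) * potential q f (Y (D \<omega>) \<omega>)) \<partial>M)"
    by (rule expand[of "\<lambda>d \<omega>. ennreal (exp (- q * d)) * potential q f (Y d \<omega>)", symmetric]) measurable
  finally show ?thesis .
qed

definition passage_laplace :: "real \<Rightarrow> real \<Rightarrow> ennreal" where
  "passage_laplace q x =
     (\<integral>\<^sup>+\<omega>. indicator {\<omega>. exceeds x \<omega>} \<omega> * ennreal (exp (- q * exceedance_time x \<omega>)) \<partial>M)"

text \<open>
  Let the mesh of the grid tend to zero. The process at the grid times converges to
  \<open>Y\<close> at \<open>\<rho>\<^sub>x\<close>, that is, to \<open>x\<close>, by right-continuity, and the potential of a continuous function is continuous.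
\<close>
lemma strong_markov_potential:
  fixes f :: "real \<Rightarrow> real"
  assumes q: "0 < q" and x: "0 \<le> x" and cont: "continuous_on UNIV f" and f1: "\<And>y. f y \<le> 1"
  shows "(\<integral>\<^sup>+\<omega>. indicator {\<omega>. exceeds x \<omega>} \<omega> *
       (\<integral>\<^sup>+t. ennreal (exp (- q * t)) * indicator {exceedance_time x \<omega><..} t * ennreal (f (Y t \<omega>)) \<partial>lborel) \<partial>M) =
    passage_laplace q x * potential q (\<lambda>y. ennreal (f y)) x"
proof (rule LIMSEQ_unique)
  have [measurable]: "f \<in> borel_measurable borel"
    using cont by (rule borel_measurable_continuous_onI)
  let ?r = "exceedance_time x" and ?D = "\<lambda>m \<omega>. grid_time m (exceedance_time x \<omega>)"
  let ?I = "\<lambda>\<omega>. indicator {\<omega>. exceeds x \<omega>} \<omega> :: ennreal"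
  let ?J = "\<lambda>m \<omega>. \<integral>\<^sup>+t. ennreal (exp (- q * t)) * indicator {?D m \<omega>..} t * ennreal (f (Y t \<omega>)) \<partial>lborel"
  let ?P = "potential q (\<lambda>y. ennreal (f y))"
  have r0: "0 \<le> ?r \<omega>" for \<omega> by (rule exceedance_time_nonneg)
  have D0: "0 \<le> ?D m \<omega>" for m \<omega>
    using grid_time_bounds(1)[OF r0, of \<omega> m] r0[of \<omega>] by linarith
  have bnd: "ennreal (exp (- q * t)) * indicator {?D m \<omega>..} t * ennreal (f (Y t \<omega>))
      \<le> ennreal (exp (- q * t)) * indicator {0..} t" for m \<omega> t
    using mult_left_mono[of "ennreal (f (Y t \<omega>))" 1 "ennreal (exp (- q * t))"] f1 D0[of m \<omega>]
    by (auto simp: indicator_def)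
  have limJ: "(\<lambda>m. ?J m \<omega>) \<longlonglongrightarrow>
      (\<integral>\<^sup>+t. ennreal (exp (- q * t)) * indicator {?r \<omega><..} t * ennreal (f (Y t \<omega>)) \<partial>lborel)"
    if [measurable]: "\<omega> \<in> space M" for \<omega>
  proof (rule nn_integral_dominated_convergence[where w="\<lambda>t. ennreal (exp (- q * t)) * indicator {0..} t"])
    have "(\<lambda>m. ennreal (exp (- q * t)) * indicator {?D m \<omega>..} t * ennreal (f (Y t \<omega>)))
      \<longlonglongrightarrow> ennreal (exp (- q * t)) * indicator {?r \<omega><..} t * ennreal (f (Y t \<omega>))" for t
    proof (cases "?r \<omega> < t")
      case True
      have "eventually (\<lambda>m. ?D m \<omega> < t) sequentially"
        using order_tendstoD(2)[OF grid_time_tendsto[OF r0] True] .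
      then have "eventually (\<lambda>m. ennreal (exp (- q * t)) * indicator {?D m \<omega>..} t * ennreal (f (Y t \<omega>)) =
         ennreal (exp (- q * t)) * indicator {?r \<omega><..} t * ennreal (f (Y t \<omega>))) sequentially"
        by eventually_elim (use True in simp)
      then show ?thesis by (rule tendsto_eventually)
    next
      case False
      then have "t < ?D m \<omega>" for m
        using grid_time_bounds(1)[OF r0, of \<omega> m] by linarith
      then show ?thesis using False by (simp add: not_le)
    qed
    then show "AE t in lborel. (\<lambda>m. ennreal (exp (- q * t)) * indicator {?D m \<omega>..} t * ennreal (f (Y t \<omega>)))
      \<longlonglongrightarrow> ennreal (exp (- q * t)) * indicator {?r \<omega><..} t * ennreal (f (Y t \<omega>))" by simp
  qed (use q bnd in \<open>auto simp: nn_integral_exp_from\<close>)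
  have J1: "?J m \<omega> \<le> ennreal (1 / q)" for m \<omega>
  proof -
    have "?J m \<omega> \<le> (\<integral>\<^sup>+t. ennreal (exp (- q * t)) * indicator {0..} t \<partial>lborel)"
      by (intro nn_integral_mono bnd)
    then show ?thesis using q by (simp add: nn_integral_exp_from)
  qed
  have gt: "indicator {a<..} t = (if a < t then 1 else 0 :: ennreal)" for a t :: real
    by simp
  have [measurable]: "(\<lambda>\<omega>. \<integral>\<^sup>+t. ennreal (exp (- q * t)) * indicator {?r \<omega><..} t * ennreal (f (Y t \<omega>)) \<partial>lborel)
      \<in> borel_measurable M"
    unfolding gt by measurable
  show "(\<lambda>m. \<integral>\<^sup>+\<omega>. ?I \<omega> * ?J m \<omega> \<partial>M) \<longlonglongrightarrow> (\<integral>\<^sup>+\<omega>. ?I \<omega> *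
       (\<integral>\<^sup>+t. ennreal (exp (- q * t)) * indicator {?r \<omega><..} t * ennreal (f (Y t \<omega>)) \<partial>lborel) \<partial>M)"
  proof (rule nn_integral_dominated_convergence[where w="\<lambda>_. ennreal (1 / q)"])
    show "(\<lambda>\<omega>. ?I \<omega> * (\<integral>\<^sup>+t. ennreal (exp (- q * t)) * indicator {?r \<omega><..} t * ennreal (f (Y t \<omega>)) \<partial>lborel))
      \<in> borel_measurable M" by measurable
    show "AE \<omega> in M. ?I \<omega> * ?J m \<omega> \<le> ennreal (1 / q)" for m
      using J1[of m] by (auto simp: indicator_def)
    show "AE \<omega> in M. (\<lambda>m. ?I \<omega> * ?J m \<omega>) \<longlonglongrightarrow> ?I \<omega> *
       (\<integral>\<^sup>+t. ennreal (exp (- q * t)) * indicator {?r \<omega><..} t * ennreal (f (Y t \<omega>)) \<partial>lborel)"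
      using limJ by (intro AE_I2 ennreal_tendsto_cmult) (auto simp: indicator_def)
  qed (measurable, auto simp: emeasure_space_1)
  have P1: "?P y \<le> ennreal (1 / q)" for y
    using potential_le[OF q, of "\<lambda>y. ennreal (f y)" 1 y] f1 by simp
  have "(\<lambda>m. \<integral>\<^sup>+\<omega>. ?I \<omega> * (ennreal (exp (- q * ?D m \<omega>)) * ?P (Y (?D m \<omega>) \<omega>)) \<partial>M)
     \<longlonglongrightarrow> (\<integral>\<^sup>+\<omega>. ?I \<omega> * (ennreal (exp (- q * ?r \<omega>)) * ?P x) \<partial>M)"
  proof (rule nn_integral_dominated_convergence[where w="\<lambda>_. ennreal (1 / q)"])
    show "AE \<omega> in M. ?I \<omega> * (ennreal (exp (- q * ?D m \<omega>)) * ?P (Y (?D m \<omega>) \<omega>)) \<le> ennreal (1 / q)" for m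
    proof (rule AE_I2)
      fix \<omega>
      have "ennreal (exp (- q * ?D m \<omega>)) \<le> 1" using q D0[of m \<omega>] by simp
      then have "ennreal (exp (- q * ?D m \<omega>)) * ?P (Y (?D m \<omega>) \<omega>) \<le> 1 * ennreal (1 / q)"
        by (intro mult_mono P1) auto
      then show "?I \<omega> * (ennreal (exp (- q * ?D m \<omega>)) * ?P (Y (?D m \<omega>) \<omega>)) \<le> ennreal (1 / q)"
        by (auto simp: indicator_def)
    qed
    have "(\<lambda>m. ?I \<omega> * (ennreal (exp (- q * ?D m \<omega>)) * ?P (Y (?D m \<omega>) \<omega>)))
        \<longlonglongrightarrow> ?I \<omega> * (ennreal (exp (- q * ?r \<omega>)) * ?P x)" for \<omega>
    proof (cases "exceeds x \<omega>")
      case True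
      have "filterlim (\<lambda>m. ?D m \<omega>) (at_right (?r \<omega>)) sequentially"
        using grid_time_tendsto[OF r0[of \<omega>]] grid_time_bounds(1)[OF r0[of \<omega>]]
        by (simp add: filterlim_at less_imp_neq[symmetric] always_eventually)
      then have "(\<lambda>m. Y (?D m \<omega>) \<omega>) \<longlonglongrightarrow> x"
        using filterlim_compose[OF right_continuous[OF r0]] Y_exceedance_time[OF True x] by metis
      then have "(\<lambda>m. ?P (Y (?D m \<omega>) \<omega>)) \<longlonglongrightarrow> ?P x"
        by (rule potential_tendsto[OF q cont f1])
      moreover have "(\<lambda>m. ennreal (exp (- q * ?D m \<omega>))) \<longlonglongrightarrow> ennreal (exp (- q * ?r \<omega>))"
        by (intro tendsto_ennrealI tendsto_intros grid_time_tendsto r0)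
      ultimately show ?thesis
        using P1[of x] by (auto simp: True intro!: tendsto_mult_ennreal dest: order_trans simp: top_unique)
    qed auto
    then show "AE \<omega> in M. (\<lambda>m. ?I \<omega> * (ennreal (exp (- q * ?D m \<omega>)) * ?P (Y (?D m \<omega>) \<omega>)))
        \<longlonglongrightarrow> ?I \<omega> * (ennreal (exp (- q * ?r \<omega>)) * ?P x)" by simp
  qed (measurable, auto simp: emeasure_space_1)
  moreover have "(\<integral>\<^sup>+\<omega>. ?I \<omega> * (ennreal (exp (- q * ?r \<omega>)) * ?P x) \<partial>M) = passage_laplace q x * ?P x"
    unfolding passage_laplace_def by (subst nn_integral_multc[symmetric]) (measurable, simp add: mult_ac)
  ultimately show "(\<lambda>m. \<integral>\<^sup>+\<omega>. ?I \<omega> * ?J m \<omega> \<partial>M) \<longlonglongrightarrow> passage_laplace q x * ?P x"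
    using markov_potential_grid[where f="\<lambda>y. ennreal (f y)" and x=x and q=q] f1 by simp
qed

section \<open>Exponential form of the passage transform and of the potential\<close>

definition potential_tail :: "real \<Rightarrow> real \<Rightarrow> real" where
  "potential_tail q x = enn2real (potential q (indicator {x<..}) 0)"

lemma ennreal_potential_tail:
  assumes "0 < q"
  shows "potential q (indicator {x<..}) z = ennreal (potential_tail q (x - z))"
proof -
  have "potential q (indicator {x<..}) z = potential q (indicator {x - z<..}) 0"
    unfolding potential_translate[of q _ z]
    by (rule arg_cong[where f="\<lambda>f. potential q f 0"]) (auto simp: indicator_def)
  moreover have "potential q (indicator {x - z<..}) 0 \<le> 1 * ennreal (1 / q)"
    by (rule potential_le[OF assms]) (simp add: indicator_def)
  then have "potential q (indicator {x - z<..}) 0 < top"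
    using le_less_trans by fastforce
  ultimately show ?thesis by (simp add: potential_tail_def)
qed

lemma potential_tail_nonneg: "0 \<le> potential_tail q x"
  by (simp add: potential_tail_def)

lemma potential_tail_le:
  assumes "0 < q"
  shows "potential_tail q x \<le> 1 / q"
proof -
  have "ennreal (potential_tail q x) \<le> 1 * ennreal (1 / q)"
    using potential_le[OF assms, of "indicator {x<..}" 1 0] ennreal_potential_tail[OF assms, of x 0]
    by (simp add: indicator_def)
  then show ?thesis using assms by (simp add: ennreal_le_iff)
qed

lemma potential_tail_tendsto:
  assumes "0 < q" "\<And>y. (\<lambda>n. indicator {x n<..} y :: ennreal) \<longlonglongrightarrow> indicator A y" "A \<in> sets borel"
  shows "(\<lambda>n. ennreal (potential_tail q (x n))) \<longlonglongrightarrow> potential q (indicator A) 0"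
  using potential_dominated_convergence[OF assms(1), of "\<lambda>n. indicator {x n<..}" "indicator A" 0]
    ennreal_potential_tail[OF assms(1), of "x _" 0] assms(2,3)
  by (simp add: indicator_def)

text \<open>
  If the potential does not charge \<open>(0, \<infinity>)\<close>, then almost every path is at or below \<open>0\<close> for almost all
  times, hence for all times by right-continuity.
\<close>
lemma potential_tail_0_pos:
  assumes q: "0 < q"
  shows "0 < potential_tail q 0"
proof (rule ccontr)
  assume "\<not> 0 < potential_tail q 0"
  then have "potential q (indicator {0<..}) 0 = 0"
    using ennreal_potential_tail[OF q, of 0 0] potential_tail_nonneg[of q 0] by simp
  then have "AE \<omega> in M. (\<integral>\<^sup>+t. ennreal (exp (- q * t)) * indicator {0..} t * indicator {0<..} (0 + Y t \<omega>) \<partial>lborel) = 0"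
    by (subst (asm) potential_swap, simp, subst (asm) nn_integral_0_iff_AE) measurable
  then have "AE \<omega> in M. \<forall>t\<ge>0. Y t \<omega> \<le> 0"
    using AE_space
  proof eventually_elim
    case (elim \<omega>)
    note [measurable] = elim(2)
    have "AE t in lborel. \<not> (0 \<le> t \<and> 0 < Y t \<omega>)"
      using elim(1)
      by (subst (asm) nn_integral_0_iff_AE) (measurable, auto elim!: eventually_mono simp: indicator_def split: if_splits)
    then have null: "emeasure lborel {t. 0 \<le> t \<and> 0 < Y t \<omega>} = 0"
      by (subst (asm) AE_iff_measurable[OF _ refl]) (auto, measurable)
    show ?case
    proof (intro allI impI, rule ccontr)
      fix t :: real assume t: "0 \<le> t" "\<not> Y t \<omega> \<le> 0"
      then obtain b where b: "t < b" "\<And>s. t \<le> s \<Longrightarrow> s < b \<Longrightarrow> 0 < Y s \<omega>"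
        using right_neighbourhood_above[of t 0 \<omega>] by auto
      have "emeasure lborel {t..<b} \<le> emeasure lborel {t. 0 \<le> t \<and> 0 < Y t \<omega>}"
        using b t by (intro emeasure_mono) auto
      then show False using null b(1) by simp
    qed
  qed
  then show False using not_nonincreasing by blast
qed

lemma passage_laplace_le_1:
  assumes "0 < q"
  shows "passage_laplace q x \<le> 1"
proof -
  have "passage_laplace q x \<le> (\<integral>\<^sup>+\<omega>. 1 \<partial>M)"
    unfolding passage_laplace_def using assms exceedance_time_nonneg[of x]
    by (intro nn_integral_mono) (auto simp: indicator_def)
  then show ?thesis by (simp add: emeasure_space_1)
qed

text \<open>
  Time spent above \<open>y \<ge> x\<close> is spent after \<open>\<rho>\<^sub>x\<close>. So the strong Markov property applies to the whole
  potential of \<open>(y, \<infinity>)\<close>, after an approximation of the indicator function by continuous functions.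
\<close>
lemma potential_tail_factor_ennreal:
  assumes q: "0 < q" and xy: "0 \<le> x" "x \<le> y"
  shows "potential q (indicator {y<..}) 0 = passage_laplace q x * potential q (indicator {y<..}) x"
proof -
  \<comment> \<open>continuous ramps that increase to the indicator function of \<open>(y, \<infinity>)\<close>\<close>
  define f where "f m z = min 1 (max 0 (real m * (z - y)))" for m z
  have cont: "continuous_on UNIV (f m)" for m
    unfolding f_def by (intro continuous_intros)
  have [measurable]: "f m \<in> borel_measurable borel" for m
    unfolding f_def by measurable
  have f01: "0 \<le> f m z" "f m z \<le> 1" for m z by (simp_all add: f_def)
  have flim: "(\<lambda>m. ennreal (f m z)) \<longlonglongrightarrow> indicator {y<..} z" for z
  proof (cases "y < z")
    case True
    then obtain N where N: "real N * (z - y) > 1" using reals_Archimedean3[of "z - y"] by auto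
    have "f m z = 1" if "N \<le> m" for m
    proof -
      have "real N * (z - y) \<le> real m * (z - y)" using that True by (intro mult_right_mono) auto
      then show ?thesis using N by (simp add: f_def)
    qed
    then have "eventually (\<lambda>m. ennreal (f m z) = 1) sequentially"
      by (auto simp: eventually_sequentially)
    then show ?thesis using True by (simp add: tendsto_eventually)
  next
    case False
    then have "real m * (z - y) \<le> 0" for m by (simp add: mult_nonneg_nonpos)
    then show ?thesis using False by (simp add: f_def max_absorb1)
  qed
  let ?r = "exceedance_time x" and ?I = "\<lambda>\<omega>. indicator {\<omega>. exceeds x \<omega>} \<omega> :: ennreal"
  let ?J = "\<lambda>f \<omega>. \<integral>\<^sup>+t. ennreal (exp (- q * t)) * (if ?r \<omega> < t then 1 else 0) * f (Y t \<omega>) \<partial>lborel"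
  have gt: "indicator {a<..} t = (if a < t then 1 else 0 :: ennreal)" for a t :: real by simp
  have bnd: "ennreal (exp (- q * t)) * (if ?r \<omega> < t then 1 else 0) * c \<le> ennreal (exp (- q * t)) * indicator {0..} t"
    if "c \<le> 1" for t \<omega> and c :: ennreal
    using mult_left_mono[OF that, of "ennreal (exp (- q * t))"] exceedance_time_nonneg[of x \<omega>]
    by (auto simp: indicator_def)
  have J1: "?J g \<omega> \<le> ennreal (1 / q)" if "\<And>z. g z \<le> 1" for g \<omega>
  proof -
    have "?J g \<omega> \<le> (\<integral>\<^sup>+t. ennreal (exp (- q * t)) * indicator {0..} t \<partial>lborel)"
      by (intro nn_integral_mono bnd that)
    then show ?thesis using q by (simp add: nn_integral_exp_from)
  qed
  have limJ: "(\<lambda>m. ?J (\<lambda>z. ennreal (f m z)) \<omega>) \<longlonglongrightarrow> ?J (indicator {y<..}) \<omega>" if [measurable]: "\<omega> \<in> space M" for \<omega>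
  proof (rule nn_integral_dominated_convergence[where w="\<lambda>t. ennreal (exp (- q * t)) * indicator {0..} t"])
    show "AE t in lborel. ennreal (exp (- q * t)) * (if ?r \<omega> < t then 1 else 0) * ennreal (f m (Y t \<omega>))
       \<le> ennreal (exp (- q * t)) * indicator {0..} t" for m
      by (intro AE_I2 bnd) (simp add: f01)
    show "AE t in lborel. (\<lambda>m. ennreal (exp (- q * t)) * (if ?r \<omega> < t then 1 else 0) * ennreal (f m (Y t \<omega>)))
      \<longlonglongrightarrow> ennreal (exp (- q * t)) * (if ?r \<omega> < t then 1 else 0) * indicator {y<..} (Y t \<omega>)"
      by (intro AE_I2 ennreal_tendsto_cmult flim) (auto simp: ennreal_mult_less_top)
  qed (use q in \<open>auto simp: nn_integral_exp_from\<close>)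
  have "(\<lambda>m. \<integral>\<^sup>+\<omega>. ?I \<omega> * ?J (\<lambda>z. ennreal (f m z)) \<omega> \<partial>M) \<longlonglongrightarrow> (\<integral>\<^sup>+\<omega>. ?I \<omega> * ?J (indicator {y<..}) \<omega> \<partial>M)"
  proof (rule nn_integral_dominated_convergence[where w="\<lambda>_. ennreal (1 / q)"])
    show "(\<lambda>\<omega>. ?I \<omega> * ?J (\<lambda>z. ennreal (f m z)) \<omega>) \<in> borel_measurable M" for m by measurable
    show "(\<lambda>\<omega>. ?I \<omega> * ?J (indicator {y<..}) \<omega>) \<in> borel_measurable M" by measurable
    show "AE \<omega> in M. ?I \<omega> * ?J (\<lambda>z. ennreal (f m z)) \<omega> \<le> ennreal (1 / q)" for m
      using J1[of "\<lambda>z. ennreal (f m z)"] f01 by (auto simp: indicator_def)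
    show "AE \<omega> in M. (\<lambda>m. ?I \<omega> * ?J (\<lambda>z. ennreal (f m z)) \<omega>) \<longlonglongrightarrow> ?I \<omega> * ?J (indicator {y<..}) \<omega>"
      using limJ by (intro AE_I2 ennreal_tendsto_cmult) (auto simp: indicator_def)
  qed (auto simp: emeasure_space_1)
  moreover have "(\<integral>\<^sup>+\<omega>. ?I \<omega> * ?J (\<lambda>z. ennreal (f m z)) \<omega> \<partial>M) =
      passage_laplace q x * potential q (\<lambda>z. ennreal (f m z)) x" for m
    using strong_markov_potential[OF q xy(1) cont f01(2)] unfolding gt .
  moreover have "(\<lambda>m. passage_laplace q x * potential q (\<lambda>z. ennreal (f m z)) x)
      \<longlonglongrightarrow> passage_laplace q x * potential q (indicator {y<..}) x"
  proof (rule ennreal_tendsto_cmult)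
    show "passage_laplace q x < top"
      using passage_laplace_le_1[OF q, of x] by (simp add: order_le_less_trans)
    show "(\<lambda>m. potential q (\<lambda>z. ennreal (f m z)) x) \<longlonglongrightarrow> potential q (indicator {y<..}) x"
      by (rule potential_dominated_convergence[OF q]) (auto simp: f01 flim)
  qed
  ultimately have "(\<integral>\<^sup>+\<omega>. ?I \<omega> * ?J (indicator {y<..}) \<omega> \<partial>M) = passage_laplace q x * potential q (indicator {y<..}) x"
    using LIMSEQ_unique by simp
  moreover have "(\<integral>\<^sup>+\<omega>. ?I \<omega> * ?J (indicator {y<..}) \<omega> \<partial>M) = potential q (indicator {y<..}) 0"
    unfolding potential_swap[OF borel_measurable_indicator[OF borel_open[OF open_greaterThan]]]
  proof (rule nn_integral_cong)
    fix \<omega> assume "\<omega> \<in> space M"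
    have "?I \<omega> * ?J (indicator {y<..}) \<omega> = (\<integral>\<^sup>+t. ?I \<omega> * (ennreal (exp (- q * t)) * (if ?r \<omega> < t then 1 else 0) * indicator {y<..} (Y t \<omega>)) \<partial>lborel)"
      by (rule nn_integral_cmult[symmetric]) (use \<open>\<omega> \<in> space M\<close> in measurable)
    also have "\<dots> = (\<integral>\<^sup>+t. ennreal (exp (- q * t)) * indicator {0..} t * indicator {y<..} (0 + Y t \<omega>) \<partial>lborel)"
    proof (rule nn_integral_cong_AE)
      show "AE t in lborel. ?I \<omega> * (ennreal (exp (- q * t)) * (if ?r \<omega> < t then 1 else 0) * indicator {y<..} (Y t \<omega>)) =
        ennreal (exp (- q * t)) * indicator {0..} t * indicator {y<..} (0 + Y t \<omega>)"
        using AE_lborel_singleton[of "?r \<omega>"]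
      proof eventually_elim
        case (elim t)
        show ?case
        proof (cases "0 \<le> t \<and> y < Y t \<omega>")
          case True
          then have "exceeds x \<omega>" "?r \<omega> \<le> t"
            using exceedance_time_le[of t x \<omega>] xy(2) by auto
          then show ?thesis using True elim by simp
        next
          case False
          then show ?thesis using exceedance_time_nonneg[of x \<omega>] by (auto simp: indicator_def)
        qed
      qed
    qed
    finally show "?I \<omega> * ?J (indicator {y<..}) \<omega> =
      (\<integral>\<^sup>+t. ennreal (exp (- q * t)) * indicator {0..} t * indicator {y<..} (0 + Y t \<omega>) \<partial>lborel)" .
  qed
  ultimately show ?thesis by simp
qed

definition passage_transform :: "real \<Rightarrow> real \<Rightarrow> real" where
  "passage_transform q x = enn2real (passage_laplace q x)"

lemma ennreal_passage_transform:
  assumes "0 < q"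
  shows "passage_laplace q x = ennreal (passage_transform q x)"
  unfolding passage_transform_def
  using passage_laplace_le_1[OF assms, of x] by (simp add: order_le_less_trans)

lemma passage_transform_nonneg: "0 \<le> passage_transform q x"
  by (simp add: passage_transform_def)

lemma potential_tail_factor:
  assumes q: "0 < q" and xy: "0 \<le> x" "x \<le> y"
  shows "potential_tail q y = passage_transform q x * potential_tail q (y - x)"
proof -
  have "ennreal (potential_tail q y) = ennreal (passage_transform q x * potential_tail q (y - x))"
    using potential_tail_factor_ennreal[OF assms]
    unfolding ennreal_potential_tail[OF q] ennreal_passage_transform[OF q]
    by (simp add: ennreal_mult passage_transform_nonneg potential_tail_nonneg)
  then show ?thesis
    by (simp add: passage_transform_nonneg potential_tail_nonneg)
qed

lemma passage_transform_mult:
  assumes q: "0 < q" and xy: "0 \<le> x" "0 \<le> y"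
  shows "passage_transform q (x + y) = passage_transform q x * passage_transform q y"
proof -
  have "passage_transform q (x + y) * potential_tail q 0 = potential_tail q (x + y)"
    using potential_tail_factor[OF q, of "x + y" "x + y"] xy by simp
  also have "\<dots> = passage_transform q x * potential_tail q y"
    using potential_tail_factor[OF q, of x "x + y"] xy by simp
  also have "\<dots> = passage_transform q x * passage_transform q y * potential_tail q 0"
    using potential_tail_factor[OF q, of y y] xy by simp
  finally show ?thesis using potential_tail_0_pos[OF q] by simp
qed

lemma passage_transform_antimono:
  assumes q: "0 < q" and "x \<le> y"
  shows "passage_transform q y \<le> passage_transform q x"
proof -
  have "passage_laplace q y \<le> passage_laplace q x"
    unfolding passage_laplace_def
    using exceedance_mono[OF \<open>x \<le> y\<close>] q
    by (intro nn_integral_mono) (auto simp: indicator_def)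
  then show ?thesis
    unfolding ennreal_passage_transform[OF q] by (simp add: passage_transform_nonneg)
qed

text \<open>
  If \<open>L\<^sub>q\<close> vanished at \<open>x\<close>, then by multiplicativity it would vanish at all \<open>x / n\<close>, and the potential of
  \<open>(0, \<infinity>)\<close>, which is the limit of the potentials of \<open>(x / n, \<infinity>)\<close>, would be zero.
\<close>
lemma passage_transform_pos:
  assumes q: "0 < q" and "0 \<le> x"
  shows "0 < passage_transform q x"
proof (rule ccontr)
  assume "\<not> 0 < passage_transform q x"
  then have x0: "passage_transform q x = 0"
    using passage_transform_nonneg[of q x] by simp
  have pw: "passage_transform q (real n * a) = passage_transform q a ^ n" if "0 \<le> a" "0 < n" for a n
    using that(2)
  proof (induction n rule: nat_induct_non_zero)
    case (Suc n)
    then show ?case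
      using passage_transform_mult[OF q, of "real n * a" a] \<open>0 \<le> a\<close> by (simp add: algebra_simps)
  qed simp
  have "passage_transform q (x / real (Suc n)) = 0" for n
    using pw[of "x / real (Suc n)" "Suc n"] x0 \<open>0 \<le> x\<close> by (auto simp del: of_nat_Suc)
  then have z: "potential_tail q (x / real (Suc n)) = 0" for n
    using potential_tail_factor[OF q, of "x / real (Suc n)" "x / real (Suc n)"] \<open>0 \<le> x\<close>
    by (simp del: of_nat_Suc)
  have "(\<lambda>n. indicator {x / real (Suc n)<..} y :: ennreal) \<longlonglongrightarrow> indicator {0<..} y" for y
  proof (cases "0 < y")
    case True
    have "(\<lambda>n. x / real (Suc n)) \<longlonglongrightarrow> 0"
      using tendsto_mult_left[OF LIMSEQ_Suc[OF lim_1_over_n], of x] by simp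
    then have "eventually (\<lambda>n. x / real (Suc n) < y) sequentially"
      using order_tendstoD(2) True by blast
    then have "eventually (\<lambda>n. indicator {x / real (Suc n)<..} y = (1::ennreal)) sequentially"
      by eventually_elim simp
    then show ?thesis using True by (simp add: tendsto_eventually)
  next
    case False
    have "0 \<le> x / real (Suc n)" for n using \<open>0 \<le> x\<close> by simp
    then have "\<not> x / real (Suc n) < y" for n using False by (meson le_less_trans)
    then show ?thesis using False by simp
  qed
  from potential_tail_tendsto[OF q this]
  have "(\<lambda>n::nat. 0) \<longlonglongrightarrow> potential q (indicator {0<..}) 0"
    by (simp add: z del: of_nat_Suc)
  then have "potential q (indicator {0<..}) 0 = 0"
    using LIMSEQ_unique tendsto_const by blast
  then show False
    using ennreal_potential_tail[OF q, of 0 0] potential_tail_0_pos[OF q] by simp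
qed

text \<open>The function called \<open>\<Phi>\<close> above.\<close>
definition passage_exponent :: "real \<Rightarrow> real" where
  "passage_exponent q = - ln (passage_transform q 1)"

lemma passage_transform_eq_exp:
  assumes q: "0 < q" and "0 \<le> x"
  shows "passage_transform q x = exp (- (passage_exponent q * x))"
  using decreasing_multiplicative_eq_exp[of "passage_transform q" x]
    passage_transform_mult[OF q] passage_transform_antimono[OF q] passage_transform_pos[OF q] \<open>0 \<le> x\<close>
  by (simp add: passage_exponent_def mult.commute)

lemma potential_tail_eq_exp:
  assumes q: "0 < q" and "0 \<le> x"
  shows "potential_tail q x = potential_tail q 0 * exp (- (passage_exponent q * x))"
  using potential_tail_factor[OF q, of x x] passage_transform_eq_exp[OF assms] \<open>0 \<le> x\<close> by simp

lemma passage_exponent_pos: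
  assumes q: "0 < q"
  shows "0 < passage_exponent q"
proof (rule ccontr)
  assume neg: "\<not> 0 < passage_exponent q"
  have ge: "potential_tail q 0 \<le> potential_tail q (real n)" for n
  proof -
    have "passage_exponent q * real n \<le> 0" using neg by (simp add: mult_nonpos_nonneg)
    then have "1 \<le> exp (- (passage_exponent q * real n))" by simp
    then have "potential_tail q 0 * 1 \<le> potential_tail q 0 * exp (- (passage_exponent q * real n))"
      by (intro mult_left_mono potential_tail_nonneg)
    then show ?thesis using potential_tail_eq_exp[OF q, of "real n"] by simp
  qed
  have "(\<lambda>n. indicator {real n<..} y :: ennreal) \<longlonglongrightarrow> indicator {} y" for y
  proof -
    obtain N where "y \<le> real N" using real_arch_simple by blast
    then have "eventually (\<lambda>n. indicator {real n<..} y = (0::ennreal)) sequentially"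
      unfolding eventually_sequentially by (intro exI[of _ N]) (auto simp: indicator_def)
    then show ?thesis by (simp add: tendsto_eventually)
  qed
  from potential_tail_tendsto[OF q this]
  have "(\<lambda>n. ennreal (potential_tail q (real n))) \<longlonglongrightarrow> potential q (indicator {}) 0" by simp
  then have "(\<lambda>n. ennreal (potential_tail q (real n))) \<longlonglongrightarrow> 0" by (simp add: potential_def)
  then have "ennreal (potential_tail q 0) \<le> 0"
    by (rule LIMSEQ_le_const) (use ge in \<open>auto intro!: ennreal_leI\<close>)
  then show False using potential_tail_0_pos[OF q] by (simp add: ennreal_eq_0_iff)
qed

text \<open>
  The constant called \<open>c(q)\<close> above. It is determined by the total mass \<open>c(q) / \<Phi>(q)\<close> that the potential
  gives to \<open>(0, \<infinity>)\<close>.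
\<close>
definition potential_rate :: "real \<Rightarrow> real" where
  "potential_rate q = potential_tail q 0 * passage_exponent q"

lemma potential_rate_pos: "0 < q \<Longrightarrow> 0 < potential_rate q"
  by (simp add: potential_rate_def potential_tail_0_pos passage_exponent_pos)

text \<open>
  Two measures on the line that agree on all half-lines \<open>(x, \<infinity>)\<close> are equal. Here the first one is the
  restriction of the potential measure to \<open>(0, \<infinity>)\<close>, written as the image under \<open>Y\<close> of a measure on
  pairs of a time and a path.
\<close>
lemma potential_positive_half_line:
  assumes r: "0 < r" and [measurable]: "f \<in> borel_measurable borel"
  shows "potential r (\<lambda>z. indicator {0<..} z * f z) 0 =
    (\<integral>\<^sup>+z. ennreal (potential_rate r * exp (- (passage_exponent r * z))) * indicator {0<..} z * f z \<partial>lborel)"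
proof -
  define N1 where "N1 = distr (density (lborel \<Otimes>\<^sub>M M)
      (\<lambda>p. ennreal (exp (- r * fst p)) * indicator {0..} (fst p) * indicator {0<..} (Y (fst p) (snd p))))
      borel (\<lambda>p. Y (fst p) (snd p))"
  define N2 where "N2 = density lborel (\<lambda>z. ennreal (potential_rate r * exp (- (passage_exponent r * z))) * indicator {0<..} z)"
  have int1: "(\<integral>\<^sup>+z. g z \<partial>N1) = potential r (\<lambda>z. indicator {0<..} z * g z) 0"
    if [measurable]: "g \<in> borel_measurable borel" for g
  proof -
    have "(\<integral>\<^sup>+z. g z \<partial>N1) = (\<integral>\<^sup>+p. ennreal (exp (- r * fst p)) * indicator {0..} (fst p) *
        indicator {0<..} (Y (fst p) (snd p)) * g (Y (fst p) (snd p)) \<partial>(lborel \<Otimes>\<^sub>M M))"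
      unfolding N1_def by (simp add: nn_integral_distr nn_integral_density)
    also have "\<dots> = (\<integral>\<^sup>+t. (\<integral>\<^sup>+\<omega>. ennreal (exp (- r * t)) * indicator {0..} t *
        indicator {0<..} (Y t \<omega>) * g (Y t \<omega>) \<partial>M) \<partial>lborel)"
      by (subst nn_integral_fst[symmetric]) simp_all
    also have "\<dots> = potential r (\<lambda>z. indicator {0<..} z * g z) 0"
      unfolding potential_def by (intro nn_integral_cong) (simp add: nn_integral_cmult mult.assoc)
    finally show ?thesis .
  qed
  have int2: "(\<integral>\<^sup>+z. g z \<partial>N2) =
     (\<integral>\<^sup>+z. ennreal (potential_rate r * exp (- (passage_exponent r * z))) * indicator {0<..} z * g z \<partial>lborel)"
    if [measurable]: "g \<in> borel_measurable borel" for g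
    unfolding N2_def by (simp add: nn_integral_density)
  have s: "sets N1 = sets borel" "sets N2 = sets borel" by (simp_all add: N1_def N2_def)
  have t1: "emeasure N1 {x<..} = ennreal (potential_tail r (max 0 x))" for x
  proof -
    have "emeasure N1 {x<..} = (\<integral>\<^sup>+z. indicator {x<..} z \<partial>N1)" using s by simp
    also have "\<dots> = potential r (\<lambda>z. indicator {0<..} z * indicator {x<..} z) 0" by (rule int1) measurable
    also have "(\<lambda>z. indicator {0<..} z * indicator {x<..} z) = (indicator {max 0 x<..} :: real \<Rightarrow> ennreal)"
      by (auto simp: indicator_def)
    finally show ?thesis using ennreal_potential_tail[OF r, of "max 0 x" 0] by simp
  qed
  have t2: "emeasure N2 {x<..} = ennreal (potential_tail r (max 0 x))" for x
  proof -
    let ?a = "max 0 x" and ?d = "passage_exponent r"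
    have "emeasure N2 {x<..} = (\<integral>\<^sup>+z. indicator {x<..} z \<partial>N2)" using s by simp
    also have "\<dots> = (\<integral>\<^sup>+z. ennreal (potential_rate r * exp (- (?d * z))) * indicator {0<..} z * indicator {x<..} z \<partial>lborel)"
      by (rule int2) measurable
    also have "\<dots> = (\<integral>\<^sup>+z. ennreal (potential_rate r) * (ennreal (exp (- (?d * z))) * indicator {?a..} z) \<partial>lborel)"
    proof (rule nn_integral_cong_AE)
      show "AE z in lborel. ennreal (potential_rate r * exp (- (?d * z))) * indicator {0<..} z * indicator {x<..} z =
        ennreal (potential_rate r) * (ennreal (exp (- (?d * z))) * indicator {?a..} z)"
        using AE_lborel_singleton[of ?a]
        by eventually_elim (auto simp: indicator_def ennreal_mult potential_rate_pos[OF r] less_imp_le max_def split: if_splits)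
    qed
    also have "\<dots> = ennreal (potential_rate r) * ennreal (exp (- (?d * ?a)) / ?d)"
      using passage_exponent_pos[OF r] by (subst nn_integral_cmult) (auto simp: nn_integral_exp_from)
    also have "\<dots> = ennreal (potential_tail r ?a)"
      using passage_exponent_pos[OF r] potential_tail_eq_exp[OF r, of ?a] potential_rate_pos[OF r]
      by (simp add: ennreal_mult[symmetric] potential_rate_def)
    finally show ?thesis .
  qed
  have "N1 = N2"
    by (rule measure_eqI_lessThan) (simp_all add: s t1 t2)
  then show ?thesis using int1[of f] int2[of f] by simp
qed

section \<open>The resolvent equation and the moment of the exceedance time\<close>

text \<open>
  By the Markov property, the double potential on the right weights the mean of \<open>f (Y v)\<close> by the integral
  of \<open>exp (- r t - q (v - t))\<close> over \<open>0 \<le> t \<le> v\<close>; multiplied by \<open>r - q\<close> this is \<open>exp (- q v) - exp (- r v)\<close>.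
\<close>
lemma resolvent_equation:
  assumes qr: "0 < q" "q < r" and [measurable]: "f \<in> borel_measurable borel" and f1: "\<And>y. f y \<le> 1"
  shows "potential q f 0 = potential r f 0 + ennreal (r - q) * potential r (potential q f) 0"
proof -
  define p where "p v = (\<integral>\<^sup>+\<omega>. f (Y v \<omega>) \<partial>M)" for v
  have [measurable]: "p \<in> borel_measurable borel" unfolding p_def by measurable
  have mean: "(\<integral>\<^sup>+\<omega>. potential q f (Y t \<omega>) \<partial>M) =
      ennreal (exp (q * t)) * (\<integral>\<^sup>+v. ennreal (exp (- q * v)) * indicator {t..} v * p v \<partial>lborel)" if "0 \<le> t" for t
  proof -
    have "ennreal (exp (- q * t)) * (\<integral>\<^sup>+\<omega>. potential q f (Y t \<omega>) \<partial>M) =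
        (\<integral>\<^sup>+\<omega>. indicator (space M) \<omega> * (ennreal (exp (- q * t)) * potential q f (Y t \<omega>)) \<partial>M)"
      by (subst nn_integral_cmult[symmetric]) (auto intro!: nn_integral_cong)
    also have "\<dots> = (\<integral>\<^sup>+\<omega>. indicator (space M) \<omega> * (\<integral>\<^sup>+v. ennreal (exp (- q * v)) * indicator {t..} v * f (Y v \<omega>) \<partial>lborel) \<partial>M)"
      by (rule markov_potential[symmetric]) (use markov_event_space that f1 in auto)
    also have "\<dots> = (\<integral>\<^sup>+\<omega>. (\<integral>\<^sup>+v. ennreal (exp (- q * v)) * indicator {t..} v * f (Y v \<omega>) \<partial>lborel) \<partial>M)"
      by (intro nn_integral_cong) simp
    also have "\<dots> = (\<integral>\<^sup>+v. (\<integral>\<^sup>+\<omega>. ennreal (exp (- q * v)) * indicator {t..} v * f (Y v \<omega>) \<partial>M) \<partial>lborel)"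
      by (rule lborel_M.Fubini') measurable
    also have "\<dots> = (\<integral>\<^sup>+v. ennreal (exp (- q * v)) * indicator {t..} v * p v \<partial>lborel)"
      unfolding p_def by (intro nn_integral_cong nn_integral_cmult) measurable
    finally have "ennreal (exp (q * t)) * (ennreal (exp (- q * t)) * (\<integral>\<^sup>+\<omega>. potential q f (Y t \<omega>) \<partial>M)) =
      ennreal (exp (q * t)) * (\<integral>\<^sup>+v. ennreal (exp (- q * v)) * indicator {t..} v * p v \<partial>lborel)" by simp
    moreover have "ennreal (exp (q * t)) * ennreal (exp (- q * t)) = 1"
      by (simp add: ennreal_mult[symmetric] exp_add[symmetric])
    ultimately show ?thesis by (simp add: mult.assoc[symmetric])
  qed
  have "ennreal (r - q) * potential r (potential q f) 0 =
     ennreal (r - q) * (\<integral>\<^sup>+t. (\<integral>\<^sup>+v. ennreal (exp (- ((r - q) * t))) * indicator {0..} t * (ennreal (exp (- q * v)) * indicator {t..} v * p v) \<partial>lborel) \<partial>lborel)"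
    unfolding potential_def[of r]
  proof (intro arg_cong[where f="(*) (ennreal (r - q))"] nn_integral_cong)
    fix t :: real
    have e: "exp (- r * t) * exp (q * t) = exp (- ((r - q) * t))"
      by (simp add: exp_add[symmetric] algebra_simps)
    have "ennreal (exp (- r * t)) * indicator {0..} t * (\<integral>\<^sup>+\<omega>. potential q f (0 + Y t \<omega>) \<partial>M) =
       ennreal (exp (- r * t)) * indicator {0..} t * (ennreal (exp (q * t)) * (\<integral>\<^sup>+v. ennreal (exp (- q * v)) * indicator {t..} v * p v \<partial>lborel))"
      using mean[of t] by (auto simp: indicator_def)
    also have "\<dots> = ennreal (exp (- ((r - q) * t))) * indicator {0..} t * (\<integral>\<^sup>+v. ennreal (exp (- q * v)) * indicator {t..} v * p v \<partial>lborel)"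
      unfolding e[symmetric] by (simp add: ennreal_mult mult_ac)
    also have "\<dots> = (\<integral>\<^sup>+v. ennreal (exp (- ((r - q) * t))) * indicator {0..} t * (ennreal (exp (- q * v)) * indicator {t..} v * p v) \<partial>lborel)"
      by (rule nn_integral_cmult[symmetric]) measurable
    finally show "ennreal (exp (- r * t)) * indicator {0..} t * (\<integral>\<^sup>+\<omega>. potential q f (0 + Y t \<omega>) \<partial>M) =
      (\<integral>\<^sup>+v. ennreal (exp (- ((r - q) * t))) * indicator {0..} t * (ennreal (exp (- q * v)) * indicator {t..} v * p v) \<partial>lborel)" .
  qed
  also have "\<dots> = ennreal (r - q) * (\<integral>\<^sup>+v. (\<integral>\<^sup>+t. ennreal (exp (- ((r - q) * t))) * indicator {0..} t * (ennreal (exp (- q * v)) * indicator {t..} v * p v) \<partial>lborel) \<partial>lborel)"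
  proof -
    have [measurable]: "Measurable.pred (borel \<Otimes>\<^sub>M borel) (\<lambda>w::real \<times> real. fst w \<in> {snd w..})"
      by simp
    show ?thesis
      by (rule arg_cong[where f="(*) _"], rule lborel_pair.Fubini') (simp add: indicator_def, measurable)
  qed
  also have "\<dots> = ennreal (r - q) * (\<integral>\<^sup>+v. ennreal (exp (- q * v)) * p v * indicator {0..} v * ennreal ((1 - exp (- ((r - q) * v))) / (r - q)) \<partial>lborel)"
  proof (intro arg_cong[where f="(*) (ennreal (r - q))"] nn_integral_cong_AE, rule AE_mp[OF AE_lborel_singleton[of 0]], intro AE_I2 impI)
    fix v :: real assume "v \<noteq> 0"
    have "(\<integral>\<^sup>+t. ennreal (exp (- ((r - q) * t))) * indicator {0..} t * (ennreal (exp (- q * v)) * indicator {t..} v * p v) \<partial>lborel) =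
      (\<integral>\<^sup>+t. (ennreal (exp (- q * v)) * p v * indicator {0..} v) * (ennreal (exp (- ((r - q) * t))) * indicator {0..<v} t) \<partial>lborel)"
      by (rule nn_integral_cong_AE, rule AE_mp[OF AE_lborel_singleton[of v]]) (auto simp: indicator_def mult_ac)
    also have "\<dots> = (ennreal (exp (- q * v)) * p v * indicator {0..} v) * (\<integral>\<^sup>+t. (ennreal (exp (- ((r - q) * t))) * indicator {0..<v} t) \<partial>lborel)"
      by (rule nn_integral_cmult) measurable
    also have "\<dots> = ennreal (exp (- q * v)) * p v * indicator {0..} v * ennreal ((1 - exp (- ((r - q) * v))) / (r - q))"
      using nn_integral_exp_between[of "r - q" 0 v] qr by (cases "0 \<le> v") auto
    finally show "(\<integral>\<^sup>+t. ennreal (exp (- ((r - q) * t))) * indicator {0..} t * (ennreal (exp (- q * v)) * indicator {t..} v * p v) \<partial>lborel) =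
      ennreal (exp (- q * v)) * p v * indicator {0..} v * ennreal ((1 - exp (- ((r - q) * v))) / (r - q))" .
  qed
  also have "\<dots> = (\<integral>\<^sup>+v. ennreal (exp (- q * v) - exp (- r * v)) * indicator {0..} v * p v \<partial>lborel)"
  proof (subst nn_integral_cmult[symmetric], measurable, rule nn_integral_cong)
    fix v :: real
    show "ennreal (r - q) * (ennreal (exp (- q * v)) * p v * indicator {0..} v * ennreal ((1 - exp (- ((r - q) * v))) / (r - q))) =
      ennreal (exp (- q * v) - exp (- r * v)) * indicator {0..} v * p v"
    proof (cases "0 \<le> v")
      case True
      have mult3: "ennreal a * ennreal b * ennreal c = ennreal (a * b * c)"
        if "0 \<le> a" "0 \<le> b" "0 \<le> c" for a b c
        using that by (simp add: ennreal_mult)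
      have "0 \<le> 1 - exp (- ((r - q) * v))" using True qr by simp
      then have "ennreal (r - q) * ennreal (exp (- q * v)) * ennreal ((1 - exp (- ((r - q) * v))) / (r - q)) =
        ennreal ((r - q) * exp (- q * v) * ((1 - exp (- ((r - q) * v))) / (r - q)))"
        using qr by (intro mult3) simp_all
      also have "(r - q) * exp (- q * v) * ((1 - exp (- ((r - q) * v))) / (r - q)) = exp (- q * v) - exp (- q * v) * exp (- ((r - q) * v))"
        using qr by simp (simp only: right_diff_distrib mult_1_right)
      also have "exp (- q * v) * exp (- ((r - q) * v)) = exp (- r * v)"
        by (simp add: exp_add[symmetric] algebra_simps)
      finally show ?thesis using True by (simp add: mult_ac)
    qed simp
  qed
  also have "potential r f 0 + \<dots> = potential q f 0"
  proof -
    have pq: "potential s f 0 = (\<integral>\<^sup>+v. ennreal (exp (- s * v)) * indicator {0..} v * p v \<partial>lborel)" for s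
      unfolding potential_def p_def by simp
    have "exp (- r * v) \<le> exp (- q * v)" if "0 \<le> v" for v
      using that qr by (simp add: mult_right_mono)
    then have split: "ennreal (exp (- q * v)) = ennreal (exp (- r * v)) + ennreal (exp (- q * v) - exp (- r * v))" if "0 \<le> v" for v
      using that by (subst ennreal_plus[symmetric]) simp_all
    have "potential r f 0 + (\<integral>\<^sup>+v. ennreal (exp (- q * v) - exp (- r * v)) * indicator {0..} v * p v \<partial>lborel) =
        (\<integral>\<^sup>+v. ennreal (exp (- r * v)) * indicator {0..} v * p v +
          ennreal (exp (- q * v) - exp (- r * v)) * indicator {0..} v * p v \<partial>lborel)"
      unfolding pq by (rule nn_integral_add[symmetric]) measurable
    also have "\<dots> = potential q f 0"
      unfolding pq
    proof (rule nn_integral_cong)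
      fix v :: real
      show "ennreal (exp (- r * v)) * indicator {0..} v * p v +
          ennreal (exp (- q * v) - exp (- r * v)) * indicator {0..} v * p v =
        ennreal (exp (- q * v)) * indicator {0..} v * p v"
      proof (cases "0 \<le> v")
        case True
        show ?thesis by (simp only: split[OF True] distrib_right)
      qed simp
    qed
    finally show ?thesis .
  qed
  finally show ?thesis by simp
qed

lemma measurable_potential_tail [measurable]: "potential_tail q \<in> borel_measurable borel"
proof -
  have "potential_tail q x = enn2real (potential q (indicator {0<..}) (- x))" for x
    unfolding potential_tail_def potential_translate[of q _ "- x"]
    by (rule arg_cong[where f="\<lambda>f. enn2real (potential q f 0)"]) (auto simp: indicator_def)
  then have "potential_tail q = (\<lambda>x. enn2real (potential q (indicator {0<..}) (- x)))"
    by (rule ext)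
  also have "\<dots> \<in> borel_measurable borel" by measurable
  finally show ?thesis .
qed

lemma resolvent_tail:
  assumes qr: "0 < q" "q < r"
  shows "ennreal (potential_tail q x) = ennreal (potential_tail r x) +
    ennreal (r - q) * potential r (\<lambda>z. ennreal (potential_tail q (x - z))) 0"
proof -
  have "potential q (indicator {x<..}) = (\<lambda>z. ennreal (potential_tail q (x - z)))"
    by (rule ext, rule ennreal_potential_tail[OF qr(1)])
  then show ?thesis
    using resolvent_equation[OF qr, of "indicator {x<..}"] ennreal_potential_tail[of _ x 0] qr
    by (simp add: indicator_def)
qed

text \<open>
  These inequalities say that \<open>c(r)\<close> is the left derivative of \<open>\<Phi>\<close> at \<open>r\<close>, because \<open>q / r\<close> tends to \<open>1\<close> as
  \<open>q\<close> tends to \<open>r\<close>. They come from the resolvent equation on \<open>(x, \<infinity>)\<close>, in which the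
  potential \<open>U\<^sub>r\<close> integrates the function \<open>H x\<close> whose value at \<open>z\<close> is \<open>U\<^sub>q (x - z, \<infinity>)\<close>. For \<open>0 < z \<le> x\<close> (the part
  \<open>Mid\<close>) both the function and the measure are explicit exponentials, and the integral is
  \<open>U\<^sub>q (x, \<infinity>) c(r) (1 - exp (- d x)) / d\<close> with \<open>d = \<Phi>(r) - \<Phi>(q)\<close>. Dropping the rest
  gives one inequality. For the other one the rest is bounded: the part \<open>z \<le> 0\<close> contributes at most
  \<open>U\<^sub>q (x, \<infinity>) / r\<close>, and the part \<open>z > x\<close> at most \<open>U\<^sub>r (x, \<infinity>) / q\<close>, which is negligible against
  \<open>U\<^sub>q (x, \<infinity>)\<close> for large \<open>x\<close>.
\<close>
lemma potential_rate_bounds: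
  assumes qr: "0 < q" "q < r"
  shows "passage_exponent q < passage_exponent r"
    and "potential_rate r * (r - q) \<le> passage_exponent r - passage_exponent q"
    and "q / r * (passage_exponent r - passage_exponent q) \<le> potential_rate r * (r - q)"
proof -
  define d where "d = passage_exponent r - passage_exponent q"
  define c where "c = potential_rate r"
  define u where "u x = potential_tail q x" for x
  define H where "H x z = ennreal (u (x - z))" for x z
  define Mid where "Mid x z = indicator {0<..} z * (indicator {..x} z * ennreal (u x * exp (passage_exponent q * z)))" for x z :: real
  have r: "0 < r" using qr by simp
  have c: "0 < c" unfolding c_def using potential_rate_pos[OF r] .
  have u: "u x = u 0 * exp (- (passage_exponent q * x))" "0 < u x" if "0 \<le> x" for x
    using potential_tail_eq_exp[OF qr(1) that] potential_tail_0_pos[OF qr(1)] by (simp_all add: u_def)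
  have u0: "0 \<le> u x" for x by (simp add: u_def potential_tail_nonneg)
  have [measurable]: "u \<in> borel_measurable borel" unfolding u_def by measurable
  have res: "ennreal (u x) = ennreal (potential_tail r x) + ennreal (r - q) * potential r (H x) 0" for x
    using resolvent_tail[OF qr, of x] by (simp add: u_def H_def[abs_def])
  have Hmid: "H x z = ennreal (u x * exp (passage_exponent q * z))" if "0 \<le> x" "z \<le> x" for x z
  proof -
    have "u (x - z) = u x * exp (passage_exponent q * z)"
      using u(1)[of "x - z"] u(1)[of x] that by (simp add: exp_add[symmetric] algebra_simps)
    then show ?thesis by (simp add: H_def)
  qed
  have [measurable]: "Mid x \<in> borel_measurable borel" for x unfolding Mid_def[abs_def] by measurable
  have mid: "potential r (Mid x) 0 =
      ennreal (c * u x) * (\<integral>\<^sup>+z. ennreal (exp (- (d * z))) * indicator {0..<x} z \<partial>lborel)" if "0 \<le> x" for x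
  proof -
    have "potential r (Mid x) 0 = (\<integral>\<^sup>+z. ennreal (c * exp (- (passage_exponent r * z))) * indicator {0<..} z *
        (indicator {..x} z * ennreal (u x * exp (passage_exponent q * z))) \<partial>lborel)"
      unfolding Mid_def[abs_def] c_def by (rule potential_positive_half_line[OF r]) measurable
    also have "\<dots> = (\<integral>\<^sup>+z. ennreal (c * u x) * (ennreal (exp (- (d * z))) * indicator {0..<x} z) \<partial>lborel)"
    proof (rule nn_integral_cong_AE, rule AE_mp[OF AE_lborel_singleton[of 0]],
        rule AE_mp[OF AE_lborel_singleton[of x]], intro AE_I2 impI)
      fix z assume z: "z \<noteq> x" "z \<noteq> 0"
      have "ennreal (c * exp (- (passage_exponent r * z))) * ennreal (u x * exp (passage_exponent q * z)) =
        ennreal ((c * u x) * (exp (- (passage_exponent r * z)) * exp (passage_exponent q * z)))"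
        using c u0[of x] by (subst ennreal_mult[symmetric]) (auto simp: mult_ac)
      also have "exp (- (passage_exponent r * z)) * exp (passage_exponent q * z) = exp (- (d * z))"
        by (simp add: exp_add[symmetric] d_def algebra_simps)
      finally have "ennreal (c * exp (- (passage_exponent r * z))) * ennreal (u x * exp (passage_exponent q * z)) =
        ennreal (c * u x) * ennreal (exp (- (d * z)))"
        using c u0[of x] by (simp add: ennreal_mult)
      then show "ennreal (c * exp (- (passage_exponent r * z))) * indicator {0<..} z *
          (indicator {..x} z * ennreal (u x * exp (passage_exponent q * z))) =
        ennreal (c * u x) * (ennreal (exp (- (d * z))) * indicator {0..<x} z)"
        using z by (auto simp: indicator_def)
    qed
    also have "\<dots> = ennreal (c * u x) * (\<integral>\<^sup>+z. ennreal (exp (- (d * z))) * indicator {0..<x} z \<partial>lborel)"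
      by (rule nn_integral_cmult) measurable
    finally show ?thesis .
  qed
  have low: "ennreal (r - q) * potential r (Mid x) 0 \<le> ennreal (u x)" if "0 \<le> x" for x
  proof -
    have "Mid x z \<le> H x z" for z
      using Hmid[OF that, of z] by (auto simp: Mid_def indicator_def)
    then have "ennreal (r - q) * potential r (Mid x) 0 \<le> ennreal (r - q) * potential r (H x) 0"
      by (intro mult_left_mono potential_mono) auto
    also have "\<dots> \<le> ennreal (u x)" unfolding res[of x] by simp
    finally show ?thesis .
  qed
  \<comment> \<open>otherwise the integral of \<open>exp (- d z)\<close> over \<open>(0, x]\<close>, which \<open>low\<close> bounds, would be at least \<open>x\<close>\<close>
  have d: "0 < d"
  proof (rule ccontr)
    assume "\<not> 0 < d"
    have "(r - q) * c * x \<le> 1" if x: "0 \<le> x" for x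
    proof -
      have "ennreal x = (\<integral>\<^sup>+z. indicator {0..<x} z \<partial>lborel)" using x by simp
      also have "\<dots> \<le> (\<integral>\<^sup>+z. ennreal (exp (- (d * z))) * indicator {0..<x} z \<partial>lborel)"
        using \<open>\<not> 0 < d\<close> by (intro nn_integral_mono) (auto simp: indicator_def mult_nonpos_nonneg)
      finally have "ennreal (r - q) * (ennreal (c * u x) * ennreal x) \<le> ennreal (r - q) * potential r (Mid x) 0"
        unfolding mid[OF x] by (intro mult_left_mono) auto
      also note low[OF x]
      finally have "(r - q) * (c * u x * x) \<le> u x"
        using qr c u(2)[OF x] x by (simp add: ennreal_mult[symmetric])
      then have "(r - q) * c * x * u x \<le> 1 * u x" by (simp add: mult_ac)
      then show ?thesis using u(2)[OF x] by (simp only: mult_le_cancel_right_pos)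
    qed
    moreover have "0 < (r - q) * c" using qr c by simp
    ultimately show False
      using reals_Archimedean3[of "(r - q) * c"] by (metis mult.commute not_le of_nat_0_le_iff)
  qed
  then show "passage_exponent q < passage_exponent r" by (simp add: d_def)
  have mid': "potential r (Mid x) 0 = ennreal (c * u x * ((1 - exp (- (d * x))) / d))" if "0 \<le> x" for x
    unfolding mid[OF that] using nn_integral_exp_between[OF d that] c u0[of x] d that
    by (simp add: ennreal_mult[symmetric])
  have lim: "(\<lambda>n. exp (- (d * real n))) \<longlonglongrightarrow> 0"
    using d by (intro filterlim_compose[OF exp_at_bot]) 
      (simp add: filterlim_uminus_at_bot filterlim_tendsto_pos_mult_at_top[OF tendsto_const _ filterlim_real_sequentially])
  have "(r - q) * (c * ((1 - exp (- (d * real n))) / d)) \<le> 1" for n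
  proof -
    have "ennreal ((r - q) * (c * u (real n) * ((1 - exp (- (d * real n))) / d))) =
        ennreal (r - q) * potential r (Mid (real n)) 0"
      by (subst mid'[of "real n"], simp, rule ennreal_mult', use qr in simp)
    also have "\<dots> \<le> ennreal (u (real n))"
      by (rule low) simp
    finally have "(r - q) * (c * ((1 - exp (- (d * real n))) / d)) * u (real n) \<le> 1 * u (real n)"
      using u0[of "real n"] by (simp add: mult_ac)
    then show ?thesis using u(2)[of "real n"] by (simp only: mult_le_cancel_right_pos)
  qed
  moreover have "(\<lambda>n. (r - q) * (c * ((1 - exp (- (d * real n))) / d))) \<longlonglongrightarrow> (r - q) * (c * ((1 - 0) / d))"
    by (intro tendsto_intros lim) (use d in auto)
  ultimately have "(r - q) * (c * ((1 - 0) / d)) \<le> 1"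
    by (intro LIMSEQ_le_const2) auto
  then show "potential_rate r * (r - q) \<le> passage_exponent r - passage_exponent q"
    using d by (simp add: c_def[symmetric] d_def[symmetric] field_simps)
  define p where "p = potential_tail r 0 / u 0"
  have up: "1 \<le> p * exp (- (d * x)) + (r - q) * (c * ((1 - exp (- (d * x))) / d) + 1 / r + 1 / q * (p * exp (- (d * x))))"
    if x: "0 \<le> x" for x
  proof -
    have ur: "potential_tail r x = p * exp (- (d * x)) * u x"
    proof -
      have "potential_tail r x = p * u 0 * exp (- (passage_exponent r * x))"
        using potential_tail_eq_exp[OF r x] u(2)[of 0] by (simp add: p_def)
      also have "exp (- (passage_exponent r * x)) = exp (- (d * x)) * exp (- (passage_exponent q * x))"
        by (simp add: exp_add[symmetric] d_def algebra_simps)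
      finally show ?thesis using u(1)[OF x] by simp
    qed
    have "H x z \<le> Mid x z + (ennreal (u x) + ennreal (1 / q) * indicator {x<..} z)" for z
    proof -
      consider "z \<le> 0" | "0 < z" "z \<le> x" | "x < z" "0 < z" using x by linarith
      then show ?thesis
      proof cases
        case 1
        then have "passage_exponent q * z \<le> 0"
          using passage_exponent_pos[OF qr(1)] by (simp add: mult_nonneg_nonpos)
        then have "u x * exp (passage_exponent q * z) \<le> u x * 1"
          using u0[of x] by (intro mult_left_mono) auto
        then show ?thesis using Hmid[OF x, of z] 1 x by (simp add: Mid_def ennreal_leI)
      next
        case 2
        then show ?thesis using Hmid[OF x, of z] by (simp add: Mid_def)
      next
        case 3
        then have "H x z \<le> ennreal (1 / q)"
          unfolding H_def u_def using potential_tail_le[OF qr(1)] by (intro ennreal_leI)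
        then show ?thesis using 3 by (simp add: Mid_def add_increasing)
      qed
    qed
    then have "potential r (H x) 0 \<le> potential r (\<lambda>z. Mid x z + (ennreal (u x) + ennreal (1 / q) * indicator {x<..} z)) 0"
      by (rule potential_mono)
    also have "\<dots> = potential r (Mid x) 0 + (potential r (\<lambda>_. ennreal (u x)) 0 + ennreal (1 / q) * ennreal (potential_tail r x))"
      using ennreal_potential_tail[OF r, of x 0] by (simp add: potential_add potential_cmult)
    also have "\<dots> \<le> ennreal (c * u x * ((1 - exp (- (d * x))) / d)) + (ennreal (u x) * ennreal (1 / r) + ennreal (1 / q) * ennreal (potential_tail r x))"
      unfolding mid'[OF x] by (intro add_mono potential_le[OF r] order_refl)
    also have "\<dots> = ennreal (c * u x * ((1 - exp (- (d * x))) / d) + (u x * (1 / r) + 1 / q * potential_tail r x))"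
      using c u0[of x] d x r qr potential_tail_nonneg[of r x] by (simp add: ennreal_mult[symmetric])
    finally have "ennreal (u x) \<le> ennreal (potential_tail r x) +
      ennreal (r - q) * ennreal (c * u x * ((1 - exp (- (d * x))) / d) + (u x * (1 / r) + 1 / q * potential_tail r x))"
      unfolding res[of x] by (intro add_left_mono mult_left_mono) auto
    also have "\<dots> = ennreal (potential_tail r x + (r - q) * (c * u x * ((1 - exp (- (d * x))) / d) + (u x * (1 / r) + 1 / q * potential_tail r x)))"
      (is "_ + ennreal (r - q) * ennreal ?Z = _")
    proof -
      have "0 \<le> ?Z"
        using c u0[of x] d x r qr potential_tail_nonneg[of r x] by simp
      then show ?thesis
        using qr potential_tail_nonneg[of r x]
        by (simp only: ennreal_mult[symmetric] ennreal_plus[symmetric] mult_nonneg_nonneg diff_ge_0_iff_ge less_imp_le)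
    qed
    finally have "u x \<le> potential_tail r x + (r - q) * (c * u x * ((1 - exp (- (d * x))) / d) + (u x * (1 / r) + 1 / q * potential_tail r x))"
      using c u0[of x] d x r qr potential_tail_nonneg[of r x] by (subst (asm) ennreal_le_iff) simp_all
    then have "1 * u x \<le> (p * exp (- (d * x)) + (r - q) * (c * ((1 - exp (- (d * x))) / d) + 1 / r + 1 / q * (p * exp (- (d * x))))) * u x"
      unfolding ur by (simp only: distrib_right distrib_left mult_ac mult_1)
    then show ?thesis using u(2)[OF x] by (simp only: mult_le_cancel_right_pos)
  qed
  have "(\<lambda>n. p * exp (- (d * real n)) + (r - q) * (c * ((1 - exp (- (d * real n))) / d) + 1 / r + 1 / q * (p * exp (- (d * real n)))))
     \<longlonglongrightarrow> p * 0 + (r - q) * (c * ((1 - 0) / d) + 1 / r + 1 / q * (p * 0))"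
    by (intro tendsto_intros lim) (use d in auto)
  then have "1 \<le> p * 0 + (r - q) * (c * ((1 - 0) / d) + 1 / r + 1 / q * (p * 0))"
    by (rule LIMSEQ_le_const) (use up in auto)
  then have "1 \<le> (r - q) * (c / d + 1 / r)" by simp
  then have "1 * d \<le> (r - q) * (c / d + 1 / r) * d" using d by (intro mult_right_mono) auto
  also have "\<dots> = (r - q) * c + (r - q) / r * d" using d by (simp add: field_simps)
  finally have "d - (r - q) / r * d \<le> (r - q) * c" by simp
  moreover have "d - (r - q) / r * d = q / r * d" using r by (simp add: field_simps)
  ultimately show "q / r * (passage_exponent r - passage_exponent q) \<le> potential_rate r * (r - q)"
    by (simp add: c_def[symmetric] d_def[symmetric] mult.commute)
qed

text \<open>
  Both sides are left derivatives with respect to the discount rate, up to sign, of the two sides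
  of \<open>E (exp (- q \<rho>\<^sub>x)) = exp (- \<Phi>(q) x)\<close>. The difference quotients are taken along the sequence
  \<open>q n\<close>, which increases to \<open>r\<close> and stays above \<open>r / 2\<close>. On the left this bounds them by \<open>2 / r\<close>, so that the limit
  may be taken under the integral; on the right they are controlled by the bounds on the increments of \<open>\<Phi>\<close>.
\<close>
lemma passage_time_moment:
  assumes r: "0 < r" and x: "0 \<le> x"
  shows "(\<integral>\<^sup>+\<omega>. indicator {\<omega>. exceeds x \<omega>} \<omega> * ennreal (exceedance_time x \<omega> * exp (- (r * exceedance_time x \<omega>))) \<partial>M) =
    ennreal (x * potential_rate r * exp (- (passage_exponent r * x)))"
proof (rule LIMSEQ_unique)
  define e where "e n = 1 / real (Suc (Suc n))" for n
  define q where "q n = r * (1 - e n)" for n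
  define h where "h n = r * e n" for n
  have e: "0 < e n" "e n \<le> 1 / 2" for n by (simp_all add: e_def field_simps)
  have elim: "e \<longlonglongrightarrow> 0"
    using LIMSEQ_Suc[OF LIMSEQ_Suc[OF lim_1_over_n]] by (simp add: e_def[abs_def])
  have h: "0 < h n" "r - q n = h n" for n using r e[of n] by (simp_all add: h_def q_def algebra_simps)
  have q: "0 < q n" "q n < r" "r / 2 \<le> q n" for n
  proof -
    have "r * (1 / 2) \<le> r * (1 - e n)" using r e[of n] by (intro mult_left_mono) auto
    then show "0 < q n" "r / 2 \<le> q n" using r by (simp_all add: q_def)
    show "q n < r" using h[of n] by linarith
  qed
  have hlim: "h \<longlonglongrightarrow> 0" unfolding h_def[abs_def] using tendsto_mult_right[OF elim, of r] by (simp add: mult.commute)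
  let ?t = "exceedance_time x" and ?I = "\<lambda>\<omega>. indicator {\<omega>. exceeds x \<omega>} \<omega> :: ennreal"
  let ?g = "\<lambda>n \<omega>. (exp (- (q n * ?t \<omega>)) - exp (- (r * ?t \<omega>))) / h n"
  have t0: "0 \<le> ?t \<omega>" for \<omega> by (rule exceedance_time_nonneg)
  have geq: "?g n \<omega> = exp (- (r * ?t \<omega>)) * ((exp (h n * ?t \<omega>) - 1) / h n)" for n \<omega>
    by (simp add: h(2)[symmetric] right_diff_distrib exp_add[symmetric] algebra_simps)
  have glo: "?t \<omega> \<le> (exp (h n * ?t \<omega>) - 1) / h n" for n \<omega>
    using exp_minus_one_bounds(1)[of "h n * ?t \<omega>"] h(1)[of n] by (simp add: field_simps)
  have ghi: "(exp (h n * ?t \<omega>) - 1) / h n \<le> ?t \<omega> * exp (h n * ?t \<omega>)" for n \<omega>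
    using exp_minus_one_bounds(2)[of "h n * ?t \<omega>"] h(1)[of n] by (simp add: field_simps)
  have g0: "0 \<le> ?g n \<omega>" for n \<omega>
    unfolding geq using glo[of \<omega> n] t0[of \<omega>] by (intro mult_nonneg_nonneg) auto
  have gbound: "?g n \<omega> \<le> 2 / r" for n \<omega>
  proof -
    have "?g n \<omega> \<le> exp (- (r * ?t \<omega>)) * (?t \<omega> * exp (h n * ?t \<omega>))"
      unfolding geq by (intro mult_left_mono ghi) auto
    also have "\<dots> = ?t \<omega> * exp (- (q n * ?t \<omega>))"
      by (simp add: h(2)[symmetric] exp_add[symmetric] algebra_simps)
    also have "\<dots> \<le> ?t \<omega> * exp (- (r / 2 * ?t \<omega>))"
      using mult_right_mono[OF q(3)[of n] t0[of \<omega>]] t0[of \<omega>] by (intro mult_left_mono) simp_all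
    also have "\<dots> \<le> 2 / r"
    proof -
      have "r / 2 * ?t \<omega> \<le> exp (r / 2 * ?t \<omega>)" using exp_ge_add_one_self[of "r / 2 * ?t \<omega>"] by linarith
      then have "r / 2 * ?t \<omega> * exp (- (r / 2 * ?t \<omega>)) \<le> exp (r / 2 * ?t \<omega>) * exp (- (r / 2 * ?t \<omega>))"
        by (rule mult_right_mono) simp
      then show ?thesis using r by (simp add: exp_add[symmetric] field_simps)
    qed
    finally show ?thesis .
  qed
  have glim: "(\<lambda>n. ?g n \<omega>) \<longlonglongrightarrow> ?t \<omega> * exp (- (r * ?t \<omega>))" for \<omega>
  proof -
    have "(\<lambda>n. (exp (h n * ?t \<omega>) - 1) / h n) \<longlonglongrightarrow> ?t \<omega>"
    proof (rule tendsto_sandwich[where f="\<lambda>_. ?t \<omega>" and h="\<lambda>n. ?t \<omega> * exp (h n * ?t \<omega>)"])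
      have "(\<lambda>n. ?t \<omega> * exp (h n * ?t \<omega>)) \<longlonglongrightarrow> ?t \<omega> * exp (0 * ?t \<omega>)"
        by (intro tendsto_mult tendsto_exp tendsto_const hlim)
      then show "(\<lambda>n. ?t \<omega> * exp (h n * ?t \<omega>)) \<longlonglongrightarrow> ?t \<omega>" by simp
    qed (use glo ghi in simp_all)
    then have "(\<lambda>n. exp (- (r * ?t \<omega>)) * ((exp (h n * ?t \<omega>) - 1) / h n)) \<longlonglongrightarrow> exp (- (r * ?t \<omega>)) * ?t \<omega>"
      by (rule tendsto_mult[OF tendsto_const])
    then show ?thesis unfolding geq by (simp only: mult.commute)
  qed
  show "(\<lambda>n. \<integral>\<^sup>+\<omega>. ?I \<omega> * ennreal (?g n \<omega>) \<partial>M) \<longlonglongrightarrow> (\<integral>\<^sup>+\<omega>. ?I \<omega> * ennreal (?t \<omega> * exp (- (r * ?t \<omega>))) \<partial>M)"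
  proof (rule nn_integral_dominated_convergence[where w="\<lambda>_. ennreal (2 / r)"])
    show "AE \<omega> in M. ?I \<omega> * ennreal (?g n \<omega>) \<le> ennreal (2 / r)" for n
      using ennreal_leI[OF gbound] by (auto simp: indicator_def)
    show "AE \<omega> in M. (\<lambda>n. ?I \<omega> * ennreal (?g n \<omega>)) \<longlonglongrightarrow> ?I \<omega> * ennreal (?t \<omega> * exp (- (r * ?t \<omega>)))"
      by (intro AE_I2 ennreal_tendsto_cmult tendsto_ennrealI glim) (simp add: indicator_def)
  qed (measurable, simp_all add: emeasure_space_1)
  define L where "L s = exp (- (passage_exponent s * x))" for s
  have split: "(\<integral>\<^sup>+\<omega>. ?I \<omega> * ennreal (?g n \<omega>) \<partial>M) = ennreal ((L (q n) - L r) / h n)" for n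
  proof -
    have "ennreal (L (q n)) = passage_laplace (q n) x"
      using ennreal_passage_transform[OF q(1)] passage_transform_eq_exp[OF q(1) x] by (simp add: L_def)
    also have "\<dots> = (\<integral>\<^sup>+\<omega>. ?I \<omega> * ennreal (exp (- r * ?t \<omega>)) + ennreal (h n) * (?I \<omega> * ennreal (?g n \<omega>)) \<partial>M)"
      unfolding passage_laplace_def
    proof (rule nn_integral_cong)
      fix \<omega>
      have "exp (- q n * ?t \<omega>) = exp (- r * ?t \<omega>) + h n * ?g n \<omega>" using h(1)[of n] by simp
      then have "ennreal (exp (- q n * ?t \<omega>)) = ennreal (exp (- r * ?t \<omega>) + h n * ?g n \<omega>)"
        by (simp only:)
      also have "\<dots> = ennreal (exp (- r * ?t \<omega>)) + ennreal (h n * ?g n \<omega>)"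
        by (rule ennreal_plus[OF exp_ge_zero mult_nonneg_nonneg[OF less_imp_le[OF h(1)] g0]])
      also have "ennreal (h n * ?g n \<omega>) = ennreal (h n) * ennreal (?g n \<omega>)"
        by (rule ennreal_mult'[OF less_imp_le[OF h(1)]])
      finally have "ennreal (exp (- q n * ?t \<omega>)) = ennreal (exp (- r * ?t \<omega>)) + ennreal (h n) * ennreal (?g n \<omega>)" .
      then show "?I \<omega> * ennreal (exp (- q n * ?t \<omega>)) = ?I \<omega> * ennreal (exp (- r * ?t \<omega>)) + ennreal (h n) * (?I \<omega> * ennreal (?g n \<omega>))"
        by (auto simp: indicator_def)
    qed
    also have "\<dots> = passage_laplace r x + ennreal (h n) * (\<integral>\<^sup>+\<omega>. ?I \<omega> * ennreal (?g n \<omega>) \<partial>M)"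
      unfolding passage_laplace_def by (simp add: nn_integral_add nn_integral_cmult)
    also have "passage_laplace r x = ennreal (L r)"
      using ennreal_passage_transform[OF r] passage_transform_eq_exp[OF r x] by (simp add: L_def)
    finally have eq: "ennreal (L (q n)) = ennreal (L r) + ennreal (h n) * (\<integral>\<^sup>+\<omega>. ?I \<omega> * ennreal (?g n \<omega>) \<partial>M)" .
    have "(\<integral>\<^sup>+\<omega>. ?I \<omega> * ennreal (?g n \<omega>) \<partial>M) < top"
    proof -
      have "(\<integral>\<^sup>+\<omega>. ?I \<omega> * ennreal (?g n \<omega>) \<partial>M) \<le> (\<integral>\<^sup>+\<omega>. ennreal (2 / r) \<partial>M)"
        using ennreal_leI[OF gbound] by (intro nn_integral_mono) (auto simp: indicator_def)
      then show ?thesis by (simp add: emeasure_space_1 order_le_less_trans)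
    qed
    then obtain y where y: "0 \<le> y" "(\<integral>\<^sup>+\<omega>. ?I \<omega> * ennreal (?g n \<omega>) \<partial>M) = ennreal y"
      by (cases "\<integral>\<^sup>+\<omega>. ?I \<omega> * ennreal (?g n \<omega>) \<partial>M") auto
    have "L (q n) = L r + h n * y"
      using eq y(1) h(1)[of n] unfolding y(2)
      by (simp add: L_def ennreal_mult[symmetric] ennreal_plus[symmetric] del: ennreal_plus)
    then show ?thesis using y h(1)[of n] by simp
  qed
  define d where "d n = passage_exponent r - passage_exponent (q n)" for n
  define c where "c = potential_rate r"
  have c0: "0 < c" using potential_rate_pos[OF r] by (simp add: c_def)
  have d0: "0 < d n" and dlo: "c \<le> d n / h n" and dhi: "d n / h n \<le> c / (1 - e n)" for n
  proof -
    show "0 < d n" using potential_rate_bounds(1)[OF q(1,2)[of n]] by (simp add: d_def)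
    show "c \<le> d n / h n"
      using potential_rate_bounds(2)[OF q(1,2)[of n]] h[of n] by (simp add: d_def c_def field_simps)
    have "q n / r = 1 - e n" using r by (simp add: q_def)
    then have "(1 - e n) * d n \<le> c * h n"
      using potential_rate_bounds(3)[OF q(1,2)[of n]] h(2)[of n] by (simp add: d_def c_def)
    then show "d n / h n \<le> c / (1 - e n)"
      using h(1)[of n] e[of n] by (simp add: field_simps)
  qed
  have Leq: "(L (q n) - L r) / h n = L r * ((exp (d n * x) - 1) / h n)" for n
    by (simp add: L_def d_def right_diff_distrib exp_add[symmetric] algebra_simps)
  define up where "up n = x * (c / (1 - e n)) * exp (c / (1 - e n) * h n * x)" for n
  have lo: "x * c \<le> (exp (d n * x) - 1) / h n" for n
  proof -
    have "x * c \<le> x * (d n / h n)" using x dlo by (intro mult_left_mono) auto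
    also have "\<dots> = d n * x / h n" by simp
    also have "\<dots> \<le> (exp (d n * x) - 1) / h n"
      using exp_minus_one_bounds(1) h(1)[of n] by (intro divide_right_mono) auto
    finally show ?thesis .
  qed
  have hi: "(exp (d n * x) - 1) / h n \<le> up n" for n
  proof -
    have dh: "d n \<le> c / (1 - e n) * h n" using dhi[of n] h(1)[of n] by (simp only: pos_divide_le_eq)
    have "(exp (d n * x) - 1) / h n \<le> d n * x * exp (d n * x) / h n"
      using exp_minus_one_bounds(2) h(1)[of n] by (intro divide_right_mono) auto
    also have "\<dots> = x * (d n / h n) * exp (d n * x)" by simp
    also have "\<dots> \<le> x * (c / (1 - e n)) * exp (c / (1 - e n) * h n * x)"
    proof (rule mult_mono)
      show "x * (d n / h n) \<le> x * (c / (1 - e n))"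
        using x dhi by (intro mult_left_mono) auto
      show "exp (d n * x) \<le> exp (c / (1 - e n) * h n * x)"
        using mult_right_mono[OF dh x] by (simp only: exp_le_cancel_iff)
      show "0 \<le> x * (c / (1 - e n))"
        using x c0 e[of n] by simp
    qed simp
    finally show ?thesis by (simp add: up_def)
  qed
  have "up \<longlonglongrightarrow> x * (c / (1 - 0)) * exp (c / (1 - 0) * 0 * x)"
    unfolding up_def[abs_def] by (intro tendsto_intros elim hlim) auto
  then have "up \<longlonglongrightarrow> x * c" by simp
  have "(\<lambda>n. (exp (d n * x) - 1) / h n) \<longlonglongrightarrow> x * c"
    by (rule tendsto_sandwich[where f="\<lambda>_. x * c" and h=up]) (use lo hi \<open>up \<longlonglongrightarrow> x * c\<close> in simp_all)
  then have "(\<lambda>n. L r * ((exp (d n * x) - 1) / h n)) \<longlonglongrightarrow> L r * (x * c)"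
    by (intro tendsto_intros)
  then show "(\<lambda>n. \<integral>\<^sup>+\<omega>. ?I \<omega> * ennreal (?g n \<omega>) \<partial>M) \<longlonglongrightarrow> ennreal (x * potential_rate r * exp (- (passage_exponent r * x)))"
    unfolding split Leq by (intro tendsto_ennrealI) (simp add: L_def c_def mult_ac)
qed

section \<open>Kendall's identity for exceedance times\<close>

text \<open>
  The two measures to be compared have the same Laplace transform in time: for the exceedance times it is
  the moment computed above, and for the positions it is a potential on the positive half-line.
\<close>
lemma kendall_laplace:
  assumes r: "0 < r" and [measurable]: "A \<in> sets borel"
  shows "(\<integral>\<^sup>+x. (\<integral>\<^sup>+\<omega>. indicator {0<..} x * indicator A x * (indicator {\<omega>. exceeds x \<omega>} \<omega> *
        ennreal (exceedance_time x \<omega> * exp (- (r * exceedance_time x \<omega>)))) \<partial>M) \<partial>lborel) =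
    (\<integral>\<^sup>+z. indicator {0<..} z * indicator A z * ennreal (z * potential_rate r * exp (- (passage_exponent r * z))) \<partial>lborel)"
    (is "?L = ?C")
    and "(\<integral>\<^sup>+t. (\<integral>\<^sup>+\<omega>. indicator {0<..} t * ennreal (exp (- (r * t))) *
        (indicator {0<..} (Y t \<omega>) * indicator A (Y t \<omega>) * ennreal (Y t \<omega>)) \<partial>M) \<partial>lborel) =
    (\<integral>\<^sup>+z. indicator {0<..} z * indicator A z * ennreal (z * potential_rate r * exp (- (passage_exponent r * z))) \<partial>lborel)"
    (is "?R = ?C")
proof -
  show "?L = ?C"
  proof (rule nn_integral_cong)
    fix x :: real
    show "(\<integral>\<^sup>+\<omega>. indicator {0<..} x * indicator A x * (indicator {\<omega>. exceeds x \<omega>} \<omega> *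
        ennreal (exceedance_time x \<omega> * exp (- (r * exceedance_time x \<omega>)))) \<partial>M) =
      indicator {0<..} x * indicator A x * ennreal (x * potential_rate r * exp (- (passage_exponent r * x)))"
    proof (cases "0 < x")
      case True
      then show ?thesis
        using passage_time_moment[OF r, of x] by (subst nn_integral_cmult) simp_all
    qed simp
  qed
  have "?R = potential r (\<lambda>z. indicator {0<..} z * (indicator A z * ennreal z)) 0"
    unfolding potential_def
  proof (rule nn_integral_cong)
    fix t :: real
    have "(\<integral>\<^sup>+\<omega>. indicator {0<..} t * ennreal (exp (- (r * t))) *
        (indicator {0<..} (Y t \<omega>) * indicator A (Y t \<omega>) * ennreal (Y t \<omega>)) \<partial>M) =
      indicator {0<..} t * ennreal (exp (- (r * t))) *
        (\<integral>\<^sup>+\<omega>. indicator {0<..} (Y t \<omega>) * indicator A (Y t \<omega>) * ennreal (Y t \<omega>) \<partial>M)"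
      by (rule nn_integral_cmult) measurable
    also have "\<dots> = ennreal (exp (- r * t)) * indicator {0..} t *
        (\<integral>\<^sup>+\<omega>. indicator {0<..} (0 + Y t \<omega>) * (indicator A (0 + Y t \<omega>) * ennreal (0 + Y t \<omega>)) \<partial>M)"
      by (cases "0 < t"; cases "t = 0") (simp_all add: mult_ac)
    finally show "(\<integral>\<^sup>+\<omega>. indicator {0<..} t * ennreal (exp (- (r * t))) *
        (indicator {0<..} (Y t \<omega>) * indicator A (Y t \<omega>) * ennreal (Y t \<omega>)) \<partial>M) =
      ennreal (exp (- r * t)) * indicator {0..} t *
        (\<integral>\<^sup>+\<omega>. indicator {0<..} (0 + Y t \<omega>) * (indicator A (0 + Y t \<omega>) * ennreal (0 + Y t \<omega>)) \<partial>M)" .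
  qed
  also have "\<dots> = (\<integral>\<^sup>+z. ennreal (potential_rate r * exp (- (passage_exponent r * z))) * indicator {0<..} z *
      (indicator A z * ennreal z) \<partial>lborel)"
    by (rule potential_positive_half_line[OF r]) measurable
  also have "\<dots> = ?C"
  proof (rule nn_integral_cong)
    fix z :: real
    have "ennreal (potential_rate r * exp (- (passage_exponent r * z))) * ennreal z =
        ennreal (z * potential_rate r * exp (- (passage_exponent r * z)))" if "0 < z"
      using that potential_rate_pos[OF r] by (subst ennreal_mult[symmetric]) (simp_all add: mult_ac)
    then show "ennreal (potential_rate r * exp (- (passage_exponent r * z))) * indicator {0<..} z * (indicator A z * ennreal z) =
      indicator {0<..} z * indicator A z * ennreal (z * potential_rate r * exp (- (passage_exponent r * z)))"
      by (auto simp: indicator_def)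
  qed
  finally show "?R = ?C" .
qed

lemma kendall_laplace_finite:
  assumes r: "0 < r"
  shows "(\<integral>\<^sup>+z. indicator {0<..} z * indicator A z * ennreal (z * potential_rate r * exp (- (passage_exponent r * z))) \<partial>lborel) < \<infinity>"
proof -
  let ?d = "passage_exponent r / 2"
  have d: "0 < ?d" using passage_exponent_pos[OF r] by simp
  have "(\<integral>\<^sup>+z. indicator {0<..} z * indicator A z * ennreal (z * potential_rate r * exp (- (passage_exponent r * z))) \<partial>lborel)
     \<le> (\<integral>\<^sup>+z. ennreal (potential_rate r / ?d) * (ennreal (exp (- (?d * z))) * indicator {0..} z) \<partial>lborel)"
  proof (rule nn_integral_mono)
    fix z :: real
    show "indicator {0<..} z * indicator A z * ennreal (z * potential_rate r * exp (- (passage_exponent r * z)))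
       \<le> ennreal (potential_rate r / ?d) * (ennreal (exp (- (?d * z))) * indicator {0..} z)"
    proof (cases "0 < z \<and> z \<in> A")
      case True
      have "z * ?d \<le> exp (z * ?d)" using exp_ge_add_one_self[of "z * ?d"] by linarith
      then have "z * ?d * exp (- (?d * z)) \<le> exp (z * ?d) * exp (- (?d * z))"
        by (rule mult_right_mono) simp
      then have "z * ?d * exp (- (?d * z)) \<le> 1"
        by (simp add: exp_add[symmetric] mult.commute)
      then have "z * exp (- (?d * z)) \<le> 1 / ?d"
        using d by (simp only: pos_le_divide_eq mult.commute mult.assoc mult.left_commute)
      then have "z * exp (- (?d * z)) * (potential_rate r * exp (- (?d * z))) \<le> 1 / ?d * (potential_rate r * exp (- (?d * z)))"
        using potential_rate_pos[OF r] by (intro mult_right_mono) auto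
      moreover have "z * potential_rate r * exp (- (passage_exponent r * z)) =
          z * exp (- (?d * z)) * (potential_rate r * exp (- (?d * z)))"
        by (simp add: exp_add[symmetric])
      moreover have "1 / ?d * (potential_rate r * exp (- (?d * z))) = potential_rate r / ?d * exp (- (?d * z))"
        by simp
      ultimately have "ennreal (z * potential_rate r * exp (- (passage_exponent r * z))) \<le>
          ennreal (potential_rate r / ?d * exp (- (?d * z)))"
        by (intro ennreal_leI) (simp only:)
      also have "\<dots> = ennreal (potential_rate r / ?d) * ennreal (exp (- (?d * z)))"
        by (rule ennreal_mult'') simp
      finally show ?thesis using True by simp
    next
      case False
      then show ?thesis by (auto simp: indicator_def)
    qed
  qed
  also have "\<dots> = ennreal (potential_rate r / ?d) * ennreal (1 / ?d)"
    by (subst nn_integral_cmult) (use nn_integral_exp_from[OF d, of 0] in simp_all)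
  also have "\<dots> < \<infinity>" by (simp add: ennreal_mult_less_top)
  finally show ?thesis .
qed

text \<open>
  The measures \<open>t P(\<rho>\<^sub>x \<in> dt) dx\<close> and \<open>x P(Y\<^sub>t \<in> dx) dt\<close> on \<open>(0, \<infinity>)\<^sup>2\<close>, multiplied by \<open>exp (- t)\<close> to make
  them finite.
\<close>
definition passage_joint_law :: "(real \<times> real) measure" where
  "passage_joint_law = distr (density (lborel \<Otimes>\<^sub>M M)
     (\<lambda>p. indicator {0<..} (fst p) * ((if exceeds (fst p) (snd p) then 1 else 0) *
        ennreal (exceedance_time (fst p) (snd p) * exp (- exceedance_time (fst p) (snd p))))))
     (borel \<Otimes>\<^sub>M borel) (\<lambda>p. (exceedance_time (fst p) (snd p), fst p))"

definition position_joint_law :: "(real \<times> real) measure" where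
  "position_joint_law = distr (density (lborel \<Otimes>\<^sub>M M)
     (\<lambda>p. indicator {0<..} (fst p) * (indicator {0<..} (Y (fst p) (snd p)) *
        ennreal (Y (fst p) (snd p) * exp (- fst p)))))
     (borel \<Otimes>\<^sub>M borel) (\<lambda>p. (fst p, Y (fst p) (snd p)))"

lemma nn_integral_passage_joint_law:
  assumes [measurable]: "g \<in> borel_measurable (borel \<Otimes>\<^sub>M borel)"
  shows "(\<integral>\<^sup>+p. g p \<partial>passage_joint_law) =
    (\<integral>\<^sup>+x. (\<integral>\<^sup>+\<omega>. indicator {0<..} x * (indicator {\<omega>. exceeds x \<omega>} \<omega> *
       ennreal (exceedance_time x \<omega> * exp (- exceedance_time x \<omega>))) * g (exceedance_time x \<omega>, x) \<partial>M) \<partial>lborel)"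
proof -
  have "(\<integral>\<^sup>+p. g p \<partial>passage_joint_law) = (\<integral>\<^sup>+p. indicator {0<..} (fst p) * ((if exceeds (fst p) (snd p) then 1 else 0) *
        ennreal (exceedance_time (fst p) (snd p) * exp (- exceedance_time (fst p) (snd p)))) *
        g (exceedance_time (fst p) (snd p), fst p) \<partial>(lborel \<Otimes>\<^sub>M M))"
    unfolding passage_joint_law_def by (subst nn_integral_distr, measurable, subst nn_integral_density) simp_all
  also have "\<dots> = (\<integral>\<^sup>+x. (\<integral>\<^sup>+\<omega>. indicator {0<..} x * ((if exceeds x \<omega> then 1 else 0) *
        ennreal (exceedance_time x \<omega> * exp (- exceedance_time x \<omega>))) * g (exceedance_time x \<omega>, x) \<partial>M) \<partial>lborel)"
    by (subst nn_integral_fst[symmetric]) simp_all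
  moreover have "indicator {\<omega>. exceeds x \<omega>} \<omega> = (if exceeds x \<omega> then 1 else 0 :: ennreal)" for x \<omega>
    by (simp add: indicator_def)
  ultimately show ?thesis by (simp only:)
qed

lemma nn_integral_position_joint_law:
  assumes [measurable]: "g \<in> borel_measurable (borel \<Otimes>\<^sub>M borel)"
  shows "(\<integral>\<^sup>+p. g p \<partial>position_joint_law) =
    (\<integral>\<^sup>+t. (\<integral>\<^sup>+\<omega>. indicator {0<..} t * (indicator {0<..} (Y t \<omega>) *
       ennreal (Y t \<omega> * exp (- t))) * g (t, Y t \<omega>) \<partial>M) \<partial>lborel)"
proof -
  have "(\<integral>\<^sup>+p. g p \<partial>position_joint_law) = (\<integral>\<^sup>+p. indicator {0<..} (fst p) * (indicator {0<..} (Y (fst p) (snd p)) *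
        ennreal (Y (fst p) (snd p) * exp (- fst p))) * g (fst p, Y (fst p) (snd p)) \<partial>(lborel \<Otimes>\<^sub>M M))"
    unfolding position_joint_law_def by (subst nn_integral_distr, measurable, subst nn_integral_density) simp_all
  also have "\<dots> = (\<integral>\<^sup>+t. (\<integral>\<^sup>+\<omega>. indicator {0<..} t * (indicator {0<..} (Y t \<omega>) *
       ennreal (Y t \<omega> * exp (- t))) * g (t, Y t \<omega>) \<partial>M) \<partial>lborel)"
    by (subst nn_integral_fst[symmetric]) simp_all
  finally show ?thesis .
qed

text \<open>
  The Laplace transforms at \<open>n\<close> of these marginals are those of \<open>kendall_laplace\<close> at \<open>n + 1\<close>, since the
  factor \<open>exp (- t)\<close> is part of the joint laws.
\<close>
lemma time_marginals_eq:
  assumes [measurable]: "A \<in> sets borel"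
  shows "distr (density passage_joint_law (\<lambda>p. indicator A (snd p))) borel fst =
    distr (density position_joint_law (\<lambda>p. indicator A (snd p))) borel fst" (is "?N1 = ?N2")
    and "emeasure (distr (density passage_joint_law (\<lambda>p. indicator A (snd p))) borel fst) UNIV < \<infinity>"
proof -
  have [measurable_cong]: "sets passage_joint_law = sets (borel \<Otimes>\<^sub>M borel)"
    "sets position_joint_law = sets (borel \<Otimes>\<^sub>M borel)"
    by (simp_all add: passage_joint_law_def position_joint_law_def)
  have i1: "(\<integral>\<^sup>+t. g t \<partial>?N1) = (\<integral>\<^sup>+x. (\<integral>\<^sup>+\<omega>. indicator {0<..} x * (indicator {\<omega>. exceeds x \<omega>} \<omega> *
       ennreal (exceedance_time x \<omega> * exp (- exceedance_time x \<omega>))) * (indicator A x * g (exceedance_time x \<omega>)) \<partial>M) \<partial>lborel)"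
    if [measurable]: "g \<in> borel_measurable borel" for g
    using nn_integral_passage_joint_law[of "\<lambda>p. indicator A (snd p) * g (fst p)"]
    by (simp add: nn_integral_distr nn_integral_density)
  have i2: "(\<integral>\<^sup>+t. g t \<partial>?N2) = (\<integral>\<^sup>+t. (\<integral>\<^sup>+\<omega>. indicator {0<..} t * (indicator {0<..} (Y t \<omega>) *
       ennreal (Y t \<omega> * exp (- t))) * (indicator A (Y t \<omega>) * g t) \<partial>M) \<partial>lborel)"
    if [measurable]: "g \<in> borel_measurable borel" for g
    using nn_integral_position_joint_law[of "\<lambda>p. indicator A (snd p) * g (fst p)"]
    by (simp add: nn_integral_distr nn_integral_density)
  define C where "C r = (\<integral>\<^sup>+z. indicator {0<..} z * indicator A z * ennreal (z * potential_rate r * exp (- (passage_exponent r * z))) \<partial>lborel)" for r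
  have split: "ennreal (a * exp (- b)) * ennreal (exp (- real n * b)) = ennreal (a * exp (- (real (Suc n) * b)))" for a b n
    by (subst ennreal_mult''[symmetric]) (simp_all add: exp_add[symmetric] mult.assoc algebra_simps)
  have e1: "(\<integral>\<^sup>+t. ennreal (exp (- real n * t)) \<partial>?N1) = C (real (Suc n))" for n
  proof -
    have "(\<integral>\<^sup>+t. ennreal (exp (- real n * t)) \<partial>?N1) = (\<integral>\<^sup>+x. (\<integral>\<^sup>+\<omega>. indicator {0<..} x * indicator A x * (indicator {\<omega>. exceeds x \<omega>} \<omega> *
        ennreal (exceedance_time x \<omega> * exp (- (real (Suc n) * exceedance_time x \<omega>)))) \<partial>M) \<partial>lborel)"
      unfolding split[symmetric] by (subst i1) (measurable, simp add: mult_ac)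
    also have "\<dots> = C (real (Suc n))"
      unfolding C_def by (rule kendall_laplace(1)) simp_all
    finally show ?thesis .
  qed
  have e2: "(\<integral>\<^sup>+t. ennreal (exp (- real n * t)) \<partial>?N2) = C (real (Suc n))" for n
  proof -
    have *: "ennreal (y * exp (- t)) * ennreal (exp (- real n * t)) = ennreal (exp (- (real (Suc n) * t))) * ennreal y" for y t
      unfolding split by (simp add: ennreal_mult'' mult.commute)
    have "(\<integral>\<^sup>+t. ennreal (exp (- real n * t)) \<partial>?N2) = (\<integral>\<^sup>+t. (\<integral>\<^sup>+\<omega>. indicator {0<..} t * (indicator {0<..} (Y t \<omega>) * indicator A (Y t \<omega>) *
        (ennreal (Y t \<omega> * exp (- t)) * ennreal (exp (- real n * t)))) \<partial>M) \<partial>lborel)"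
      by (subst i2) (measurable, simp add: mult_ac)
    also have "\<dots> = (\<integral>\<^sup>+t. (\<integral>\<^sup>+\<omega>. indicator {0<..} t * ennreal (exp (- (real (Suc n) * t))) *
        (indicator {0<..} (Y t \<omega>) * indicator A (Y t \<omega>) * ennreal (Y t \<omega>)) \<partial>M) \<partial>lborel)"
      unfolding * by (simp add: mult_ac)
    also have "\<dots> = C (real (Suc n))"
      unfolding C_def by (rule kendall_laplace(2)) simp_all
    finally show ?thesis .
  qed
  have Cfin: "C (real (Suc n)) < \<infinity>" for n
    unfolding C_def by (rule kendall_laplace_finite) simp
  have m1: "emeasure ?N1 UNIV = C 1"
    using e1[of 0] nn_integral_indicator[of UNIV ?N1] by simp
  have m2: "emeasure ?N2 UNIV = C 1"
    using e2[of 0] nn_integral_indicator[of UNIV ?N2] by simp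
  show fin1: "emeasure ?N1 UNIV < \<infinity>"
    using m1 Cfin[of 0] by simp
  have pos: "AE t in N. 0 < t" if s: "sets N = sets borel" and z: "(\<integral>\<^sup>+t. indicator {..0} t \<partial>N) = 0" for N :: "real measure"
  proof (rule AE_I)
    show "emeasure N {..0} = 0" "{..0::real} \<in> sets N" using s z by simp_all
  qed auto
  show "?N1 = ?N2"
  proof (rule laplace_unique)
    show "finite_measure ?N1" "finite_measure ?N2"
      using m1 m2 Cfin[of 0] by (auto intro!: finite_measureI)
    have "indicator {0<..} x * (indicator {\<omega>. exceeds x \<omega>} \<omega> * ennreal (exceedance_time x \<omega> * exp (- exceedance_time x \<omega>))) *
       (indicator A x * indicator {..0} (exceedance_time x \<omega>)) = 0" for x \<omega>
      using exceedance_time_pos[of x \<omega>] by (auto simp: indicator_def)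
    then show "AE t in ?N1. 0 < t"
      by (intro pos) (simp, subst i1, simp_all only: nn_integral_const mult_zero_left, measurable)
    have "indicator {0<..} t * (indicator {0<..} (Y t \<omega>) * ennreal (Y t \<omega> * exp (- t))) * (indicator A (Y t \<omega>) * indicator {..0} t) = 0" for t \<omega>
      by (auto simp: indicator_def)
    then show "AE t in ?N2. 0 < t"
      by (intro pos) (simp, subst i2, simp_all only: nn_integral_const mult_zero_left, measurable)
  qed (simp_all only: e1 e2 sets_distr)
qed

lemma joint_laws_eq: "passage_joint_law = position_joint_law"
proof (rule measure_eqI_generator_eq)
  have s [measurable_cong]: "sets passage_joint_law = sets (borel \<Otimes>\<^sub>M borel)"
    "sets position_joint_law = sets (borel \<Otimes>\<^sub>M borel)"
    by (simp_all add: passage_joint_law_def position_joint_law_def)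
  let ?E = "{a \<times> b |a b. a \<in> sets (borel::real measure) \<and> b \<in> sets (borel::real measure)}"
  show "Int_stable ?E" by (rule Int_stable_pair_measure_generator)
  show "?E \<subseteq> Pow UNIV" by simp
  show "sets passage_joint_law = sigma_sets UNIV ?E" "sets position_joint_law = sigma_sets UNIV ?E"
    unfolding s by (simp_all add: sets_pair_measure)
  have rect: "emeasure passage_joint_law (a \<times> b) = emeasure (distr (density passage_joint_law (\<lambda>p. indicator b (snd p))) borel fst) a"
    "emeasure position_joint_law (a \<times> b) = emeasure (distr (density position_joint_law (\<lambda>p. indicator b (snd p))) borel fst) a"
    if [measurable]: "a \<in> sets borel" "b \<in> sets borel" for a b
  proof -
    have *: "emeasure J (a \<times> b) = emeasure (distr (density J (\<lambda>p. indicator b (snd p))) borel fst) a"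
      if [measurable_cong]: "sets J = sets (borel \<Otimes>\<^sub>M borel)" for J :: "(real \<times> real) measure"
    proof -
      have sp: "space J = UNIV" using sets_eq_imp_space_eq[OF that] by (simp add: space_pair_measure)
      have "emeasure (distr (density J (\<lambda>p. indicator b (snd p))) borel fst) a =
          (\<integral>\<^sup>+p. indicator b (snd p) * indicator (fst -` a) p \<partial>J)"
        by (subst emeasure_distr, simp, simp, subst emeasure_density)
          (simp_all add: sp measurable_sets[of fst J borel a, unfolded sp, simplified])
      also have "\<dots> = (\<integral>\<^sup>+p. indicator (a \<times> b) p \<partial>J)"
        by (intro nn_integral_cong) (auto simp: indicator_def)
      also have "\<dots> = emeasure J (a \<times> b)" by simp
      finally show ?thesis by simp
    qed
    show "emeasure passage_joint_law (a \<times> b) = emeasure (distr (density passage_joint_law (\<lambda>p. indicator b (snd p))) borel fst) a"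
      "emeasure position_joint_law (a \<times> b) = emeasure (distr (density position_joint_law (\<lambda>p. indicator b (snd p))) borel fst) a"
      by (rule *, rule s)+
  qed
  show "emeasure passage_joint_law X = emeasure position_joint_law X" if "X \<in> ?E" for X
    using that by (auto simp: rect time_marginals_eq(1))
  show "range (\<lambda>_::nat. UNIV \<times> UNIV) \<subseteq> ?E"
    by (intro image_subsetI CollectI exI conjI, rule refl) simp_all
  show "(\<Union>i::nat. UNIV \<times> UNIV) = UNIV" by simp
  show "emeasure passage_joint_law (UNIV \<times> UNIV) \<noteq> \<infinity>"
    using time_marginals_eq(2)[of UNIV] rect(1)[of UNIV UNIV] by simp
qed

text \<open>
  Integrate \<open>exp t / t\<close> over \<open>B\<close> with respect to the two equal joint laws. On the left the weight cancels
  because \<open>\<rho>\<^sub>x > 0\<close> for \<open>x > 0\<close>.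
\<close>
lemma kendall_exceedance:
  assumes [measurable]: "B \<in> sets (borel \<Otimes>\<^sub>M borel)"
  shows "(\<integral>\<^sup>+x. (\<integral>\<^sup>+\<omega>. indicator {0<..} x * (indicator {\<omega>. exceeds x \<omega>} \<omega> * indicator B (exceedance_time x \<omega>, x)) \<partial>M) \<partial>lborel) =
    (\<integral>\<^sup>+t. (\<integral>\<^sup>+\<omega>. indicator {0<..} t * (indicator {0<..} (Y t \<omega>) * ennreal (Y t \<omega> / t) * indicator B (t, Y t \<omega>)) \<partial>M) \<partial>lborel)"
proof -
  have "(\<integral>\<^sup>+p. ennreal (exp (fst p) / fst p) * indicator B p \<partial>passage_joint_law) =
    (\<integral>\<^sup>+p. ennreal (exp (fst p) / fst p) * indicator B p \<partial>position_joint_law)"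
    unfolding joint_laws_eq ..
  also have "(\<integral>\<^sup>+p. ennreal (exp (fst p) / fst p) * indicator B p \<partial>passage_joint_law) =
    (\<integral>\<^sup>+x. (\<integral>\<^sup>+\<omega>. indicator {0<..} x * (indicator {\<omega>. exceeds x \<omega>} \<omega> * indicator B (exceedance_time x \<omega>, x)) \<partial>M) \<partial>lborel)"
  proof (subst nn_integral_passage_joint_law, measurable, intro nn_integral_cong)
    fix x \<omega>
    show "indicator {0<..} x * (indicator {\<omega>. exceeds x \<omega>} \<omega> * ennreal (exceedance_time x \<omega> * exp (- exceedance_time x \<omega>))) *
        (ennreal (exp (fst (exceedance_time x \<omega>, x)) / fst (exceedance_time x \<omega>, x)) * indicator B (exceedance_time x \<omega>, x)) =
      indicator {0<..} x * (indicator {\<omega>. exceeds x \<omega>} \<omega> * indicator B (exceedance_time x \<omega>, x))"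
    proof (cases "0 < x \<and> exceeds x \<omega>")
      case True
      then have "0 < exceedance_time x \<omega>" using exceedance_time_pos by blast
      then have "ennreal (exceedance_time x \<omega> * exp (- exceedance_time x \<omega>)) * ennreal (exp (exceedance_time x \<omega>) / exceedance_time x \<omega>) = 1"
        by (subst ennreal_mult[symmetric]) (simp_all add: exp_minus)
      then show ?thesis using True by (simp add: mult.assoc[symmetric])
    qed auto
  qed
  also have "(\<integral>\<^sup>+p. ennreal (exp (fst p) / fst p) * indicator B p \<partial>position_joint_law) =
    (\<integral>\<^sup>+t. (\<integral>\<^sup>+\<omega>. indicator {0<..} t * (indicator {0<..} (Y t \<omega>) * ennreal (Y t \<omega> / t) * indicator B (t, Y t \<omega>)) \<partial>M) \<partial>lborel)"
  proof (subst nn_integral_position_joint_law, measurable, intro nn_integral_cong)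
    fix t \<omega>
    show "indicator {0<..} t * (indicator {0<..} (Y t \<omega>) * ennreal (Y t \<omega> * exp (- t))) *
        (ennreal (exp (fst (t, Y t \<omega>)) / fst (t, Y t \<omega>)) * indicator B (t, Y t \<omega>)) =
      indicator {0<..} t * (indicator {0<..} (Y t \<omega>) * ennreal (Y t \<omega> / t) * indicator B (t, Y t \<omega>))"
    proof (cases "0 < t \<and> 0 < Y t \<omega>")
      case True
      then have "ennreal (Y t \<omega> * exp (- t)) * ennreal (exp t / t) = ennreal (Y t \<omega> / t)"
        by (subst ennreal_mult[symmetric]) (simp_all add: exp_minus)
      then show ?thesis using True by (simp add: mult.assoc[symmetric])
    qed auto
  qed
  finally show ?thesis .
qed

section \<open>Hitting times and exceedance times\<close>

text \<open>
  A path may reach \<open>x\<close> as a left limit and jump down, or touch \<open>x\<close> without exceeding it, so the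
  equality fails on exceptional paths. But \<open>T\<^sub>x\<close> is at least \<open>\<rho>\<^sub>y\<close> for all \<open>y < x\<close>, and at
  most \<open>\<rho>\<^sub>x\<close> if the latter is finite. With \<open>K y = exp (- \<rho>\<^sub>y)\<close> (or \<open>0\<close> if \<open>y\<close> is never exceeded), the infimum of \<open>K y\<close>
  over a sequence increasing to \<open>x\<close> dominates \<open>K x\<close> and has at most the same expectation, because the expectation
  of \<open>K\<close> depends continuously on the level. Hence the two are almost surely equal.
\<close>
lemma hitting_time_eq_exceedance_time:
  assumes x: "0 < x"
  shows "AE \<omega> in M. Inf {ereal s |s. 0 \<le> s \<and> Y s \<omega> = x} =
    (if exceeds x \<omega> then ereal (exceedance_time x \<omega>) else \<infinity>)"
proof -
  define K where "K y \<omega> = indicator {\<omega>. exceeds y \<omega>} \<omega> * ennreal (exp (- 1 * exceedance_time y \<omega>))" for y \<omega>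
  have [measurable]: "K y \<in> borel_measurable M" for y unfolding K_def[abs_def] by measurable
  define y where "y n = x - x / real (Suc n)" for n
  have y: "0 \<le> y n" "y n < x" for n using x by (simp_all add: y_def field_simps)
  have ylim: "y \<longlonglongrightarrow> x"
    using tendsto_diff[OF tendsto_const[of x] tendsto_mult_left[OF LIMSEQ_Suc[OF lim_1_over_n], of x]]
    by (simp add: y_def[abs_def])
  have intK: "(\<integral>\<^sup>+\<omega>. K z \<omega> \<partial>M) = ennreal (exp (- (passage_exponent 1 * z)))" if "0 \<le> z" for z
    using ennreal_passage_transform[of 1 z] passage_transform_eq_exp[of 1 z] that
    by (simp add: K_def passage_laplace_def)
  define I where "I \<omega> = (INF n. K (y n) \<omega>)" for \<omega>
  have [measurable]: "I \<in> borel_measurable M" unfolding I_def[abs_def] by measurable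
  have KI: "K x \<omega> \<le> I \<omega>" for \<omega>
    unfolding I_def
  proof (rule INF_greatest)
    fix n show "K x \<omega> \<le> K (y n) \<omega>"
      using exceedance_mono[OF less_imp_le[OF y(2)], of \<omega> n] by (auto simp: K_def indicator_def)
  qed
  have "(\<integral>\<^sup>+\<omega>. I \<omega> \<partial>M) \<le> (\<integral>\<^sup>+\<omega>. K x \<omega> \<partial>M)"
  proof (rule LIMSEQ_le_const)
    show "(\<lambda>n. \<integral>\<^sup>+\<omega>. K (y n) \<omega> \<partial>M) \<longlonglongrightarrow> (\<integral>\<^sup>+\<omega>. K x \<omega> \<partial>M)"
      unfolding intK[OF y(1)] intK[OF less_imp_le[OF x]]
      by (intro tendsto_ennrealI tendsto_intros ylim)
    show "\<exists>N. \<forall>n\<ge>N. (\<integral>\<^sup>+\<omega>. I \<omega> \<partial>M) \<le> (\<integral>\<^sup>+\<omega>. K (y n) \<omega> \<partial>M)"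
      unfolding I_def by (intro exI allI impI nn_integral_mono INF_lower) simp
  qed
  moreover have fin: "(\<integral>\<^sup>+\<omega>. K x \<omega> \<partial>M) \<noteq> \<infinity>" using intK[of x] x by simp
  ultimately have "(\<integral>\<^sup>+\<omega>. I \<omega> - K x \<omega> \<partial>M) = 0"
    using KI by (subst nn_integral_diff) (auto simp: diff_eq_0_iff_ennreal less_top)
  then have "AE \<omega> in M. I \<omega> - K x \<omega> = 0"
    by (subst (asm) nn_integral_0_iff_AE) auto
  then show ?thesis
  proof eventually_elim
    case (elim \<omega>)
    have "K x \<omega> < top" by (auto simp: K_def indicator_def)
    then have IK: "I \<omega> \<le> K x \<omega>" using elim by (auto simp: diff_eq_0_iff_ennreal)
    have hit: "exceeds x \<omega> \<and> exceedance_time x \<omega> \<le> s" if s: "0 \<le> s" "Y s \<omega> = x" for s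
    proof -
      have "ennreal (exp (- s)) \<le> I \<omega>"
        unfolding I_def
      proof (rule INF_greatest)
        fix n show "ennreal (exp (- s)) \<le> K (y n) \<omega>"
          using exceedance_time_le[of s "y n" \<omega>] y(2)[of n] s by (simp add: K_def)
      qed
      then have "ennreal (exp (- s)) \<le> K x \<omega>" using IK by (rule order_trans)
      then show ?thesis by (cases "exceeds x \<omega>") (simp_all add: K_def)
    qed
    show ?case
    proof (cases "exceeds x \<omega>")
      case True
      then have "Inf {ereal s |s. 0 \<le> s \<and> Y s \<omega> = x} = ereal (exceedance_time x \<omega>)"
        using hit Y_exceedance_time[OF True less_imp_le[OF x]] exceedance_time_nonneg[of x \<omega>]
        by (intro antisym Inf_lower Inf_greatest) auto
      then show ?thesis using True by simp
    next
      case False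
      then have empty: "{ereal s |s. 0 \<le> s \<and> Y s \<omega> = x} = {}" using hit by blast
      show ?thesis unfolding empty using False by (simp add: top_ereal_def)
    qed
  qed
qed

end

section \<open>Passage from Levy processes to skip-free versions\<close>

lemma (in prob_space) indep_var_nn_integral:
  assumes ind: "indep_var S A T B" and [measurable]: "g \<in> borel_measurable (S \<Otimes>\<^sub>M T)"
  shows "(\<integral>\<^sup>+\<omega>. g (A \<omega>, B \<omega>) \<partial>M) = (\<integral>\<^sup>+\<omega>. (\<integral>\<^sup>+\<omega>'. g (A \<omega>, B \<omega>') \<partial>M) \<partial>M)"
proof -
  have [measurable]: "A \<in> measurable M S" "B \<in> measurable M T"
    using indep_var_rv1[OF ind] indep_var_rv2[OF ind] by auto
  have eq: "distr M S A \<Otimes>\<^sub>M distr M T B = distr M (S \<Otimes>\<^sub>M T) (\<lambda>x. (A x, B x))"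
    using ind unfolding indep_var_distribution_eq by blast
  interpret B: prob_space "distr M T B" by (rule prob_space_distr) measurable
  have "(\<integral>\<^sup>+\<omega>. g (A \<omega>, B \<omega>) \<partial>M) = (\<integral>\<^sup>+p. g p \<partial>(distr M S A \<Otimes>\<^sub>M distr M T B))"
    unfolding eq by (simp add: nn_integral_distr)
  also have "\<dots> = (\<integral>\<^sup>+a. (\<integral>\<^sup>+b. g (a, b) \<partial>distr M T B) \<partial>distr M S A)"
    by (rule B.nn_integral_fst[symmetric]) measurable
  also have "\<dots> = (\<integral>\<^sup>+\<omega>. (\<integral>\<^sup>+b. g (A \<omega>, b) \<partial>distr M T B) \<partial>M)"
    by (rule nn_integral_distr) measurable
  also have "\<dots> = (\<integral>\<^sup>+\<omega>. (\<integral>\<^sup>+\<omega>'. g (A \<omega>, B \<omega>') \<partial>M) \<partial>M)"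
    by (intro nn_integral_cong nn_integral_distr)
       (use measurable_space[OF \<open>A \<in> measurable M S\<close>] in measurable)
  finally show ?thesis .
qed

text \<open>
  The vector of increments up to time \<open>b\<close>, over a partition that contains \<open>F\<close>, \<open>0\<close> and \<open>b\<close>, is independent
  of the increment from \<open>b\<close> to \<open>b + u\<close>, and the values at the times in \<open>F\<close> are partial sums of the former.
\<close>
lemma levy_markov:
  assumes levy: "levy_process M X"
    and F: "finite F" "F \<subseteq> {0..b}" and b: "0 \<le> b" and u: "0 \<le> u"
    and [measurable]: "f \<in> borel_measurable borel"
  shows "(\<integral>\<^sup>+\<omega>. indicator {\<omega>. \<exists>s\<in>F. x < - X s \<omega>} \<omega> * f (- X (b + u) \<omega>) \<partial>M) =
    (\<integral>\<^sup>+\<omega>. indicator {\<omega>. \<exists>s\<in>F. x < - X s \<omega>} \<omega> * (\<integral>\<^sup>+\<omega>'. f (- X b \<omega> - (X u \<omega>' - X 0 \<omega>')) \<partial>M) \<partial>M)"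
proof -
  interpret prob_space M using levy by (simp add: levy_process_def)
  have Xm: "X t \<in> borel_measurable M" if "0 \<le> t" for t
    using levy that by (simp add: levy_process_def)
  define T where "T = insert 0 (insert b F)"
  define ts where "ts = sorted_list_of_set T"
  have "finite T" using F by (simp add: T_def)
  then have ts: "set ts = T" "sorted ts" by (simp_all add: ts_def)
  have "ts \<noteq> []" using ts(1) by (auto simp: T_def)
  define n where "n = length ts - 1"
  have len: "length ts = Suc n" using \<open>ts \<noteq> []\<close> by (cases ts) (simp_all add: n_def)
  have T: "T \<subseteq> {0..b}" using F b by (auto simp: T_def)
  define \<tau> where "\<tau> i = (if i \<le> n then ts ! i else b + u)" for i
  have \<tau>T: "\<tau> i \<in> T" if "i \<le> n" for i
    using that nth_mem[of i ts] len ts(1) by (simp add: \<tau>_def)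
  have \<tau>0: "0 \<le> \<tau> i" for i
    using \<tau>T[of i] T b u by (cases "i \<le> n") (auto simp: \<tau>_def)
  have "mono \<tau>"
  proof (rule monoI)
    fix i j :: nat assume "i \<le> j"
    show "\<tau> i \<le> \<tau> j"
    proof (cases "j \<le> n")
      case True
      then show ?thesis using \<open>i \<le> j\<close> sorted_nth_mono[OF ts(2), of i j] len by (simp add: \<tau>_def)
    next
      case False
      then show ?thesis using \<tau>T[of i] T u by (cases "i \<le> n") (auto simp: \<tau>_def)
    qed
  qed
  have \<tau>n: "\<tau> n = b"
  proof (rule antisym)
    show "\<tau> n \<le> b" using \<tau>T[of n] T by auto
    obtain k where "k < length ts" "ts ! k = b"
      using ts(1) by (metis T_def in_set_conv_nth insertI1 insertI2)
    then show "b \<le> \<tau> n" using sorted_nth_mono[OF ts(2), of k n] len by (simp add: \<tau>_def)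
  qed
  have F\<tau>: "(\<exists>s\<in>F. P s) \<longleftrightarrow> (\<exists>i\<in>{..n}. \<tau> i \<in> F \<and> P (\<tau> i))" for P
  proof
    assume "\<exists>s\<in>F. P s"
    then obtain s where s: "s \<in> F" "P s" by blast
    then have "s \<in> set ts" using ts(1) by (simp add: T_def)
    then obtain k where "k < length ts" "ts ! k = s" by (metis in_set_conv_nth)
    then show "\<exists>i\<in>{..n}. \<tau> i \<in> F \<and> P (\<tau> i)"
      using s len by (intro bexI[of _ k]) (auto simp: \<tau>_def)
  qed blast
  define Z where "Z i \<omega> = (case i of 0 \<Rightarrow> X (\<tau> 0) \<omega> | Suc j \<Rightarrow> X (\<tau> (Suc j)) \<omega> - X (\<tau> j) \<omega>)" for i \<omega>
  have "indep_vars (\<lambda>_. borel) Z {..Suc n}"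
    using levy \<tau>0[of 0] \<open>mono \<tau>\<close> unfolding levy_process_def Z_def[abs_def] by blast
  then have ind: "indep_var (PiM {..n} (\<lambda>_. borel)) (\<lambda>\<omega>. restrict (\<lambda>i. Z i \<omega>) {..n})
      (PiM {Suc n} (\<lambda>_. borel)) (\<lambda>\<omega>. restrict (\<lambda>i. Z i \<omega>) {Suc n})"
    by (rule indep_var_restrict) auto
  have tele: "(\<Sum>j\<le>i. Z j \<omega>) = X (\<tau> i) \<omega>" for i \<omega>
    by (induction i) (simp_all add: Z_def)
  define S where "S i w = (if i \<le> n then \<Sum>j\<le>i. w j else 0)" for i and w :: "nat \<Rightarrow> real"
  have [measurable]: "S i \<in> borel_measurable (PiM {..n} (\<lambda>_. borel))" for i
  proof (cases "i \<le> n")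
    case True
    then have "S i = (\<lambda>w. \<Sum>j\<le>i. w j)" by (simp add: S_def fun_eq_iff)
    moreover have "(\<lambda>w::nat \<Rightarrow> real. \<Sum>j\<le>i. w j) \<in> borel_measurable (PiM {..n} (\<lambda>_. borel))"
      using True by (intro borel_measurable_sum measurable_component_singleton) auto
    ultimately show ?thesis by simp
  qed (simp add: S_def[abs_def])
  have SX: "S i (restrict (\<lambda>i. Z i \<omega>) {..n}) = X (\<tau> i) \<omega>" if "i \<le> n" for i \<omega>
    using that tele[of \<omega> i] by (simp add: S_def)
  define g where "g p = (if \<exists>i\<in>{..n}. \<tau> i \<in> F \<and> x < - S i (fst p) then 1 else 0) *
      f (- S n (fst p) - snd p (Suc n))" for p :: "(nat \<Rightarrow> real) \<times> (nat \<Rightarrow> real)"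
  have [measurable]: "(\<lambda>p. snd p (Suc n)) \<in> borel_measurable (PiM {..n} (\<lambda>_. borel) \<Otimes>\<^sub>M PiM {Suc n} (\<lambda>_. borel :: real measure))"
    by (rule measurable_compose[OF measurable_snd]) simp
  have [measurable]: "g \<in> borel_measurable (PiM {..n} (\<lambda>_. borel) \<Otimes>\<^sub>M PiM {Suc n} (\<lambda>_. borel))"
    unfolding g_def[abs_def] by measurable
  have gX: "g (restrict (\<lambda>i. Z i \<omega>) {..n}, restrict (\<lambda>i. Z i \<omega>') {Suc n}) =
      indicator {\<omega>. \<exists>s\<in>F. x < - X s \<omega>} \<omega> * f (- X b \<omega> - (X (b + u) \<omega>' - X b \<omega>'))" for \<omega> \<omega>'
  proof -
    have "Z (Suc n) \<omega>' = X (b + u) \<omega>' - X b \<omega>'"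
      using \<tau>n by (simp add: Z_def) (simp add: \<tau>_def)
    moreover have "(\<exists>i\<in>{..n}. \<tau> i \<in> F \<and> x < - S i (restrict (\<lambda>i. Z i \<omega>) {..n})) \<longleftrightarrow> (\<exists>s\<in>F. x < - X s \<omega>)"
      unfolding F\<tau>[of "\<lambda>s. x < - X s \<omega>"] using SX[of _ \<omega>] by (intro bex_cong) auto
    ultimately show ?thesis
      using SX[of n \<omega>] \<tau>n by (simp add: g_def indicator_def)
  qed
  have law: "(\<integral>\<^sup>+\<omega>'. h (X (b + u) \<omega>' - X b \<omega>') \<partial>M) = (\<integral>\<^sup>+\<omega>'. h (X u \<omega>' - X 0 \<omega>') \<partial>M)"
    if [measurable]: "h \<in> borel_measurable borel" for h
  proof -
    have [measurable]: "X (b + u) \<in> borel_measurable M" "X b \<in> borel_measurable M"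
      "X u \<in> borel_measurable M" "X 0 \<in> borel_measurable M"
      using Xm b u by auto
    have "distr M borel (\<lambda>\<omega>. X (b + u) \<omega> - X b \<omega>) = distr M borel (\<lambda>\<omega>. X u \<omega> - X 0 \<omega>)"
      using levy b u by (simp add: levy_process_def)
    then have "(\<integral>\<^sup>+v. h v \<partial>distr M borel (\<lambda>\<omega>. X (b + u) \<omega> - X b \<omega>)) =
        (\<integral>\<^sup>+v. h v \<partial>distr M borel (\<lambda>\<omega>. X u \<omega> - X 0 \<omega>))" by simp
    then show ?thesis by (simp add: nn_integral_distr)
  qed
  have "(\<integral>\<^sup>+\<omega>. indicator {\<omega>. \<exists>s\<in>F. x < - X s \<omega>} \<omega> * f (- X (b + u) \<omega>) \<partial>M) =
      (\<integral>\<^sup>+\<omega>. g (restrict (\<lambda>i. Z i \<omega>) {..n}, restrict (\<lambda>i. Z i \<omega>) {Suc n}) \<partial>M)"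
    unfolding gX by simp
  also have "\<dots> = (\<integral>\<^sup>+\<omega>. (\<integral>\<^sup>+\<omega>'. g (restrict (\<lambda>i. Z i \<omega>) {..n}, restrict (\<lambda>i. Z i \<omega>') {Suc n}) \<partial>M) \<partial>M)"
    by (rule indep_var_nn_integral[OF ind]) measurable
  also have "\<dots> = (\<integral>\<^sup>+\<omega>. indicator {\<omega>. \<exists>s\<in>F. x < - X s \<omega>} \<omega> * (\<integral>\<^sup>+\<omega>'. f (- X b \<omega> - (X (b + u) \<omega>' - X b \<omega>')) \<partial>M) \<partial>M)"
    unfolding gX using Xm[of b] Xm[of "b + u"] b u by (intro nn_integral_cong nn_integral_cmult) simp
  also have "\<dots> = (\<integral>\<^sup>+\<omega>. indicator {\<omega>. \<exists>s\<in>F. x < - X s \<omega>} \<omega> * (\<integral>\<^sup>+\<omega>'. f (- X b \<omega> - (X u \<omega>' - X 0 \<omega>')) \<partial>M) \<partial>M)"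
  proof (rule nn_integral_cong)
    fix \<omega>
    show "indicator {\<omega>. \<exists>s\<in>F. x < - X s \<omega>} \<omega> * (\<integral>\<^sup>+\<omega>'. f (- X b \<omega> - (X (b + u) \<omega>' - X b \<omega>')) \<partial>M) =
      indicator {\<omega>. \<exists>s\<in>F. x < - X s \<omega>} \<omega> * (\<integral>\<^sup>+\<omega>'. f (- X b \<omega> - (X u \<omega>' - X 0 \<omega>')) \<partial>M)"
      using law[of "\<lambda>v. f (- X b \<omega> - v)"] by simp
  qed
  finally show ?thesis .
qed

text \<open>
  By stationarity every increment is almost surely nonnegative, hence all increments between rational
  times are so simultaneously, and right-continuity extends this to all times.
\<close>
lemma subordinator_if_nonneg:
  assumes levy: "levy_process M X" and nonneg: "\<And>h. 0 \<le> h \<Longrightarrow> AE \<omega> in M. 0 \<le> X h \<omega> - X 0 \<omega>"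
  shows "subordinator M X"
proof -
  interpret prob_space M using levy by (simp add: levy_process_def)
  have Xm: "X t \<in> borel_measurable M" if "0 \<le> t" for t
    using levy that by (simp add: levy_process_def)
  have incr: "AE \<omega> in M. X s \<omega> \<le> X t \<omega>" if st: "0 \<le> s" "s \<le> t" for s t
  proof -
    have [measurable]: "X s \<in> borel_measurable M" "X t \<in> borel_measurable M"
      "X (t - s) \<in> borel_measurable M" "X 0 \<in> borel_measurable M"
      using Xm st by auto
    have "distr M borel (\<lambda>\<omega>. X (s + (t - s)) \<omega> - X s \<omega>) = distr M borel (\<lambda>\<omega>. X (t - s) \<omega> - X 0 \<omega>)"
      using levy st unfolding levy_process_def by (meson diff_ge_0_iff_ge)
    then have eq: "distr M borel (\<lambda>\<omega>. X t \<omega> - X s \<omega>) = distr M borel (\<lambda>\<omega>. X (t - s) \<omega> - X 0 \<omega>)" by simp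
    have "AE v in distr M borel (\<lambda>\<omega>. X (t - s) \<omega> - X 0 \<omega>). 0 \<le> v"
      using nonneg[of "t - s"] st by (subst AE_distr_iff) auto
    then have "AE v in distr M borel (\<lambda>\<omega>. X t \<omega> - X s \<omega>). 0 \<le> v" unfolding eq .
    then show ?thesis by (subst (asm) AE_distr_iff) auto
  qed
  have "AE \<omega> in M. 0 \<le> real_of_rat a \<longrightarrow> real_of_rat a \<le> real_of_rat b \<longrightarrow> X (real_of_rat a) \<omega> \<le> X (real_of_rat b) \<omega>" for a b :: rat
    using incr[of "real_of_rat a" "real_of_rat b"] by (cases "0 \<le> real_of_rat a \<and> real_of_rat a \<le> real_of_rat b") auto
  then have "AE \<omega> in M. \<forall>a b::rat. 0 \<le> real_of_rat a \<longrightarrow> real_of_rat a \<le> real_of_rat b \<longrightarrow> X (real_of_rat a) \<omega> \<le> X (real_of_rat b) \<omega>"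
    by (simp add: AE_all_countable)
  moreover have "AE \<omega> in M. cadlag (\<lambda>t. X t \<omega>)"
    using levy by (simp add: levy_process_def)
  ultimately have "AE \<omega> in M. mono_on {0..} (\<lambda>t. X t \<omega>)"
  proof eventually_elim
    case (elim \<omega>)
    have rc: "((\<lambda>s. X s \<omega>) \<longlongrightarrow> X t \<omega>) (at_right t)" if "0 \<le> t" for t
      using elim(2) that by (simp add: cadlag_def continuous_within)
    show ?case
    proof (rule mono_onI, rule ccontr)
      fix s t :: real assume st: "s \<in> {0..}" "t \<in> {0..}" "s \<le> t" "\<not> X s \<omega> \<le> X t \<omega>"
      then have lt: "s < t" by (cases "s = t") auto
      define m where "m = (X s \<omega> + X t \<omega>) / 2"
      have m: "X t \<omega> < m" "m < X s \<omega>" using st by (simp_all add: m_def)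
      have "eventually (\<lambda>r. m < X r \<omega>) (at_right s)" "eventually (\<lambda>r. X r \<omega> < m) (at_right t)"
        using order_tendstoD(1)[OF rc m(2)] order_tendstoD(2)[OF rc m(1)] st by auto
      then obtain b c where b: "s < b" "\<And>r. s < r \<Longrightarrow> r < b \<Longrightarrow> m < X r \<omega>"
        and c: "t < c" "\<And>r. t < r \<Longrightarrow> r < c \<Longrightarrow> X r \<omega> < m"
        using eventually_at_right[of s "s + 1"] eventually_at_right[of t "t + 1"] by auto
      obtain p where p: "s < real_of_rat p" "real_of_rat p < min b t"
        using of_rat_dense[of s "min b t"] b(1) lt by auto
      obtain r where r: "t < real_of_rat r" "real_of_rat r < c"
        using of_rat_dense[OF c(1)] by auto
      have "0 \<le> real_of_rat p" using p(1) st(1) by (simp only: atLeast_iff)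
      moreover have "real_of_rat p \<le> real_of_rat r" using p(2) r(1) by linarith
      ultimately have "X (real_of_rat p) \<omega> \<le> X (real_of_rat r) \<omega>" using elim(1) by blast
      then show False using b(2)[OF p(1)] c(2)[OF r] p(2) by simp
    qed
  qed
  then show ?thesis using levy by (simp add: subordinator_def)
qed

text \<open>
  On one null set, outside of which the paths are regular and start at \<open>0\<close>, the process is replaced by
  the constant \<open>0\<close>. This changes the hitting times only on a null set, and leaves all laws unchanged.
\<close>
lemma spectrally_positive_regular_version:
  assumes levy: "levy_process M X" and "spectrally_positive M X"
    and "measure M {\<omega> \<in> space M. X 0 \<omega> = 0} = 1" and "\<not> subordinator M X"
  obtains Y where "skip_free_process M Y" "AE \<omega> in M. \<forall>t\<ge>0. Y t \<omega> = - X t \<omega>"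
proof -
  interpret prob_space M using levy by (simp add: levy_process_def)
  have Xm: "X t \<in> borel_measurable M" if "0 \<le> t" for t
    using levy that by (simp add: levy_process_def)
  have [measurable]: "X 0 \<in> borel_measurable M" by (rule Xm) simp
  have X0: "AE \<omega> in M. X 0 \<omega> = 0"
    using prob_eq_1[of "{\<omega> \<in> space M. X 0 \<omega> = 0}"] assms(3) by simp
  have "AE \<omega> in M. cadlag (\<lambda>t. X t \<omega>) \<and> no_negative_jumps (\<lambda>t. X t \<omega>) \<and> X 0 \<omega> = 0"
    using X0 assms(2) levy by (auto simp: spectrally_positive_def levy_process_def)
  then obtain N where N: "{\<omega> \<in> space M. \<not> (cadlag (\<lambda>t. X t \<omega>) \<and> no_negative_jumps (\<lambda>t. X t \<omega>) \<and> X 0 \<omega> = 0)} \<subseteq> N"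
      "emeasure M N = 0" "N \<in> sets M"
    by (rule AE_E)
  define G where "G = space M - N"
  have [measurable]: "G \<in> sets M" using N(3) by (simp add: G_def)
  have G: "cadlag (\<lambda>t. X t \<omega>)" "no_negative_jumps (\<lambda>t. X t \<omega>)" "X 0 \<omega> = 0" if "\<omega> \<in> G" for \<omega>
    using that N(1) by (auto simp: G_def)
  have AEG: "AE \<omega> in M. \<omega> \<in> G"
    by (rule AE_I[OF _ N(2,3)]) (auto simp: G_def)
  define Y where "Y t \<omega> = (if \<omega> \<in> G \<and> 0 \<le> t then - X t \<omega> else 0)" for t \<omega>
  have YX: "AE \<omega> in M. \<forall>t\<ge>0. Y t \<omega> = - X t \<omega>"
    using AEG by eventually_elim (simp add: Y_def)
  have "skip_free_process M Y"
  proof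
    fix t show "Y t \<in> borel_measurable M"
      using Xm[of t] by (cases "0 \<le> t") (simp_all add: Y_def[abs_def])
  next
    fix t :: real and \<omega> assume "t \<le> 0"
    then show "Y t \<omega> = 0" using G(3)[of \<omega>] by (cases "t = 0") (auto simp: Y_def)
  next
    fix t :: real and \<omega> assume t: "0 \<le> t"
    show "((\<lambda>s. Y s \<omega>) \<longlongrightarrow> Y t \<omega>) (at_right t)"
    proof (cases "\<omega> \<in> G")
      case True
      have "((\<lambda>s. - X s \<omega>) \<longlongrightarrow> - X t \<omega>) (at_right t)"
        using G(1)[OF True] t by (intro tendsto_minus) (simp add: cadlag_def continuous_within)
      moreover have "eventually (\<lambda>s. - X s \<omega> = Y s \<omega>) (at_right t)"
        using t True by (auto simp: eventually_at_filter Y_def)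
      ultimately show ?thesis
        using True t by (subst tendsto_cong[symmetric]) (auto simp: Y_def)
    qed (simp add: Y_def)
  next
    fix t x :: real and \<omega> assume t: "0 < t" and le: "\<And>s. 0 \<le> s \<Longrightarrow> s < t \<Longrightarrow> Y s \<omega> \<le> x"
    show "Y t \<omega> \<le> x"
    proof (cases "\<omega> \<in> G")
      case True
      obtain l where l: "((\<lambda>s. X s \<omega>) \<longlongrightarrow> l) (at_left t)"
        using G(1)[OF True] t by (auto simp: cadlag_def)
      have "eventually (\<lambda>s. s \<in> {0<..<t}) (at_left t)"
        using t by (rule eventually_at_left_real)
      then have "eventually (\<lambda>s. - x \<le> X s \<omega>) (at_left t)"
      proof eventually_elim
        case (elim s)
        then show ?case using le[of s] True by (simp add: Y_def)
      qed
      then have "- x \<le> l"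
        using l by (intro tendsto_lowerbound) auto
      moreover have "l \<le> X t \<omega>"
        using G(2)[OF True] l t by (auto simp: no_negative_jumps_def)
      ultimately show ?thesis using True t by (simp add: Y_def)
    next
      case False
      then show ?thesis using le[of 0] t by (simp add: Y_def)
    qed
  next
    fix F :: "real set" and b u x :: real and f :: "real \<Rightarrow> ennreal"
    assume F: "finite F" "F \<subseteq> {0..b}" "0 \<le> b" "0 \<le> u" and [measurable]: "f \<in> borel_measurable (borel :: real measure)"
    have "(\<integral>\<^sup>+\<omega>. indicator {\<omega>. \<exists>s\<in>F. x < Y s \<omega>} \<omega> * f (Y (b + u) \<omega>) \<partial>M) =
        (\<integral>\<^sup>+\<omega>. indicator {\<omega>. \<exists>s\<in>F. x < - X s \<omega>} \<omega> * f (- X (b + u) \<omega>) \<partial>M)"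
      using AEG
    proof (intro nn_integral_cong_AE, eventually_elim)
      case (elim \<omega>)
      then have "Y s \<omega> = - X s \<omega>" if "0 \<le> s" for s using that by (simp add: Y_def)
      then show ?case using F by (auto simp: indicator_def subset_eq)
    qed
    also have "\<dots> = (\<integral>\<^sup>+\<omega>. indicator {\<omega>. \<exists>s\<in>F. x < - X s \<omega>} \<omega> * (\<integral>\<^sup>+\<omega>'. f (- X b \<omega> - (X u \<omega>' - X 0 \<omega>')) \<partial>M) \<partial>M)"
      by (rule levy_markov[OF levy F]) measurable
    also have "\<dots> = (\<integral>\<^sup>+\<omega>. indicator {\<omega>. \<exists>s\<in>F. x < Y s \<omega>} \<omega> * (\<integral>\<^sup>+\<omega>'. f (Y b \<omega> + Y u \<omega>') \<partial>M) \<partial>M)"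
      using AEG
    proof (intro nn_integral_cong_AE, eventually_elim)
      case (elim \<omega>)
      then have Y: "Y s \<omega> = - X s \<omega>" if "0 \<le> s" for s using that by (simp add: Y_def)
      have "(\<integral>\<^sup>+\<omega>'. f (- X b \<omega> - (X u \<omega>' - X 0 \<omega>')) \<partial>M) = (\<integral>\<^sup>+\<omega>'. f (Y b \<omega> + Y u \<omega>') \<partial>M)"
        using AEG by (intro nn_integral_cong_AE, eventually_elim) (use F Y G(3) in \<open>simp add: Y_def\<close>)
      then show ?case using F Y by (auto simp: indicator_def subset_eq)
    qed
    finally show "(\<integral>\<^sup>+\<omega>. indicator {\<omega>. \<exists>s\<in>F. x < Y s \<omega>} \<omega> * f (Y (b + u) \<omega>) \<partial>M) =
      (\<integral>\<^sup>+\<omega>. indicator {\<omega>. \<exists>s\<in>F. x < Y s \<omega>} \<omega> * (\<integral>\<^sup>+\<omega>'. f (Y b \<omega> + Y u \<omega>') \<partial>M) \<partial>M)" .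
  next
    show "\<not> (AE \<omega> in M. \<forall>t\<ge>0. Y t \<omega> \<le> 0)"
    proof
      assume a: "AE \<omega> in M. \<forall>t\<ge>0. Y t \<omega> \<le> 0"
      have "AE \<omega> in M. 0 \<le> X h \<omega> - X 0 \<omega>" if "0 \<le> h" for h
        using a YX X0 by eventually_elim (use that in force)
      then show False using subordinator_if_nonneg[OF levy] assms(4) by blast
    qed
  qed
  then show ?thesis using that YX by blast
qed

section \<open>Kendall's identity for hitting times\<close>

lemma emeasure_completion_AE_eq:
  assumes B: "B \<in> sets M" and AE: "AE \<omega> in M. \<omega> \<in> A \<longleftrightarrow> \<omega> \<in> B" and A: "A \<subseteq> space M"
  shows "emeasure (completion M) A = emeasure M B"
proof -
  obtain N where N: "{\<omega> \<in> space M. \<not> (\<omega> \<in> A \<longleftrightarrow> \<omega> \<in> B)} \<subseteq> N" "emeasure M N = 0" "N \<in> sets M"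
    using AE by (rule AE_E)
  have null: "N \<in> null_sets M" using N by auto
  have "A = (B - N) \<union> (A \<inter> N)"
    using N(1) A sets.sets_into_space[OF B] by auto
  then have As: "A \<in> sets (completion M)"
    using sets_completionI[of A "B - N" "A \<inter> N" N M] null B N(3) by auto
  have "emeasure (completion M) A = emeasure (completion M) B"
  proof (rule emeasure_eq_AE)
    show "AE \<omega> in completion M. (\<omega> \<in> A) = (\<omega> \<in> B)" using AE by (rule AE_completion)
  qed (use As B in auto)
  then show ?thesis using B by simp
qed

theorem theorem2:
  fixes M :: "'a measure" and X :: "real \<Rightarrow> 'a \<Rightarrow> real"
  assumes "levy_process M X"
    and "spectrally_positive M X"
    and "measure M {\<omega> \<in> space M. X 0 \<omega> = 0} = 1"
    and "\<not> subordinator M X"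
  shows "\<forall>B \<in> sets (borel :: (real \<times> real) measure). B \<subseteq> {0<..} \<times> {0<..} \<longrightarrow>
           passage_time_measure M X B = kendall_measure M X B"
proof (intro ballI impI)
  fix B :: "(real \<times> real) set"
  assume "B \<in> sets borel" "B \<subseteq> {0<..} \<times> {0<..}"
  then have [measurable]: "B \<in> sets (borel \<Otimes>\<^sub>M borel)" by (simp only: borel_prod)
  obtain Y where "skip_free_process M Y" and YX: "AE \<omega> in M. \<forall>t\<ge>0. Y t \<omega> = - X t \<omega>"
    using spectrally_positive_regular_version[OF assms] by blast
  then interpret Y: skip_free_process M Y by simp
  have Xm: "X t \<in> borel_measurable M" if "0 \<le> t" for t
    using assms(1) that by (simp add: levy_process_def)
  have "passage_time_measure M X B =
    (\<integral>\<^sup>+x. (\<integral>\<^sup>+\<omega>. indicator {0<..} x * (indicator {\<omega>. Y.exceeds x \<omega>} \<omega> * indicator B (Y.exceedance_time x \<omega>, x)) \<partial>M) \<partial>lborel)"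
    unfolding passage_time_measure_def
  proof (rule nn_integral_cong)
    fix x :: real
    show "emeasure (completion M) {\<omega> \<in> space M. \<exists>t. passage_time X x \<omega> = ereal t \<and> (t, x) \<in> B} * indicator {0<..} x =
      (\<integral>\<^sup>+\<omega>. indicator {0<..} x * (indicator {\<omega>. Y.exceeds x \<omega>} \<omega> * indicator B (Y.exceedance_time x \<omega>, x)) \<partial>M)"
    proof (cases "0 < x")
      case True
      let ?S = "{\<omega> \<in> space M. Y.exceeds x \<omega> \<and> (Y.exceedance_time x \<omega>, x) \<in> B}"
      have "AE \<omega> in M. passage_time X x \<omega> = (if Y.exceeds x \<omega> then ereal (Y.exceedance_time x \<omega>) else \<infinity>)"
        using Y.hitting_time_eq_exceedance_time[OF True] YX
      proof eventually_elim
        case (elim \<omega>)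
        have "{ereal s |s. 0 \<le> s \<and> X s \<omega> = - x} = {ereal s |s. 0 \<le> s \<and> Y s \<omega> = x}"
          using elim(2) by force
        then show ?case using elim(1) by (simp add: passage_time_def)
      qed
      then have AE_eq: "AE \<omega> in M. \<omega> \<in> {\<omega> \<in> space M. \<exists>t. passage_time X x \<omega> = ereal t \<and> (t, x) \<in> B} \<longleftrightarrow> \<omega> \<in> ?S"
        by eventually_elim auto
      have "?S \<in> sets M" by measurable
      from emeasure_completion_AE_eq[OF this AE_eq]
      have "emeasure (completion M) {\<omega> \<in> space M. \<exists>t. passage_time X x \<omega> = ereal t \<and> (t, x) \<in> B} = emeasure M ?S"
        by blast
      also have "\<dots> = (\<integral>\<^sup>+\<omega>. indicator ?S \<omega> \<partial>M)"
        using \<open>?S \<in> sets M\<close> by simp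
      also have "\<dots> = (\<integral>\<^sup>+\<omega>. indicator {0<..} x * (indicator {\<omega>. Y.exceeds x \<omega>} \<omega> * indicator B (Y.exceedance_time x \<omega>, x)) \<partial>M)"
        using True by (intro nn_integral_cong) (auto simp: indicator_def)
      finally show ?thesis using True by simp
    qed simp
  qed
  also have "\<dots> = (\<integral>\<^sup>+t. (\<integral>\<^sup>+\<omega>. indicator {0<..} t * (indicator {0<..} (Y t \<omega>) * ennreal (Y t \<omega> / t) * indicator B (t, Y t \<omega>)) \<partial>M) \<partial>lborel)"
    by (rule Y.kendall_exceedance) measurable
  also have "\<dots> = kendall_measure M X B"
    unfolding kendall_measure_def
  proof (rule nn_integral_cong)
    fix t :: real
    show "(\<integral>\<^sup>+\<omega>. indicator {0<..} t * (indicator {0<..} (Y t \<omega>) * ennreal (Y t \<omega> / t) * indicator B (t, Y t \<omega>)) \<partial>M) =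
      (\<integral>\<^sup>+x\<in>{0<..}. ennreal (x / t) * indicator B (t, x) \<partial>distr M borel (\<lambda>\<omega>. - X t \<omega>)) * indicator {0<..} t"
    proof (cases "0 < t")
      case True
      have [measurable]: "X t \<in> borel_measurable M" using Xm True by simp
      have "(\<integral>\<^sup>+x\<in>{0<..}. ennreal (x / t) * indicator B (t, x) \<partial>distr M borel (\<lambda>\<omega>. - X t \<omega>)) =
          (\<integral>\<^sup>+\<omega>. ennreal (- X t \<omega> / t) * indicator B (t, - X t \<omega>) * indicator {0<..} (- X t \<omega>) \<partial>M)"
        by (rule nn_integral_distr) measurable
      also have "\<dots> = (\<integral>\<^sup>+\<omega>. indicator {0<..} t * (indicator {0<..} (Y t \<omega>) * ennreal (Y t \<omega> / t) * indicator B (t, Y t \<omega>)) \<partial>M)"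
        using YX by (intro nn_integral_cong_AE, eventually_elim) (use True in \<open>simp add: mult_ac\<close>)
      finally show ?thesis using True by simp
    qed simp
  qed
  finally show "passage_time_measure M X B = kendall_measure M X B" .
qed

end
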